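(* Let $\mathcal{A}$ be the quandle algebra, with $(X,\bullet,e)$ being a group. Let $\mathcal{R}=\sum_{a\in X}h_a\otimes q_a$ be a solution of the Yang-Baxter equation and let $q:X\to\mathcal{A}$, $a\mapsto q_a$, be a strong group homomorphism (i.e. $q_aq_b=q_{a\bullet b}$ for all $a,b\in X$). Then the structure $(\mathcal{A},\Delta,\epsilon,S,\mathcal{R})$ is a quasi-triangular Hopf algebra, where: - co-product $\Delta:\mathcal{A}\to\mathcal{A}\otimes\mathcal{A}$: $\Delta(q_a^{\pm1})=q_a^{\pm1}\otimes q_a^{\pm1}$ and $\Delta(h_a)=\sum_{b,c\in X,\ b\bullet c=a}h_b\otimes h_c$; - co-unit $\epsilon:\mathcal{A}\to k$: $\epsilon(q_a^{\pm1})=1$, $\epsilon(h_a)=\delta_{a,e}$; - antipode $S:\mathcal{A}\to\mathcal{A}$: $S(q_a^{\pm1})=q_a^{\mp1}$, $S(h_a)=h_{a^*}$, where $a^*$ is the inverse of $a$ in $(X,\bullet)$.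
   Context: Rack algebra: let $(X,\triangleright)$ be a magma that is finite, or such that $a\triangleright:b\mapsto a\triangleright b$ is surjective for every $a\in X$. The rack algebra is a unital associative algebra $\mathcal{A}$ over a field $k$ generated by indeterminates $1_{\mathcal{A}}$ (the unit), $q_a,q_a^{-1},h_a$ ($a\in X$), with $h_a=h_b\Leftrightarrow a=b$, subject to the relations, for all $a,b\in X$: $q_a^{-1}q_a=q_aq_a^{-1}=1_{\mathcal{A}}$, $\ q_aq_b=q_bq_{b\triangleright a}$, $\ h_ah_b=\delta_{a,b}h_a^2$, $\ q_bh_{b\triangleright a}=h_aq_b$. Quandle algebra: a rack algebra such that there is a left quasigroup $(X,\bullet)$ with $a\bullet b=b\bullet(b\triangleright a)$ for all $a,b\in X$. In the claim this $(X,\bullet)$ is a group with identity $e$. Standing conventions: the element $\sum_{a\in X}h_a$ is central and is normalized to $\sum_{a\in X}h_a=1_{\mathcal{A}}$, so that $h_a^2=h_a$; $X$ is finite or countably infinite (for infinite $X$ sums over $X$ are understood formally). The Yang-Baxter equation is $\mathcal{R}_{12}\mathcal{R}_{13}\mathcal{R}_{23}=\mathcal{R}_{23}\mathcal{R}_{13}\mathcal{R}_{12}$. Quasi-triangularity means: $\mathcal{R}$ is invertible, $(\mathrm{id}\otimes\Delta)\mathcal{R}=\mathcal{R}_{13}\mathcal{R}_{12}$, $(\Delta\otimes\mathrm{id})\mathcal{R}=\mathcal{R}_{13}\mathcal{R}_{23}$, and $\Delta^{(op)}(x)\mathcal{R}=\mathcal{R}\Delta(x)$ for all $x\in\mathcal{A}$,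 with $\Delta^{(op)}=\pi\circ\Delta$, $\pi$ the flip. *)

theory Defs
  imports Complex_Main "HOL-Library.Countable" "HOL-Library.Poly_Mapping"
begin

section \<open>Presented algebras\<close>

datatype 'g word = Word (letters: "'g list")

instantiation word :: (type) monoid_add
begin
definition zero_word :: "'a word" where "zero_word = Word []"
definition plus_word :: "'a word \<Rightarrow> 'a word \<Rightarrow> 'a word" where
  "plus_word u v = Word (letters u @ letters v)"
instance by standard (auto simp: zero_word_def plus_word_def)
end

text \<open>The free unital associative algebra over \<open>'k\<close> on the set \<open>'g\<close> is the monoid algebra
  of the free monoid; its ring structure is the library's convolution product.\<close>

type_synonym ('g, 'k) free_alg = "'g word \<Rightarrow>\<^sub>0 'k"

definition gen_var :: "'g \<Rightarrow> ('g, 'k::field) free_alg" where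
  "gen_var g = Poly_Mapping.single (Word [g]) 1"

inductive_set two_sided_ideal :: "'r::ring_1 set \<Rightarrow> 'r set" for E where
  zero: "0 \<in> two_sided_ideal E"
| base: "r \<in> E \<Longrightarrow> r \<in> two_sided_ideal E"
| add: "r \<in> two_sided_ideal E \<Longrightarrow> s \<in> two_sided_ideal E \<Longrightarrow> r + s \<in> two_sided_ideal E"
| mult: "r \<in> two_sided_ideal E \<Longrightarrow> p * r * s \<in> two_sided_ideal E"

datatype 'x rack_gen = GQ 'x | GQinv 'x | GH 'x

text \<open>An algebra over \<open>'k\<close> on the ring \<open>'a\<close>, with elements \<open>q\<^sub>a\<close>, \<open>q\<^sub>a\<^sup>-\<^sup>1\<close>, \<open>h\<^sub>a\<close>
  indexed by \<open>'x\<close>.\<close>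

record ('x, 'k, 'a) rack_alg =
  smul :: "'k \<Rightarrow> 'a \<Rightarrow> 'a"
  qgen :: "'x \<Rightarrow> 'a"
  qinv :: "'x \<Rightarrow> 'a"
  hgen :: "'x \<Rightarrow> 'a"

fun gen_val :: "('x, 'k, 'a) rack_alg \<Rightarrow> 'x rack_gen \<Rightarrow> 'a" where
  "gen_val A (GQ a) = qgen A a"
| "gen_val A (GQinv a) = qinv A a"
| "gen_val A (GH a) = hgen A a"

definition eval_alg :: "('x, 'k::field, 'a::ring_1) rack_alg \<Rightarrow> ('x rack_gen, 'k) free_alg \<Rightarrow> 'a" where
  "eval_alg A p = (\<Sum>w\<in>Poly_Mapping.keys p.
     smul A (Poly_Mapping.lookup p w) (prod_list (map (gen_val A) (letters w))))"

definition k_algebra :: "('k::field \<Rightarrow> 'a::ring_1 \<Rightarrow> 'a) \<Rightarrow> bool" where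
  "k_algebra s \<longleftrightarrow> vector_space s \<and> (\<forall>c x y. s c x * y = s c (x * y) \<and> x * s c y = s c (x * y))"

text \<open>\<open>A\<close> is (a copy of) the free algebra on the generators modulo the two-sided ideal
  generated by the relators \<open>E\<close>.\<close>

definition presented_by :: "('x, 'k::field, 'a::ring_1) rack_alg \<Rightarrow> ('x rack_gen, 'k) free_alg set \<Rightarrow> bool" where
  "presented_by A E \<longleftrightarrow> k_algebra (smul A) \<and> surj (eval_alg A) \<and>
     (\<forall>p. eval_alg A p = 0 \<longleftrightarrow> p \<in> two_sided_ideal E)"

section \<open>Rack and quandle algebras\<close>

definition rack_relators :: "('x \<Rightarrow> 'x \<Rightarrow> 'x) \<Rightarrow> ('x rack_gen, 'k::field) free_alg set" where
  "rack_relators tr =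
     (\<Union>a. {gen_var (GQinv a) * gen_var (GQ a) - 1, gen_var (GQ a) * gen_var (GQinv a) - 1}) \<union>
     (\<Union>a b. {gen_var (GQ a) * gen_var (GQ b) - gen_var (GQ b) * gen_var (GQ (tr b a)),
             gen_var (GH a) * gen_var (GH b) - (if a = b then gen_var (GH a) ^ 2 else 0),
             gen_var (GQ b) * gen_var (GH (tr b a)) - gen_var (GH a) * gen_var (GQ b)})"

text \<open>The normalization \<open>\<Sum>\<^sub>a h\<^sub>a = 1\<close>. For infinite index set it is not a relation between
  elements of the algebra: there it is a formal identity, which holds in the completion used
  below (lemma \<open>formal_normalization\<close>), and only its consequence \<open>h\<^sub>a\<^sup>2 = h\<^sub>a\<close> is imposed on the algebra.\<close>

definition norm_relators :: "('x rack_gen, 'k::field) free_alg set" where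
  "norm_relators = (\<Union>a. {gen_var (GH a) ^ 2 - gen_var (GH a)}) \<union>
     (if finite (UNIV :: 'x set) then {(\<Sum>a\<in>UNIV. gen_var (GH a)) - 1} else {})"

text \<open>The relations saying that \<open>q\<close> is a strong group homomorphism.\<close>

definition strong_hom_relators :: "('x \<Rightarrow> 'x \<Rightarrow> 'x) \<Rightarrow> ('x rack_gen, 'k::field) free_alg set" where
  "strong_hom_relators bul = (\<Union>a b. {gen_var (GQ a) * gen_var (GQ b) - gen_var (GQ (bul a b))})"

text \<open>The (normalized) rack algebra of the magma \<open>tr\<close>, subject to further relations \<open>E\<close>.\<close>

definition rack_algebra :: "('x, 'k::field, 'a::ring_1) rack_alg \<Rightarrow> ('x \<Rightarrow> 'x \<Rightarrow> 'x) \<Rightarrow>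
    ('x rack_gen, 'k) free_alg set \<Rightarrow> bool" where
  "rack_algebra A tr E \<longleftrightarrow>
     (finite (UNIV :: 'x set) \<or> (\<forall>a. surj (tr a))) \<and>
     (\<forall>a b. hgen A a = hgen A b \<longleftrightarrow> a = b) \<and>
     presented_by A (rack_relators tr \<union> norm_relators \<union> E)"

definition left_quasigroup :: "('x \<Rightarrow> 'x \<Rightarrow> 'x) \<Rightarrow> bool" where
  "left_quasigroup bul \<longleftrightarrow> (\<forall>a. bij (bul a))"

definition quandle_algebra :: "('x, 'k::field, 'a::ring_1) rack_alg \<Rightarrow> ('x \<Rightarrow> 'x \<Rightarrow> 'x) \<Rightarrow>
    ('x \<Rightarrow> 'x \<Rightarrow> 'x) \<Rightarrow> ('x rack_gen, 'k) free_alg set \<Rightarrow> bool" where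
  "quandle_algebra A tr bul E \<longleftrightarrow> rack_algebra A tr E \<and> left_quasigroup bul \<and>
     (\<forall>a b. bul a b = bul b (tr b a))"

section \<open>Tensors and formal sums\<close>

definition multilinear :: "('k::field \<Rightarrow> 'a::ab_group_add \<Rightarrow> 'a) \<Rightarrow> ('k \<Rightarrow> 'w::ab_group_add \<Rightarrow> 'w) \<Rightarrow>
    nat \<Rightarrow> ('a list \<Rightarrow> 'w) \<Rightarrow> bool" where
  "multilinear s s' n f \<longleftrightarrow> (\<forall>xs i x y c. length xs = n \<longrightarrow> i < n \<longrightarrow>
     f (xs[i := x + y]) = f (xs[i := x]) + f (xs[i := y]) \<and> f (xs[i := s c x]) = s' c (f (xs[i := x])))"

text \<open>Multilinear forms on \<open>A\<^sup>n\<close> that depend on their arguments only through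
  \<open>(\<Sum>a\<in>F. h\<^sub>a) x\<^sub>i\<close> for some finite \<open>F\<close>. If the index set is finite, then \<open>\<Sum>\<^sub>a h\<^sub>a = 1\<close> and
  these are all multilinear forms (lemma \<open>forms_finite\<close>).\<close>

definition forms :: "('x, 'k::field, 'a::ring_1) rack_alg \<Rightarrow> nat \<Rightarrow> ('a list \<Rightarrow> 'k) set" where
  "forms A n = {f. multilinear (smul A) (*) n f \<and>
     (\<exists>F. finite F \<and> (\<forall>xs. length xs = n \<longrightarrow> f xs = f (map (\<lambda>x. (\<Sum>a\<in>F. hgen A a) * x) xs)))}"

text \<open>Tensors are realized as functionals on multilinear forms, \<open>x\<^sub>1 \<otimes> \<dots> \<otimes> x\<^sub>n\<close> being evaluation
  at \<open>(x\<^sub>1,\<dots>,x\<^sub>n)\<close>. Multilinear forms over a field separate the elements of the tensor power, so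
  for a finite index set the span \<open>alg_tensors A n\<close> of the pure tensors is the usual \<open>A\<^sup>\<otimes>\<^sup>n\<close>
  (lemma \<open>alg_tensors_universal\<close>). Formal sums are pointwise locally finite sums.\<close>

type_synonym ('k, 'a) tens = "('a list \<Rightarrow> 'k) \<Rightarrow> 'k"

definition pure :: "('x, 'k::field, 'a::ring_1) rack_alg \<Rightarrow> 'a list \<Rightarrow> ('k, 'a) tens" where
  "pure A xs = (\<lambda>f. if f \<in> forms A (length xs) then f xs else 0)"

definition has_formal_sum :: "('i \<Rightarrow> ('k::field, 'a) tens) \<Rightarrow> 'i set \<Rightarrow> ('k, 'a) tens \<Rightarrow> bool" where
  "has_formal_sum u I t \<longleftrightarrow> (\<forall>f. finite {i \<in> I. u i f \<noteq> 0} \<and> t f = (\<Sum>i | i \<in> I \<and> u i f \<noteq> 0. u i f))"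

definition alg_tensors :: "('x, 'k::field, 'a::ring_1) rack_alg \<Rightarrow> nat \<Rightarrow> ('k, 'a) tens set" where
  "alg_tensors A n = {t. \<exists>xss. (\<forall>xs\<in>set xss. length xs = n) \<and> t = (\<lambda>f. \<Sum>xs\<leftarrow>xss. pure A xs f)}"

text \<open>\<open>push t B\<close> is the image of \<open>t\<close> under the linear map \<open>x\<^sub>1 \<otimes> \<dots> \<otimes> x\<^sub>n \<mapsto> B [x\<^sub>1,\<dots>,x\<^sub>n]\<close>.\<close>

definition push :: "('k, 'a) tens \<Rightarrow> ('a list \<Rightarrow> ('k, 'a) tens) \<Rightarrow> ('k, 'a) tens" where
  "push t B = (\<lambda>f. t (\<lambda>xs. B xs f))"

definition tmult :: "('x, 'k::field, 'a::ring_1) rack_alg \<Rightarrow> ('k, 'a) tens \<Rightarrow> ('k, 'a) tens \<Rightarrow> ('k, 'a) tens" where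
  "tmult A t s = push t (\<lambda>xs. push s (\<lambda>ys. pure A (map2 (*) xs ys)))"

definition tprod :: "('x, 'k::field, 'a::ring_1) rack_alg \<Rightarrow> ('k, 'a) tens \<Rightarrow> ('k, 'a) tens \<Rightarrow> ('k, 'a) tens" where
  "tprod A t s = push t (\<lambda>xs. push s (\<lambda>ys. pure A (xs @ ys)))"

text \<open>The completed tensor power: formal sums, over \<open>as = [a\<^sub>1,\<dots>,a\<^sub>n]\<close>, of elements of
  \<open>(h\<^sub>a\<^sub>1 \<otimes> \<dots> \<otimes> h\<^sub>a\<^sub>n) A\<^sup>\<otimes>\<^sup>n\<close>. For a finite index set it is \<open>A\<^sup>\<otimes>\<^sup>n\<close>
  (lemma \<open>tensors_finite\<close>).\<close>

definition tensors :: "('x, 'k::field, 'a::ring_1) rack_alg \<Rightarrow> nat \<Rightarrow> ('k, 'a) tens set" where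
  "tensors A n = {t. \<exists>u. has_formal_sum u {as. length as = n} t \<and>
     (\<forall>as. length as = n \<longrightarrow> u as \<in> tmult A (pure A (map (hgen A) as)) ` alg_tensors A n)}"

text \<open>\<open>lifts_to A n B t y\<close>: the map \<open>x\<^sub>1 \<otimes> \<dots> \<otimes> x\<^sub>n \<mapsto> B [x\<^sub>1,\<dots>,x\<^sub>n]\<close>, applied termwise to the
  formal sum \<open>t = \<Sum>\<^sub>a\<^sub>s (h\<^sub>a\<^sub>1 \<otimes> \<dots> \<otimes> h\<^sub>a\<^sub>n) t\<close>, gives a formal sum with value \<open>y\<close>. For a finite
  index set this says \<open>y = push t B\<close> (lemma \<open>lifts_to_finite\<close>); in general \<open>push\<close> does not
  suffice, since for instance the multiplication \<open>A \<otimes> A \<rightarrow> A\<close> does not respect all formal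
  sums.\<close>

definition lifts_to :: "('x, 'k::field, 'a::ring_1) rack_alg \<Rightarrow> nat \<Rightarrow> ('a list \<Rightarrow> ('k, 'a) tens) \<Rightarrow>
    ('k, 'a) tens \<Rightarrow> ('k, 'a) tens \<Rightarrow> bool" where
  "lifts_to A n B t y \<longleftrightarrow>
     has_formal_sum (\<lambda>as. push t (\<lambda>xs. B (map2 (\<lambda>a x. hgen A a * x) as xs))) {as. length as = n} y"

section \<open>Quasi-triangular Hopf algebras\<close>

definition hopf_algebra :: "('x, 'k::field, 'a::ring_1) rack_alg \<Rightarrow> ('a \<Rightarrow> ('k, 'a) tens) \<Rightarrow>
    ('a \<Rightarrow> 'k) \<Rightarrow> ('a \<Rightarrow> 'a) \<Rightarrow> bool" where
  "hopf_algebra A \<Delta> \<epsilon> S \<longleftrightarrow>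
     k_algebra (smul A) \<and>
     (\<forall>x. \<Delta> x \<in> tensors A 2) \<and>
     (\<forall>x y. \<Delta> (x + y) = (\<lambda>f. \<Delta> x f + \<Delta> y f)) \<and>
     (\<forall>c x. \<Delta> (smul A c x) = (\<lambda>f. c * \<Delta> x f)) \<and>
     (\<forall>x y. \<Delta> (x * y) = tmult A (\<Delta> x) (\<Delta> y)) \<and>
     \<Delta> 1 = pure A [1, 1] \<and>
     (\<forall>x y. \<epsilon> (x + y) = \<epsilon> x + \<epsilon> y) \<and> (\<forall>c x. \<epsilon> (smul A c x) = c * \<epsilon> x) \<and>
     (\<forall>x y. \<epsilon> (x * y) = \<epsilon> x * \<epsilon> y) \<and> \<epsilon> 1 = 1 \<and>
     (\<forall>x. \<exists>z \<in> tensors A 3.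
        lifts_to A 2 (\<lambda>xs. tprod A (\<Delta> (xs ! 0)) (pure A [xs ! 1])) (\<Delta> x) z \<and>
        lifts_to A 2 (\<lambda>xs. tprod A (pure A [xs ! 0]) (\<Delta> (xs ! 1))) (\<Delta> x) z) \<and>
     (\<forall>x. lifts_to A 2 (\<lambda>xs. pure A [smul A (\<epsilon> (xs ! 0)) (xs ! 1)]) (\<Delta> x) (pure A [x]) \<and>
          lifts_to A 2 (\<lambda>xs. pure A [smul A (\<epsilon> (xs ! 1)) (xs ! 0)]) (\<Delta> x) (pure A [x])) \<and>
     (\<forall>x y. S (x + y) = S x + S y) \<and> (\<forall>c x. S (smul A c x) = smul A c (S x)) \<and>
     (\<forall>x. lifts_to A 2 (\<lambda>xs. pure A [S (xs ! 0) * xs ! 1]) (\<Delta> x) (pure A [smul A (\<epsilon> x) 1]) \<and>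
          lifts_to A 2 (\<lambda>xs. pure A [xs ! 0 * S (xs ! 1)]) (\<Delta> x) (pure A [smul A (\<epsilon> x) 1]))"

definition leg12 :: "('x, 'k::field, 'a::ring_1) rack_alg \<Rightarrow> ('k, 'a) tens \<Rightarrow> ('k, 'a) tens" where
  "leg12 A t = push t (\<lambda>xs. pure A [xs ! 0, xs ! 1, 1])"
definition leg13 :: "('x, 'k::field, 'a::ring_1) rack_alg \<Rightarrow> ('k, 'a) tens \<Rightarrow> ('k, 'a) tens" where
  "leg13 A t = push t (\<lambda>xs. pure A [xs ! 0, 1, xs ! 1])"
definition leg23 :: "('x, 'k::field, 'a::ring_1) rack_alg \<Rightarrow> ('k, 'a) tens \<Rightarrow> ('k, 'a) tens" where
  "leg23 A t = push t (\<lambda>xs. pure A [1, xs ! 0, xs ! 1])"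
definition flip :: "('x, 'k::field, 'a::ring_1) rack_alg \<Rightarrow> ('k, 'a) tens \<Rightarrow> ('k, 'a) tens" where
  "flip A t = push t (\<lambda>xs. pure A [xs ! 1, xs ! 0])"

definition yang_baxter :: "('x, 'k::field, 'a::ring_1) rack_alg \<Rightarrow> ('k, 'a) tens \<Rightarrow> bool" where
  "yang_baxter A R \<longleftrightarrow>
     tmult A (tmult A (leg12 A R) (leg13 A R)) (leg23 A R) =
     tmult A (tmult A (leg23 A R) (leg13 A R)) (leg12 A R)"

definition quasi_triangular_hopf_algebra :: "('x, 'k::field, 'a::ring_1) rack_alg \<Rightarrow>
    ('a \<Rightarrow> ('k, 'a) tens) \<Rightarrow> ('a \<Rightarrow> 'k) \<Rightarrow> ('a \<Rightarrow> 'a) \<Rightarrow> ('k, 'a) tens \<Rightarrow> bool" where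
  "quasi_triangular_hopf_algebra A \<Delta> \<epsilon> S R \<longleftrightarrow>
     hopf_algebra A \<Delta> \<epsilon> S \<and>
     R \<in> tensors A 2 \<and>
     (\<exists>R' \<in> tensors A 2. tmult A R R' = pure A [1, 1] \<and> tmult A R' R = pure A [1, 1]) \<and>
     lifts_to A 2 (\<lambda>xs. tprod A (pure A [xs ! 0]) (\<Delta> (xs ! 1))) R (tmult A (leg13 A R) (leg12 A R)) \<and>
     lifts_to A 2 (\<lambda>xs. tprod A (\<Delta> (xs ! 0)) (pure A [xs ! 1])) R (tmult A (leg13 A R) (leg23 A R)) \<and>
     (\<forall>x. tmult A (flip A (\<Delta> x)) R = tmult A R (\<Delta> x))"

section \<open>The case of a finite index set\<close>

lemma multilinearD:
  assumes "multilinear s s' n f" "length xs = n" "i < n"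
  shows "f (xs[i := x + y]) = f (xs[i := x]) + f (xs[i := y])" "f (xs[i := s c x]) = s' c (f (xs[i := x]))"
  using assms by (auto simp: multilinear_def)

lemma multilinear_sum:
  assumes "multilinear s s' n f" "length xs = n" "i < n" "finite I"
  shows "f (xs[i := (\<Sum>j\<in>I. g j)]) = (\<Sum>j\<in>I. f (xs[i := g j]))"
proof -
  have "f (xs[i := 0 + 0]) = f (xs[i := 0]) + f (xs[i := 0])"
    using multilinearD(1)[OF assms(1-3)] .
  then have z: "f (xs[i := 0]) = 0" by simp
  from assms(4) show ?thesis
    by (induction I) (auto simp: z multilinearD(1)[OF assms(1-3)])
qed

lemma multilinear_list_update:
  fixes hs :: "'a::ring_1 list"
  assumes "k_algebra s" "multilinear s s' n f" "length hs = n"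
  shows "multilinear s s' n (\<lambda>xs. f (map2 (*) hs xs))" "multilinear s s' n (\<lambda>xs. f (map2 (*) xs hs))"
proof -
  have 1: "map2 (*) hs (xs[i := z]) = (map2 (*) hs xs)[i := hs ! i * z]"
    if "length xs = n" "i < n" for xs :: "'a list" and i z
    using that assms(3) by (intro nth_equalityI) (auto simp: nth_list_update)
  have 2: "map2 (*) (xs[i := z]) hs = (map2 (*) xs hs)[i := z * hs ! i]"
    if "length xs = n" "i < n" for xs :: "'a list" and i z
    using that assms(3) by (intro nth_equalityI) (auto simp: nth_list_update)
  show "multilinear s s' n (\<lambda>xs. f (map2 (*) hs xs))"
    unfolding multilinear_def
  proof (intro allI impI)
    fix xs :: "'a list" and i x y c assume a: "length xs = n" "i < n"
    have l: "length (map2 (*) hs xs) = n" using a assms(3) by simp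
    have "hs ! i * s c x = s c (hs ! i * x)" using assms(1) by (simp add: k_algebra_def)
    then show "f (map2 (*) hs (xs[i := x + y])) = f (map2 (*) hs (xs[i := x])) + f (map2 (*) hs (xs[i := y])) \<and>
      f (map2 (*) hs (xs[i := s c x])) = s' c (f (map2 (*) hs (xs[i := x])))"
      using multilinearD[OF assms(2) l a(2)] by (simp only: 1[OF a] distrib_left)
  qed
  show "multilinear s s' n (\<lambda>xs. f (map2 (*) xs hs))"
    unfolding multilinear_def
  proof (intro allI impI)
    fix xs :: "'a list" and i x y c assume a: "length xs = n" "i < n"
    have l: "length (map2 (*) xs hs) = n" using a assms(3) by simp
    have "s c x * hs ! i = s c (x * hs ! i)" using assms(1) by (simp add: k_algebra_def)
    then show "f (map2 (*) (xs[i := x + y]) hs) = f (map2 (*) (xs[i := x]) hs) + f (map2 (*) (xs[i := y]) hs) \<and>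
      f (map2 (*) (xs[i := s c x]) hs) = s' c (f (map2 (*) (xs[i := x]) hs))"
      using multilinearD[OF assms(2) l a(2)] by (simp only: 2[OF a] distrib_right)
  qed
qed

lemma finite_lists_of_length:
  assumes "finite (UNIV :: 'x set)" shows "finite {as :: 'x list. length as = n}"
  using finite_lists_length_eq[OF assms, of n] by simp

lemma multilinear_expand:
  fixes h :: "'x \<Rightarrow> 'a::ring_1"
  assumes fin: "finite (UNIV :: 'x set)" and one: "(\<Sum>a\<in>UNIV. h a) = 1"
    and f: "multilinear s s' n f" and l: "length zs = n"
  shows "f zs = (\<Sum>as | length as = n. f (map2 (\<lambda>a x. h a * x) as zs))"
proof -
  have "f zs = (\<Sum>as | length as = m. f (map2 (\<lambda>a x. h a * x) as (take m zs) @ drop m zs))" if "m \<le> n" for m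
    using that
  proof (induction m)
    case 0 then show ?case by simp
  next
    case (Suc m)
    have m: "m < n" using Suc by simp
    have eq: "f (map2 (\<lambda>a x. h a * x) as (take m zs) @ drop m zs) =
        (\<Sum>a\<in>UNIV. f (map2 (\<lambda>a x. h a * x) (as @ [a]) (take (Suc m) zs) @ drop (Suc m) zs))"
      if as: "length as = m" for as
    proof -
      let ?ys = "map2 (\<lambda>a x. h a * x) as (take m zs) @ drop m zs"
      have ly: "length ?ys = n" using as l m by simp
      have "?ys[m := (\<Sum>a\<in>UNIV. h a * zs ! m)] = ?ys"
        using as l m one by (simp flip: sum_distrib_right add: list_update_append Cons_nth_drop_Suc[symmetric])
      then have "f ?ys = (\<Sum>a\<in>UNIV. f (?ys[m := h a * zs ! m]))"
        using multilinear_sum[OF f ly m fin, of "\<lambda>a. h a * zs ! m"] by simp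
      also have "\<dots> = (\<Sum>a\<in>UNIV. f (map2 (\<lambda>a x. h a * x) (as @ [a]) (take (Suc m) zs) @ drop (Suc m) zs))"
        using as l m by (intro sum.cong refl arg_cong[of _ _ f])
          (simp add: list_update_append Cons_nth_drop_Suc[symmetric] take_Suc_conv_app_nth)
      finally show ?thesis .
    qed
    have "f zs = (\<Sum>as | length as = m. \<Sum>a\<in>UNIV.
        f (map2 (\<lambda>a x. h a * x) (as @ [a]) (take (Suc m) zs) @ drop (Suc m) zs))"
      using Suc eq by simp
    also have "\<dots> = (\<Sum>(as, a) \<in> {as. length as = m} \<times> UNIV.
        f (map2 (\<lambda>a x. h a * x) (as @ [a]) (take (Suc m) zs) @ drop (Suc m) zs))"
      by (rule sum.cartesian_product)
    also have "\<dots> = (\<Sum>bs | length bs = Suc m. f (map2 (\<lambda>a x. h a * x) bs (take (Suc m) zs) @ drop (Suc m) zs))"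
      by (rule sum.reindex_bij_witness[where i = "\<lambda>bs. (butlast bs, last bs)" and j = "\<lambda>(as, a). as @ [a]"])
        (auto simp: append_butlast_last_id simp flip: length_0_conv)
    finally show ?case .
  qed
  from this[of n] show ?thesis using l by simp
qed

lemma forms_finite:
  fixes A :: "('x, 'k::field, 'a::ring_1) rack_alg"
  assumes "finite (UNIV :: 'x set)" "(\<Sum>a\<in>UNIV. hgen A a) = 1"
  shows "forms A n = {f. multilinear (smul A) (*) n f}"
proof -
  have "map ((*) (1::'a)) xs = xs" for xs by (induction xs) auto
  then show ?thesis unfolding forms_def using assms by (auto intro!: exI[of _ UNIV])
qed

lemma alg_tensors_universal:
  fixes A :: "('x, 'k::field, 'a::ring_1) rack_alg" and sW :: "'k \<Rightarrow> 'w::ab_group_add \<Rightarrow> 'w"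
  assumes "finite (UNIV :: 'x set)" "(\<Sum>a\<in>UNIV. hgen A a) = 1"
    and W: "vector_space sW" and B: "multilinear (smul A) sW n B"
    and len: "\<forall>xs\<in>set xss. length xs = n" "\<forall>xs\<in>set yss. length xs = n"
    and eq: "(\<lambda>f. \<Sum>xs\<leftarrow>xss. pure A xs f) = (\<lambda>f. \<Sum>xs\<leftarrow>yss. pure A xs f)"
  shows "(\<Sum>xs\<leftarrow>xss. B xs) = (\<Sum>xs\<leftarrow>yss. B xs)"
proof (rule ccontr)
  interpret W: vector_space sW by fact
  interpret k: vector_space "(*) :: 'k \<Rightarrow> 'k \<Rightarrow> 'k" by standard (auto simp: algebra_simps)
  interpret Wk: vector_space_pair sW "(*) :: 'k \<Rightarrow> 'k \<Rightarrow> 'k" by unfold_locales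
  let ?w = "(\<Sum>xs\<leftarrow>xss. B xs) - (\<Sum>xs\<leftarrow>yss. B xs)"
  assume "\<not> ?thesis"
  then have "W.independent {?w}" by simp
  then obtain g where g: "Vector_Spaces.linear sW (*) g" "g ?w = 1"
    using Wk.linear_independent_extend[of "{?w}" "\<lambda>_. 1"] by auto
  interpret g: Vector_Spaces.linear sW "(*)" g by fact
  have "multilinear (smul A) (*) n (\<lambda>xs. g (B xs))"
    using B unfolding multilinear_def by (simp add: g.add g.scale)
  then have m: "(\<lambda>xs. g (B xs)) \<in> forms A n" using forms_finite[OF assms(1,2)] by blast
  have *: "g (\<Sum>xs\<leftarrow>zss. B xs) = (\<Sum>xs\<leftarrow>zss. pure A xs (\<lambda>xs. g (B xs)))"
    if "\<forall>xs\<in>set zss. length xs = n" for zss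
    using that by (induction zss) (auto simp: g.zero g.add pure_def m)
  have "g ?w = 0" using fun_cong[OF eq, of "\<lambda>xs. g (B xs)"] by (simp add: g.diff *[OF len(1)] *[OF len(2)])
  then show False using g(2) by simp
qed

lemma alg_tensors_sum:
  assumes "finite I" "\<And>i. i \<in> I \<Longrightarrow> u i \<in> alg_tensors A n"
  shows "(\<lambda>f. \<Sum>i\<in>I. u i f) \<in> alg_tensors A n"
  using assms
proof (induction I)
  case empty
  show ?case unfolding alg_tensors_def by (auto intro!: exI[of _ "[]"])
next
  case (insert j I)
  have "u j \<in> alg_tensors A n" "(\<lambda>f. \<Sum>i\<in>I. u i f) \<in> alg_tensors A n"
    using insert by auto
  then obtain xss yss where xy: "\<forall>xs\<in>set xss. length xs = n" "u j = (\<lambda>f. \<Sum>xs\<leftarrow>xss. pure A xs f)"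
      "\<forall>xs\<in>set yss. length xs = n" "(\<lambda>f. \<Sum>i\<in>I. u i f) = (\<lambda>f. \<Sum>xs\<leftarrow>yss. pure A xs f)"
    unfolding alg_tensors_def mem_Collect_eq by metis
  have "(\<lambda>f. \<Sum>i\<in>insert j I. u i f) = (\<lambda>f. \<Sum>xs\<leftarrow>xss @ yss. pure A xs f)"
    using insert(1,2) fun_cong[OF xy(2)] fun_cong[OF xy(4)] by simp
  moreover have "\<forall>xs\<in>set (xss @ yss). length xs = n" using xy by auto
  ultimately show ?case unfolding alg_tensors_def by blast
qed

lemma has_formal_sum_finite:
  assumes "finite I"
  shows "has_formal_sum u I t \<longleftrightarrow> t = (\<lambda>f. \<Sum>i\<in>I. u i f)"
proof -
  have "(\<Sum>i | i \<in> I \<and> u i f \<noteq> 0. u i f) = (\<Sum>i\<in>I. u i f)" for f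
    using assms by (intro sum.mono_neutral_left) auto
  then show ?thesis using assms unfolding has_formal_sum_def by auto
qed

lemma lifts_to_finite:
  fixes A :: "('x, 'k::field, 'a::ring_1) rack_alg"
  assumes fin: "finite (UNIV :: 'x set)" and one: "(\<Sum>a\<in>UNIV. hgen A a) = 1" and "k_algebra (smul A)"
    and B: "\<And>f. multilinear (smul A) (*) n (\<lambda>xs. B xs f)" and t: "t \<in> alg_tensors A n"
  shows "lifts_to A n B t y \<longleftrightarrow> y = push t B"
proof -
  obtain xss where xss: "\<forall>xs\<in>set xss. length xs = n" "t = (\<lambda>f. \<Sum>xs\<leftarrow>xss. pure A xs f)"
    using t unfolding alg_tensors_def by auto
  have m2: "map2 (\<lambda>a x. hgen A a * x) as xs = map2 (*) (map (hgen A) as) xs" for as xs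
    by (simp add: zip_map1 case_prod_beta comp_def)
  have mem: "(\<lambda>xs. B (map2 (\<lambda>a x. hgen A a * x) as xs) f) \<in> forms A n" if "length as = n" for as f
    unfolding forms_finite[OF fin one] m2
    using multilinear_list_update(1)[OF assms(3) B, of "map (hgen A) as"] that by simp
  have memB: "(\<lambda>xs. B xs f) \<in> forms A n" for f
    using B forms_finite[OF fin one] by blast
  have "(\<Sum>as | length as = n. t (\<lambda>xs. B (map2 (\<lambda>a x. hgen A a * x) as xs) f)) = t (\<lambda>xs. B xs f)" for f
  proof -
    have "(\<Sum>as | length as = n. t (\<lambda>xs. B (map2 (\<lambda>a x. hgen A a * x) as xs) f)) =
        (\<Sum>as | length as = n. \<Sum>xs\<leftarrow>xss. B (map2 (\<lambda>a x. hgen A a * x) as xs) f)"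
      using xss mem by (intro sum.cong refl) (auto simp: pure_def cong: map_cong)
    also have "\<dots> = (\<Sum>xs\<leftarrow>xss. \<Sum>as | length as = n. B (map2 (\<lambda>a x. hgen A a * x) as xs) f)"
      by (induction xss) (simp_all add: sum.distrib)
    also have "\<dots> = (\<Sum>xs\<leftarrow>xss. B xs f)"
    proof (intro arg_cong[where f = sum_list] map_cong refl)
      fix xs assume "xs \<in> set xss"
      then show "(\<Sum>as | length as = n. B (map2 (\<lambda>a x. hgen A a * x) as xs) f) = B xs f"
        using multilinear_expand[OF fin one B, of xs f] xss by simp
    qed
    also have "\<dots> = t (\<lambda>xs. B xs f)"
      using xss memB by (auto simp: pure_def cong: map_cong)
    finally show ?thesis .
  qed
  then show ?thesis
    unfolding lifts_to_def has_formal_sum_finite[OF finite_lists_of_length[OF fin]] push_def by simp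
qed

lemma tmult_pure_finite:
  fixes A :: "('x, 'k::field, 'a::ring_1) rack_alg"
  assumes fin: "finite (UNIV :: 'x set)" and one: "(\<Sum>a\<in>UNIV. hgen A a) = 1" and k: "k_algebra (smul A)"
    and xss: "\<forall>xs\<in>set xss. length xs = n" and yss: "\<forall>ys\<in>set yss. length ys = n"
  shows "tmult A (\<lambda>f. \<Sum>xs\<leftarrow>xss. pure A xs f) (\<lambda>f. \<Sum>ys\<leftarrow>yss. pure A ys f) =
    (\<lambda>f. \<Sum>xs\<leftarrow>xss. \<Sum>ys\<leftarrow>yss. pure A (map2 (*) xs ys) f)"
proof
  fix f :: "'a list \<Rightarrow> 'k"
  have cong: "g \<in> forms A n \<longleftrightarrow> g' \<in> forms A n" if "\<And>xs. length xs = n \<Longrightarrow> g xs = g' xs" for g g'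
    unfolding forms_finite[OF fin one] multilinear_def using that by (simp cong: conj_cong)
  have p: "(\<lambda>ys. pure A (map2 (*) xs ys) f) \<in> forms A n"
       "(\<lambda>ys. pure A (map2 (*) ys xs) f) \<in> forms A n" if "length xs = n" for xs
  proof -
    have z: "(\<lambda>_. 0) \<in> forms A n" unfolding forms_finite[OF fin one] by (simp add: multilinear_def)
    have "(\<lambda>ys. f (map2 (*) xs ys)) \<in> forms A n" "(\<lambda>ys. f (map2 (*) ys xs)) \<in> forms A n" if "f \<in> forms A n"
      using multilinear_list_update[OF k, of "(*)" n f xs] that \<open>length xs = n\<close> unfolding forms_finite[OF fin one] by auto
    with z show "(\<lambda>ys. pure A (map2 (*) xs ys) f) \<in> forms A n" "(\<lambda>ys. pure A (map2 (*) ys xs) f) \<in> forms A n"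
      using cong[of "\<lambda>ys. pure A (map2 (*) xs ys) f" "if f \<in> forms A n then \<lambda>ys. f (map2 (*) xs ys) else (\<lambda>_. 0)"]
        cong[of "\<lambda>ys. pure A (map2 (*) ys xs) f" "if f \<in> forms A n then \<lambda>ys. f (map2 (*) ys xs) else (\<lambda>_. 0)"] that
      by (auto simp: pure_def split: if_splits)
  qed
  have s: "(\<lambda>xs. \<Sum>ys\<leftarrow>zss. pure A (map2 (*) xs ys) f) \<in> forms A n" if "\<forall>ys\<in>set zss. length ys = n" for zss
    using that
  proof (induction zss)
    case Nil then show ?case unfolding forms_finite[OF fin one] by (simp add: multilinear_def)
  next
    case (Cons zs zss)
    then have "(\<lambda>xs. \<Sum>ys\<leftarrow>zss. pure A (map2 (*) xs ys) f) \<in> forms A n" "(\<lambda>xs. pure A (map2 (*) xs zs) f) \<in> forms A n"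
      using p by auto
    then show ?case unfolding forms_finite[OF fin one] by (simp add: multilinear_def algebra_simps)
  qed
  have 1: "(\<Sum>ys\<leftarrow>yss. pure A ys (\<lambda>ys. pure A (map2 (*) xs ys) f)) = (\<Sum>ys\<leftarrow>yss. pure A (map2 (*) xs ys) f)"
    if "length xs = n" for xs
    using p(1)[OF that] yss by (auto simp: pure_def[of A ys for ys] intro!: arg_cong[where f = sum_list])
  have 2: "(\<lambda>xs. \<Sum>ys\<leftarrow>yss. pure A ys (\<lambda>ys. pure A (map2 (*) xs ys) f)) \<in> forms A n"
    using s[OF yss] by (subst cong[OF 1])
  show "tmult A (\<lambda>f. \<Sum>xs\<leftarrow>xss. pure A xs f) (\<lambda>f. \<Sum>ys\<leftarrow>yss. pure A ys f) f =
      (\<Sum>xs\<leftarrow>xss. \<Sum>ys\<leftarrow>yss. pure A (map2 (*) xs ys) f)"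
    unfolding tmult_def push_def
  proof (intro arg_cong[where f = sum_list] map_cong refl)
    fix xs assume "xs \<in> set xss"
    then have "length xs = n" using xss by auto
    then show "pure A xs (\<lambda>xs. \<Sum>ys\<leftarrow>yss. pure A ys (\<lambda>ys. pure A (map2 (*) xs ys) f)) =
        (\<Sum>ys\<leftarrow>yss. pure A (map2 (*) xs ys) f)"
      using 1 2 by (simp add: pure_def[of A xs])
  qed
qed

lemma tensors_finite:
  fixes A :: "('x, 'k::field, 'a::ring_1) rack_alg"
  assumes fin: "finite (UNIV :: 'x set)" and one: "(\<Sum>a\<in>UNIV. hgen A a) = 1" and k: "k_algebra (smul A)"
  shows "tensors A n = alg_tensors A n"
proof -
  have mult: "tmult A (pure A hs) (\<lambda>f. \<Sum>xs\<leftarrow>xss. pure A xs f) = (\<lambda>f. \<Sum>xs\<leftarrow>xss. pure A (map2 (*) hs xs) f)"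
    if "length hs = n" "\<forall>xs\<in>set xss. length xs = n" for hs xss
    using tmult_pure_finite[OF fin one k, of "[hs]" n xss] that by simp
  have alg: "tmult A (pure A (map (hgen A) as)) s \<in> alg_tensors A n"
    if as: "length as = n" and s: "s \<in> alg_tensors A n" for as s
  proof -
    obtain xss where xss: "\<forall>xs\<in>set xss. length xs = n" "s = (\<lambda>f. \<Sum>xs\<leftarrow>xss. pure A xs f)"
      using s unfolding alg_tensors_def by auto
    have "tmult A (pure A (map (hgen A) as)) s =
        (\<lambda>f. \<Sum>xs\<leftarrow>map (map2 (*) (map (hgen A) as)) xss. pure A xs f)"
      unfolding xss(2) using mult[of "map (hgen A) as" xss] as xss(1) by (simp add: comp_def)
    moreover have "\<forall>xs\<in>set (map (map2 (*) (map (hgen A) as)) xss). length xs = n" using xss as by auto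
    ultimately show ?thesis unfolding alg_tensors_def by blast
  qed
  have "t \<in> alg_tensors A n" if t: "t \<in> tensors A n" for t
  proof -
    obtain u where u: "has_formal_sum u {as. length as = n} t"
        "\<And>as. length as = n \<Longrightarrow> u as \<in> tmult A (pure A (map (hgen A) as)) ` alg_tensors A n"
      using t unfolding tensors_def by auto
    have "u as \<in> alg_tensors A n" if "length as = n" for as
      using u(2)[OF that] alg[OF that] by auto
    then have "(\<lambda>f. \<Sum>as | length as = n. u as f) \<in> alg_tensors A n"
      by (intro alg_tensors_sum finite_lists_of_length fin) simp
    then show ?thesis
      using u(1) unfolding has_formal_sum_finite[OF finite_lists_of_length[OF fin]] by simp
  qed
  moreover have "t \<in> tensors A n" if t: "t \<in> alg_tensors A n" for t
  proof -
    obtain xss where xss: "\<forall>xs\<in>set xss. length xs = n" "t = (\<lambda>f. \<Sum>xs\<leftarrow>xss. pure A xs f)"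
      using t unfolding alg_tensors_def by auto
    have "t f = (\<Sum>as | length as = n. tmult A (pure A (map (hgen A) as)) t f)" for f
    proof -
      have "(\<Sum>as | length as = n. tmult A (pure A (map (hgen A) as)) t f) =
          (\<Sum>as | length as = n. \<Sum>xs\<leftarrow>xss. pure A (map2 (*) (map (hgen A) as) xs) f)"
        unfolding xss(2) using xss(1) by (intro sum.cong refl) (simp add: mult)
      also have "\<dots> = (\<Sum>xs\<leftarrow>xss. \<Sum>as | length as = n. pure A (map2 (*) (map (hgen A) as) xs) f)"
        by (induction xss) (simp_all add: sum.distrib)
      also have "\<dots> = (\<Sum>xs\<leftarrow>xss. pure A xs f)"
      proof (intro arg_cong[where f = sum_list] map_cong refl)
        fix xs assume "xs \<in> set xss"
        then have l: "length xs = n" using xss by simp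
        show "(\<Sum>as | length as = n. pure A (map2 (*) (map (hgen A) as) xs) f) = pure A xs f"
        proof (cases "f \<in> forms A n")
          case True
          then have "multilinear (smul A) (*) n f" unfolding forms_def by auto
          have "map2 (\<lambda>a x. hgen A a * x) as xs = map2 (*) (map (hgen A) as) xs" for as
            by (simp add: zip_map1 case_prod_beta comp_def)
          with multilinear_expand[OF fin one \<open>multilinear (smul A) (*) n f\<close> l] True l show ?thesis
            by (simp add: pure_def)
        qed (use l in \<open>simp add: pure_def\<close>)
      qed
      finally show ?thesis using xss(2) by simp
    qed
    then show ?thesis unfolding tensors_def using t
      by (auto intro!: exI[of _ "\<lambda>as. tmult A (pure A (map (hgen A) as)) t"]
          simp: has_formal_sum_finite[OF finite_lists_of_length[OF fin]] fun_eq_iff)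
  qed
  ultimately show ?thesis by blast
qed

section \<open>Formal sums that hold for every index set\<close>

lemma form_hgen_outside:
  fixes A :: "('x, 'k::field, 'a::ring_1) rack_alg"
  assumes orth: "\<And>a b. hgen A a * hgen A b = (if a = b then hgen A a else 0)"
    and f: "multilinear (smul A) (*) n f" and F: "finite F"
    and fF: "\<And>xs. length xs = n \<Longrightarrow> f xs = f (map (\<lambda>x. (\<Sum>a\<in>F. hgen A a) * x) xs)"
    and xs: "length xs = n" "i < n" "xs ! i = hgen A b" "b \<notin> F"
  shows "f xs = 0"
proof -
  let ?ys = "map (\<lambda>x. (\<Sum>a\<in>F. hgen A a) * x) xs"
  have "(\<Sum>a\<in>F. hgen A a) * hgen A b = (\<Sum>a\<in>F. 0)"
    unfolding sum_distrib_right orth using xs(4) by (intro sum.cong) auto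
  then have "?ys ! i = 0" using xs by simp
  then have "?ys = ?ys[i := 0 + 0]" by (metis add_0 list_update_id)
  moreover have "f (?ys[i := 0 + 0]) = f (?ys[i := 0]) + f (?ys[i := 0])"
    by (rule multilinearD(1)[OF f]) (use xs in auto)
  ultimately have "f ?ys = 0" by (metis add_0 add_cancel_right_right)
  then show ?thesis using fF[OF xs(1)] by simp
qed

lemma formal_normalization:
  fixes A :: "('x, 'k::field, 'a::ring_1) rack_alg"
  assumes orth: "\<And>a b. hgen A a * hgen A b = (if a = b then hgen A a else 0)"
  shows "has_formal_sum (\<lambda>a. pure A [hgen A a]) UNIV (pure A [1])"
  unfolding has_formal_sum_def
proof
  fix f :: "'a list \<Rightarrow> 'k"
  show "finite {a \<in> UNIV. pure A [hgen A a] f \<noteq> 0} \<and>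
    pure A [1] f = (\<Sum>a | a \<in> UNIV \<and> pure A [hgen A a] f \<noteq> 0. pure A [hgen A a] f)"
  proof (cases "f \<in> forms A 1")
    case True
    then obtain F where f: "multilinear (smul A) (*) 1 f" "finite F"
        "\<And>xs. length xs = 1 \<Longrightarrow> f xs = f (map (\<lambda>x. (\<Sum>a\<in>F. hgen A a) * x) xs)"
      unfolding forms_def by auto
    have out: "f [hgen A b] = 0" if "b \<notin> F" for b
      using form_hgen_outside[OF orth f, of "[hgen A b]" 0 b] that by simp
    have sub: "{a. f [hgen A a] \<noteq> 0} \<subseteq> F" using out by blast
    have "f [1] = (\<Sum>a\<in>F. f [hgen A a])"
      using f(3)[of "[1]"] multilinear_sum[OF f(1) _ _ f(2), of "[0]" 0 "hgen A"] by simp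
    also have "\<dots> = (\<Sum>a | f [hgen A a] \<noteq> 0. f [hgen A a])"
      using sub f(2) by (intro sum.mono_neutral_right) auto
    finally show ?thesis using True finite_subset[OF sub f(2)] by (simp add: pure_def)
  qed (simp add: pure_def)
qed

lemma universal_R_exists:
  fixes A :: "('x, 'k::field, 'a::ring_1) rack_alg"
  assumes orth: "\<And>a b. hgen A a * hgen A b = (if a = b then hgen A a else 0)"
  shows "\<exists>R. has_formal_sum (\<lambda>a. pure A [hgen A a, qgen A a]) UNIV R"
proof -
  have "finite {a. pure A [hgen A a, qgen A a] f \<noteq> 0}" for f
  proof (cases "f \<in> forms A 2")
    case True
    then obtain F where f: "multilinear (smul A) (*) 2 f" "finite F"
        "\<And>xs. length xs = 2 \<Longrightarrow> f xs = f (map (\<lambda>x. (\<Sum>a\<in>F. hgen A a) * x) xs)"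
      unfolding forms_def by auto
    have "f [hgen A b, qgen A b] = 0" if "b \<notin> F" for b
      using form_hgen_outside[OF orth f, of "[hgen A b, qgen A b]" 0 b] that by simp
    then have "{a. pure A [hgen A a, qgen A a] f \<noteq> 0} \<subseteq> F" by (auto simp: pure_def)
    then show ?thesis using f(2) finite_subset by blast
  qed (simp add: pure_def numeral_2_eq_2)
  then show ?thesis unfolding has_formal_sum_def by auto
qed

end

theory Submission
  imports Defs
begin

text \<open>
The algebra is the Drinfeld double of the group, up to completion. As \<open>q\<close> is a homomorphism and
\<open>h\<^sub>a q\<^sub>b = q\<^sub>b h\<^bsub>b\<^sup>-\<^sup>1 a b\<^esub>\<close>, it is spanned by the elements \<open>q\<^sub>b\<close> and \<open>h\<^sub>a q\<^sub>b\<close>, and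
\<open>h\<^sub>a q\<^sub>b h\<^sub>c q\<^sub>d\<close> is \<open>h\<^sub>a q\<^bsub>b d\<^esub>\<close> if \<open>c = b\<^sup>-\<^sup>1 a b\<close> and \<open>0\<close> otherwise. Hence \<open>h\<^sub>a x = \<Sum>\<^sub>b x(a,b) h\<^sub>a q\<^sub>b\<close> with
finitely many nonzero coefficients, and these rows are all that a form sees of \<open>x\<close>. Rows multiply
by convolution, \<open>(x y)(a,g) = \<Sum>\<^sub>b x(a,b) y(b\<^sup>-\<^sup>1 a b, b\<^sup>-\<^sup>1 g)\<close>, and tensors have rows indexed by tuples, with the
same product taken componentwise. In these coordinates

  \<open>(\<Delta> x)((a,a'),(b,b')) = \<delta>(b,b') x(a a', b)\<close>,  \<open>\<epsilon> x = \<Sum>\<^sub>b x(e,b)\<close>,  \<open>\<R>((a,c),(b,d)) = \<delta>(b,e) \<delta>(d,a)\<close>,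

and every axiom turns into an identity in the group. For instance \<open>\<Delta>\<close> is multiplicative because conjugation
is a homomorphism, it is coassociative because the group is associative, and \<open>\<R>\<close> intertwines \<open>\<Delta>\<close> with its flip
because \<open>a (a\<^sup>-\<^sup>1 a' a) = a' a\<close>.

Three things have to be supplied. First, the coefficients must be well defined. A word of the free
algebra sends \<open>h\<^sub>a\<close> to zero or to one monomial \<open>h\<^sub>a q\<^sub>g\<close>; this rule, extended linearly, respects the relations
(\<open>free_row_relator\<close>, \<open>row_mult\<close>), and the rows of \<open>x\<close> are indeed its coefficients (\<open>h_expand\<close>). Second, the
operations on completed tensors must be computed on rows: products in \<open>tmult_row_tensor\<close> and
\<open>tprod_row_tensor\<close>, formal sums in \<open>has_formal_sum_row_tensor\<close>, maps applied termwise in \<open>lifts_row_tensor\<close>. To avoid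
multiple sums, a row is stored as the functional \<open>\<phi> \<mapsto> \<Sum>\<^sub>b x(a,b) \<phi> b\<close>, and convolution is then composition.
Third, the antipode needs values in the algebra itself and is defined as an anti-homomorphism on the
free algebra that respects the relations (\<open>free_anti_relator\<close>).
\<close>

section \<open>Linear maps out of a presented algebra\<close>

definition linear_extension :: "('k::field \<Rightarrow> 'v::ab_group_add \<Rightarrow> 'v) \<Rightarrow> ('w \<Rightarrow> 'v) \<Rightarrow> ('w \<Rightarrow>\<^sub>0 'k) \<Rightarrow> 'v" where
  "linear_extension s v p = (\<Sum>w\<in>Poly_Mapping.keys p. s (Poly_Mapping.lookup p w) (v w))"

lemma linear_extension_superset:
  assumes "vector_space s" "finite K" "Poly_Mapping.keys p \<subseteq> K"
  shows "linear_extension s v p = (\<Sum>w\<in>K. s (Poly_Mapping.lookup p w) (v w))"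
proof -
  interpret vector_space s by fact
  show ?thesis
    unfolding linear_extension_def using assms(2,3)
    by (intro sum.mono_neutral_left) (auto simp: in_keys_iff)
qed

lemma linear_extension_add:
  assumes "vector_space s"
  shows "linear_extension s v (p + r) = linear_extension s v p + linear_extension s v r"
proof -
  interpret vector_space s by fact
  let ?K = "Poly_Mapping.keys p \<union> Poly_Mapping.keys r"
  have "Poly_Mapping.keys (p + r) \<subseteq> ?K" by (rule keys_add)
  then show ?thesis
    by (simp add: linear_extension_superset[OF assms, of ?K] lookup_add scale_left_distrib sum.distrib)
qed

lemma linear_extension_single:
  assumes "vector_space s"
  shows "linear_extension s v (Poly_Mapping.single w c) = s c (v w)"
proof -
  interpret vector_space s by fact
  show ?thesis by (simp add: linear_extension_superset[OF assms, of "{w}"])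
qed

text \<open>Linear maps on the free algebra agree when they agree on scalar multiples of words; multiplicativity
is checked with this principle one factor at a time.\<close>

lemma poly_mapping_additive_eq:
  fixes F G :: "('w \<Rightarrow>\<^sub>0 'k::ab_group_add) \<Rightarrow> 'v::ab_group_add"
  assumes "\<And>p r. F (p + r) = F p + F r" "\<And>p r. G (p + r) = G p + G r"
    and eq: "\<And>w c. F (Poly_Mapping.single w c) = G (Poly_Mapping.single w c)"
  shows "F p = G p"
proof (induction p rule: update_induct)
  case const
  have "F 0 = 0" "G 0 = 0" using assms(1)[of 0 0] assms(2)[of 0 0] by auto
  then show ?case by simp
next
  case (update f a b)
  have "Poly_Mapping.update a b f = f + Poly_Mapping.single a b"
    using update by (intro poly_mapping_eqI)
      (auto simp: lookup_update lookup_add lookup_single in_keys_iff when_def)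
  then show ?case using update eq by (simp add: assms(1,2))
qed

lemma additive_uminus:
  fixes F :: "'u::ab_group_add \<Rightarrow> 'v::ab_group_add"
  assumes "\<And>p r. F (p + r) = F p + F r"
  shows "F (p - r) = F p - F r" "F 0 = 0" "finite I \<Longrightarrow> F (\<Sum>i\<in>I. g i) = (\<Sum>i\<in>I. F (g i))"
proof -
  show z: "F 0 = 0" using assms[of 0 0] by simp
  show "F (p - r) = F p - F r" using assms[of "p - r" r] by (simp add: algebra_simps)
  show "finite I \<Longrightarrow> F (\<Sum>i\<in>I. g i) = (\<Sum>i\<in>I. F (g i))"
    by (induction I rule: finite_induct) (auto simp: z assms)
qed

lemma free_alg_one: "(1 :: ('g, 'k::field) free_alg) = Poly_Mapping.single (Word []) 1"
  by (simp flip: single_one add: zero_word_def)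

lemma eval_alg_linear_extension: "eval_alg A = linear_extension (smul A) (\<lambda>w. prod_list (map (gen_val A) (letters w)))"
  by (simp add: fun_eq_iff eval_alg_def linear_extension_def)

lemma k_algebraD:
  assumes "k_algebra s"
  shows "vector_space s" "s c x * y = s c (x * y)" "x * s c y = s c (x * y)"
  using assms by (auto simp: k_algebra_def)

lemma eval_alg_add:
  assumes "k_algebra (smul A)"
  shows "eval_alg A (p + r) = eval_alg A p + eval_alg A r"
  using linear_extension_add[OF k_algebraD(1)[OF assms]] by (simp add: eval_alg_linear_extension)

lemma eval_alg_single:
  assumes "k_algebra (smul A)"
  shows "eval_alg A (Poly_Mapping.single w c) = smul A c (prod_list (map (gen_val A) (letters w)))"
  using linear_extension_single[OF k_algebraD(1)[OF assms]] by (simp add: eval_alg_linear_extension)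

lemma eval_alg_mult:
  assumes "k_algebra (smul A)"
  shows "eval_alg A (p * r) = eval_alg A p * eval_alg A r"
proof -
  interpret vector_space "smul A" using k_algebraD(1)[OF assms] .
  note ev = eval_alg_add[OF assms] eval_alg_single[OF assms]
  have *: "eval_alg A (Poly_Mapping.single w c * r) = eval_alg A (Poly_Mapping.single w c) * eval_alg A r" for w c
    by (rule poly_mapping_additive_eq[of "\<lambda>r. eval_alg A (Poly_Mapping.single w c * r)"])
      (auto simp: ev algebra_simps mult_single plus_word_def k_algebraD[OF assms])
  show ?thesis
    by (rule poly_mapping_additive_eq[of "\<lambda>p. eval_alg A (p * r)" "\<lambda>p. eval_alg A p * eval_alg A r"])
      (auto simp only: * ev distrib_right)
qed

lemma eval_alg_gen_var:
  assumes "k_algebra (smul A)"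
  shows "eval_alg A (gen_var g) = gen_val A g"
proof -
  interpret vector_space "smul A" using k_algebraD(1)[OF assms] .
  show ?thesis by (simp add: gen_var_def eval_alg_single[OF assms])
qed

lemma eval_alg_one:
  assumes "k_algebra (smul A)"
  shows "eval_alg A 1 = 1"
proof -
  interpret vector_space "smul A" using k_algebraD(1)[OF assms] .
  show ?thesis by (simp add: free_alg_one eval_alg_single[OF assms])
qed

text \<open>The universal property of a presented algebra: a linear map on the free algebra that kills the
relators' ideal does not depend on the representative chosen for an element of \<open>A\<close>. Only additivity
is asked for, so the lemma serves row functionals and an anti-homomorphism alike.\<close>

lemma presented_factor:
  fixes L :: "('x rack_gen, 'k::field) free_alg \<Rightarrow> 'v::ab_group_add"
  assumes A: "presented_by A E" and add: "\<And>p r. L (p + r) = L p + L r"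
    and kill: "\<And>p. p \<in> two_sided_ideal E \<Longrightarrow> L p = 0"
  shows "L (SOME r. eval_alg A r = eval_alg A p) = L p"
proof -
  have k: "k_algebra (smul A)" using A by (simp add: presented_by_def)
  let ?r = "SOME r. eval_alg A r = eval_alg A p"
  have "eval_alg A ?r = eval_alg A p" by (rule someI[of _ p]) simp
  then have "eval_alg A (?r - p) = 0"
    by (simp add: additive_uminus(1)[of "eval_alg A", OF eval_alg_add[OF k]])
  then have "L (?r - p) = 0" using A kill by (auto simp: presented_by_def)
  then show ?thesis by (simp add: additive_uminus(1)[of L, OF add])
qed

lemma two_sided_ideal_vanish:
  assumes add: "\<And>p r. L (p + r) = L p + (L r :: 'v::ab_group_add)"
    and mult: "\<And>p r t. L r = 0 \<Longrightarrow> L (p * r * t) = 0"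
    and base: "\<And>r. r \<in> E \<Longrightarrow> L r = 0"
    and p: "p \<in> two_sided_ideal E"
  shows "L p = 0"
  using p by induction (auto simp: add mult base additive_uminus(2)[of L, OF add])

section \<open>Finitely supported functionals\<close>

text \<open>A finitely supported family of coefficients \<open>c\<^sub>b\<close>, stored as the functional \<open>\<phi> \<mapsto> \<Sum>\<^sub>b c\<^sub>b \<phi> b\<close>. In this form
a convolution product is a composition of functionals and a reindexing is a substitution, so no
double sums have to be rearranged. The inductive generation turns linearity, finite support and
closure under composition into rule inductions.\<close>

inductive_set fin_functionals :: "'i set \<Rightarrow> (('i \<Rightarrow> 'k::field) \<Rightarrow> 'k) set" for P where
  zero: "(\<lambda>_. 0) \<in> fin_functionals P"
| eval: "b \<in> P \<Longrightarrow> (\<lambda>\<phi>. \<phi> b) \<in> fin_functionals P"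
| add: "L \<in> fin_functionals P \<Longrightarrow> M \<in> fin_functionals P \<Longrightarrow> (\<lambda>\<phi>. L \<phi> + M \<phi>) \<in> fin_functionals P"
| scale: "L \<in> fin_functionals P \<Longrightarrow> (\<lambda>\<phi>. c * L \<phi>) \<in> fin_functionals P"

lemma fin_functional_add: "L \<in> fin_functionals P \<Longrightarrow> L (\<lambda>b. \<phi> b + \<psi> b) = L \<phi> + L \<psi>"
  by (induction rule: fin_functionals.induct) (auto simp: algebra_simps)

lemma fin_functional_scale: "L \<in> fin_functionals P \<Longrightarrow> L (\<lambda>b. c * \<phi> b) = c * L \<phi>"
  by (induction rule: fin_functionals.induct) (auto simp: algebra_simps)

lemma fin_functional_zero [simp]: "L \<in> fin_functionals P \<Longrightarrow> L (\<lambda>b. 0) = 0"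
  using fin_functional_scale[of L P 0] by simp

lemma fin_functional_const: "L \<in> fin_functionals P \<Longrightarrow> L (\<lambda>b. c) = c * L (\<lambda>b. 1)"
  using fin_functional_scale[of L P c "\<lambda>_. 1"] by simp

lemma fin_functional_sum:
  "L \<in> fin_functionals P \<Longrightarrow> L (\<lambda>b. \<Sum>i\<in>I. \<phi> i b) = (\<Sum>i\<in>I. L (\<phi> i))"
proof (induction I rule: infinite_finite_induct)
  case (insert i I)
  then show ?case using fin_functional_add[of L P "\<phi> i" "\<lambda>b. \<Sum>i\<in>I. \<phi> i b"] by simp
qed simp_all

lemma fin_functional_support:
  assumes "L \<in> fin_functionals P"
  shows "\<exists>K. finite K \<and> K \<subseteq> P \<and> (\<forall>\<phi> \<psi>. (\<forall>b\<in>K. \<phi> b = \<psi> b) \<longrightarrow> L \<phi> = L \<psi>)"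
  using assms
proof (induction rule: fin_functionals.induct)
  case zero show ?case by (intro exI[of _ "{}"]) auto
next
  case (eval b) then show ?case by (intro exI[of _ "{b}"]) auto
next
  case (add L M)
  then obtain K K' where *: "finite K" "K \<subseteq> P" "\<forall>\<phi> \<psi>. (\<forall>b\<in>K. \<phi> b = \<psi> b) \<longrightarrow> L \<phi> = L \<psi>"
    "finite K'" "K' \<subseteq> P" "\<forall>\<phi> \<psi>. (\<forall>b\<in>K'. \<phi> b = \<psi> b) \<longrightarrow> M \<phi> = M \<psi>" by blast
  have "L \<phi> + M \<phi> = L \<psi> + M \<psi>" if "\<forall>b\<in>K \<union> K'. \<phi> b = \<psi> b" for \<phi> \<psi>
    using that *(3)[rule_format, of \<phi> \<psi>] *(6)[rule_format, of \<phi> \<psi>] by simp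
  with *(1,2,4,5) show ?case by (intro exI[of _ "K \<union> K'"]) blast
next
  case (scale L c) then show ?case by metis
qed

lemma fin_functional_cong:
  assumes "L \<in> fin_functionals P" "\<And>b. b \<in> P \<Longrightarrow> \<phi> b = \<psi> b"
  shows "L \<phi> = L \<psi>"
  using fin_functional_support[OF assms(1)] assms(2) by blast

lemma fin_functional_bind:
  assumes "L \<in> fin_functionals P" "\<And>b. b \<in> P \<Longrightarrow> M b \<in> fin_functionals P'"
  shows "(\<lambda>\<phi>. L (\<lambda>b. M b \<phi>)) \<in> fin_functionals P'"
  using assms by (induction rule: fin_functionals.induct) (auto intro: fin_functionals.intros)

lemma fin_functional_map:
  assumes "L \<in> fin_functionals P" "\<And>b. b \<in> P \<Longrightarrow> g b \<in> P'"
  shows "(\<lambda>\<phi>. L (\<lambda>b. \<phi> (g b))) \<in> fin_functionals P'"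
  using fin_functional_bind[OF assms(1), of "\<lambda>b \<phi>. \<phi> (g b)" P'] assms(2) by (auto intro: fin_functionals.eval)

section \<open>Relations in the quandle algebra of a group\<close>

text \<open>The defining relations with \<open>q\<close> a strong homomorphism of a group: here \<open>b \<triangleright> a = b\<^sup>-\<^sup>1 a b\<close>.\<close>

locale strong_quandle_algebra = group bul e star
  for bul :: "'x \<Rightarrow> 'x \<Rightarrow> 'x" (infixl "\<bullet>" 70) and e :: 'x and star :: "'x \<Rightarrow> 'x" +
  fixes A :: "('x, 'k::field, 'a::ring_1) rack_alg" and tr :: "'x \<Rightarrow> 'x \<Rightarrow> 'x"
  assumes quandle: "quandle_algebra A tr bul (strong_hom_relators bul)"
begin

abbreviation "h \<equiv> hgen A"
abbreviation "q \<equiv> qgen A"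
abbreviation "sm \<equiv> smul A"

abbreviation conj_by :: "'x \<Rightarrow> 'x \<Rightarrow> 'x" where "conj_by b a \<equiv> star b \<bullet> a \<bullet> b"

abbreviation relators :: "('x rack_gen, 'k) free_alg set" where
  "relators \<equiv> rack_relators tr \<union> norm_relators \<union> strong_hom_relators bul"

lemma star_cancel [simp]: "star a \<bullet> (a \<bullet> b) = b" "a \<bullet> (star a \<bullet> b) = b"
  by (simp_all flip: assoc)

lemma relators_mem:
  "gen_var (GQinv a) * gen_var (GQ a) - 1 \<in> relators"
  "gen_var (GQ a) * gen_var (GQinv a) - 1 \<in> relators"
  "gen_var (GH a) * gen_var (GH b) - (if a = b then gen_var (GH a) ^ 2 else 0) \<in> relators"
  "gen_var (GQ b) * gen_var (GH (tr b a)) - gen_var (GH a) * gen_var (GQ b) \<in> relators"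
  "gen_var (GH a) ^ 2 - gen_var (GH a) \<in> relators"
  "gen_var (GQ a) * gen_var (GQ b) - gen_var (GQ (a \<bullet> b)) \<in> relators"
  unfolding rack_relators_def norm_relators_def strong_hom_relators_def
       apply (rule UnI1, rule UnI1, rule UnI1, rule UN_I[of a]; simp)
      apply (rule UnI1, rule UnI1, rule UnI1, rule UN_I[of a]; simp)
     apply (rule UnI1, rule UnI1, rule UnI2, rule UN_I[of a, OF UNIV_I], rule UN_I[of b]; simp)
    apply (rule UnI1, rule UnI1, rule UnI2, rule UN_I[of a, OF UNIV_I], rule UN_I[of b]; simp)
   apply (rule UnI1, rule UnI2, rule UnI1, rule UN_I[of a]; simp)
  apply (rule UnI2, rule UN_I[of a, OF UNIV_I], rule UN_I[of b]; simp)
  done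

lemma presented: "presented_by A relators"
  using quandle by (simp add: quandle_algebra_def rack_algebra_def)

lemma kalg: "k_algebra sm"
  using presented by (simp add: presented_by_def)

sublocale vector_space sm using k_algebraD(1)[OF kalg] .

lemma smul_mult [simp]: "sm c x * y = sm c (x * y)" "x * sm c y = sm c (x * y)"
  using k_algebraD[OF kalg] by auto

lemma tr_eq: "tr b a = conj_by b a"
proof -
  have "a \<bullet> b = b \<bullet> tr b a" using quandle by (simp add: quandle_algebra_def)
  then have "star b \<bullet> (a \<bullet> b) = tr b a" by simp
  then show ?thesis by (simp add: assoc)
qed

lemmas eval_simps = eval_alg_add[OF kalg] eval_alg_mult[OF kalg] eval_alg_gen_var[OF kalg] eval_alg_one[OF kalg]
  additive_uminus[of "eval_alg A", OF eval_alg_add[OF kalg]]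

lemma eval_relator: "r \<in> relators \<Longrightarrow> eval_alg A r = 0"
  using presented two_sided_ideal.base[of r relators] unfolding presented_by_def by blast

lemma eval_surj: "\<exists>p. x = eval_alg A p"
  using presented by (auto simp: presented_by_def surj_def)

lemma eval_alg_eqI: "p - r \<in> relators \<Longrightarrow> eval_alg A p = eval_alg A r"
  using eval_relator[of "p - r"] by (simp add: eval_simps)

lemma q_mult: "q a * q b = q (a \<bullet> b)"
  using eval_alg_eqI[OF relators_mem(6)[of a b]] by (simp add: eval_simps)

lemma qinv_q: "qinv A a * q a = 1"
  using eval_alg_eqI[OF relators_mem(1)[of a]] by (simp add: eval_simps)

lemma q_e: "q e = 1"
proof -
  have "qinv A e * (q e * q e) = qinv A e * q e" by (simp add: q_mult)
  then show ?thesis by (simp flip: mult.assoc add: qinv_q)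
qed

lemma qinv_eq: "qinv A a = q (star a)"
proof -
  have "qinv A a * (q a * q (star a)) = qinv A a" by (simp add: q_mult q_e)
  then show ?thesis by (simp flip: mult.assoc add: qinv_q)
qed

lemma h_q: "h a * q b = q b * h (conj_by b a)"
  using eval_alg_eqI[OF relators_mem(4)[of b a]] by (simp add: eval_simps tr_eq)

lemma h_idem: "h a * h a = h a"
  using eval_alg_eqI[OF relators_mem(5)[of a]] by (simp add: eval_simps power2_eq_square)

lemma h_orth: "h a * h b = (if a = b then h a else 0)"
  using eval_alg_eqI[OF relators_mem(3)[of a b]] h_idem by (simp add: eval_simps split: if_splits)

text \<open>The multiplication table of the monomials: \<open>q\<^sub>b\<close> moves past \<open>h\<^sub>c\<close> by conjugation, and the \<open>h\<close> are orthogonal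
idempotents. All products of tensors below reduce to this rule.\<close>

lemma hq_mult: "(h a * q b) * (h c * q d) = (if c = conj_by b a then h a * q (b \<bullet> d) else 0)"
proof -
  have "(h a * q b) * (h c * q d) = q b * (h (conj_by b a) * h c) * q d"
    by (simp add: h_q mult.assoc)
  also have "\<dots> = (if c = conj_by b a then q b * h (conj_by b a) * q d else 0)"
    by (auto simp: h_orth)
  also have "q b * h (conj_by b a) * q d = h a * q (b \<bullet> d)"
    by (simp flip: h_q add: mult.assoc q_mult)
  finally show ?thesis .
qed

lemma h_sum_mult:
  assumes "finite F" shows "(\<Sum>a\<in>F. h a) * h b = (if b \<in> F then h b else 0)"
    "h b * (\<Sum>a\<in>F. h a) = (if b \<in> F then h b else 0)"
  using assms by (auto simp: sum_distrib_left sum_distrib_right h_orth sum.delta sum.delta')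

section \<open>Rows of an element\<close>

text \<open>Reading a word from the left, \<open>h\<^sub>a w\<close> is either zero or a single monomial \<open>h\<^sub>a q\<^sub>g\<close>. The recursion keeps
track of the conjugated index \<open>a\<close> and of the group element \<open>g\<close>, and returns \<open>\<phi> g\<close> or \<open>0\<close>.\<close>

fun word_row :: "'x rack_gen list \<Rightarrow> 'x \<Rightarrow> ('x \<Rightarrow> 'k) \<Rightarrow> 'k" where
  "word_row [] a \<phi> = \<phi> e"
| "word_row (GQ b # w) a \<phi> = word_row w (conj_by b a) (\<lambda>g. \<phi> (b \<bullet> g))"
| "word_row (GQinv b # w) a \<phi> = word_row w (conj_by (star b) a) (\<lambda>g. \<phi> (star b \<bullet> g))"
| "word_row (GH c # w) a \<phi> = (if a = c then word_row w a \<phi> else 0)"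

lemma word_row_fin: "word_row w a \<in> fin_functionals UNIV"
proof (induction w arbitrary: a)
  case Nil then show ?case by (simp add: fun_eq_iff fin_functionals.eval)
next
  case (Cons g w)
  show ?case
  proof (cases g)
    case (GQ b)
    then show ?thesis using fin_functional_map[OF Cons, of "\<lambda>g. b \<bullet> g" UNIV "conj_by b a"] by simp
  next
    case (GQinv b)
    then show ?thesis using fin_functional_map[OF Cons, of "\<lambda>g. star b \<bullet> g" UNIV "conj_by (star b) a"] by simp
  next
    case (GH c)
    then show ?thesis using Cons[of a] by (cases "a = c") (auto intro: fin_functionals.zero)
  qed
qed

lemma word_row_append:
  "word_row (u @ v) a \<phi> = word_row u a (\<lambda>b. word_row v (conj_by b a) (\<lambda>g. \<phi> (b \<bullet> g)))"
proof (induction u a \<phi> rule: word_row.induct)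
  case (1 a \<phi>)
  then show ?case by simp
qed (simp_all add: inverse_distrib_swap assoc)

definition free_row :: "('x rack_gen, 'k) free_alg \<Rightarrow> 'x \<Rightarrow> ('x \<Rightarrow> 'k) \<Rightarrow> 'k" where
  "free_row p a \<phi> = linear_extension (*) (\<lambda>w. word_row (letters w) a \<phi>) p"

lemma field_vector_space: "vector_space ((*) :: 'k \<Rightarrow> 'k \<Rightarrow> 'k)"
  by standard (auto simp: algebra_simps)

lemma free_row_add: "free_row (p + r) a \<phi> = free_row p a \<phi> + free_row r a \<phi>"
  and free_row_single: "free_row (Poly_Mapping.single w c) a \<phi> = c * word_row (letters w) a \<phi>"
  unfolding free_row_def by (simp_all add: linear_extension_add[OF field_vector_space] linear_extension_single[OF field_vector_space])

lemma free_row_fin: "free_row p a \<in> fin_functionals UNIV"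
proof -
  have "(\<lambda>\<phi>. \<Sum>w\<in>K. Poly_Mapping.lookup p w * word_row (letters w) a \<phi>) \<in> fin_functionals UNIV" for K
  proof (induction K rule: infinite_finite_induct)
    case (insert w K)
    show ?case
      unfolding sum.insert[OF insert(1,2)]
      by (rule fin_functionals.add[OF fin_functionals.scale[OF word_row_fin] insert(3)])
  qed (simp_all add: fin_functionals.zero)
  then show ?thesis unfolding free_row_def linear_extension_def .
qed

text \<open>Convolution: the coefficient of \<open>h\<^sub>a q\<^sub>g\<close> in a product is \<open>\<Sum>\<^sub>b p(a,b) r(b\<^sup>-\<^sup>1 a b, b\<^sup>-\<^sup>1 g)\<close>, because after reading
\<open>q\<^sub>b\<close> the index \<open>a\<close> has been conjugated by \<open>b\<close>. Since rows of zero vanish, the rows kill the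
two-sided ideal as soon as they kill the relators.\<close>

lemma free_row_mult:
  "free_row (p * r) a \<phi> = free_row p a (\<lambda>b. free_row r (conj_by b a) (\<lambda>g. \<phi> (b \<bullet> g)))"
proof -
  have *: "free_row (Poly_Mapping.single w c * r) a \<phi> =
      c * word_row (letters w) a (\<lambda>b. free_row r (conj_by b a) (\<lambda>g. \<phi> (b \<bullet> g)))" for w c
  proof (rule poly_mapping_additive_eq[of "\<lambda>r. free_row (Poly_Mapping.single w c * r) a \<phi>"
        "\<lambda>r. c * word_row (letters w) a (\<lambda>b. free_row r (conj_by b a) (\<lambda>g. \<phi> (b \<bullet> g)))"])
    show "free_row (Poly_Mapping.single w c * Poly_Mapping.single v d) a \<phi> =
      c * word_row (letters w) a (\<lambda>b. free_row (Poly_Mapping.single v d) (conj_by b a) (\<lambda>g. \<phi> (b \<bullet> g)))" for v d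
      by (simp add: mult_single plus_word_def free_row_single word_row_append
          fin_functional_scale[OF word_row_fin])
  qed (auto simp: algebra_simps free_row_add fin_functional_add[OF word_row_fin])
  show ?thesis
    by (rule poly_mapping_additive_eq[of "\<lambda>p. free_row (p * r) a \<phi>"
        "\<lambda>p. free_row p a (\<lambda>b. free_row r (conj_by b a) (\<lambda>g. \<phi> (b \<bullet> g)))"])
      (auto simp only: * distrib_right free_row_add free_row_single)
qed

lemma free_row_simps:
  "free_row 1 a \<phi> = \<phi> e"
  "free_row (gen_var (GQ b)) a \<phi> = \<phi> b"
  "free_row (gen_var (GQinv b)) a \<phi> = \<phi> (star b)"
  "free_row (gen_var (GH c)) a \<phi> = (if a = c then \<phi> e else 0)"
  "free_row (p - r) a \<phi> = free_row p a \<phi> - free_row r a \<phi>"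
  "free_row 0 a \<phi> = 0"
  "finite I \<Longrightarrow> free_row (\<Sum>i\<in>I. g i) a \<phi> = (\<Sum>i\<in>I. free_row (g i) a \<phi>)"
  using additive_uminus[of "\<lambda>p. free_row p a \<phi>"]
  by (simp_all add: free_alg_one gen_var_def free_row_single free_row_add)

lemma free_row_relator: assumes "r \<in> relators" shows "free_row r a \<phi> = 0"
proof -
  have cjI: "star b \<bullet> x = y \<longleftrightarrow> x = b \<bullet> y" for b x y
    by (metis star_cancel)
  show ?thesis
    using assms unfolding rack_relators_def norm_relators_def strong_hom_relators_def
    by (auto simp: free_row_simps free_row_mult power2_eq_square tr_eq assoc cjI right_cancel split: if_splits)
qed

lemma free_row_ideal: "p \<in> two_sided_ideal relators \<Longrightarrow> free_row p a \<phi> = 0"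
proof -
  assume "p \<in> two_sided_ideal relators"
  then have "\<forall>a \<phi>. free_row p a \<phi> = 0"
  proof induction
    case (mult r p s)
    then show ?case by (simp add: free_row_mult fin_functional_zero[OF free_row_fin])
  qed (auto simp: free_row_simps free_row_add free_row_relator)
  then show ?thesis by blast
qed

text \<open>\<open>row x a \<phi> = \<Sum>\<^sub>b c\<^sub>b \<phi> b\<close>, where \<open>h\<^sub>a x = \<Sum>\<^sub>b c\<^sub>b h\<^sub>a q\<^sub>b\<close>. The choice of a preimage is immaterial by
\<open>presented_factor\<close>, see \<open>row_eval\<close>, which amounts to the linear independence
of the monomials \<open>h\<^sub>a q\<^sub>b\<close>.\<close>

definition row :: "'a \<Rightarrow> 'x \<Rightarrow> ('x \<Rightarrow> 'k) \<Rightarrow> 'k" where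
  "row x = free_row (SOME p. eval_alg A p = x)"

lemma row_eval: "row (eval_alg A p) a \<phi> = free_row p a \<phi>"
  unfolding row_def
  by (rule presented_factor[OF presented, of "\<lambda>p. free_row p a \<phi>"])
    (auto simp: free_row_add free_row_ideal)

lemma row_fin [simp]: "row x a \<in> fin_functionals UNIV"
  by (simp add: row_def free_row_fin)

lemma row_add: "row (x + y) a \<phi> = row x a \<phi> + row y a \<phi>"
proof -
  obtain p r where "x = eval_alg A p" "y = eval_alg A r" using eval_surj by metis
  then show ?thesis by (simp add: row_eval free_row_add flip: eval_simps(1))
qed

lemma row_mult: "row (x * y) a \<phi> = row x a (\<lambda>b. row y (conj_by b a) (\<lambda>g. \<phi> (b \<bullet> g)))"
proof -
  obtain p r where "x = eval_alg A p" "y = eval_alg A r" using eval_surj by metis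
  then show ?thesis by (simp add: row_eval free_row_mult flip: eval_simps(2))
qed

lemma row_one: "row 1 a \<phi> = \<phi> e"
  using row_eval[of 1] by (simp add: eval_simps free_row_simps)

lemma row_q: "row (q b) a \<phi> = \<phi> b"
  using row_eval[of "gen_var (GQ b)"] by (simp add: eval_simps free_row_simps)

lemma row_h: "row (h c) a \<phi> = (if a = c then \<phi> e else 0)"
  using row_eval[of "gen_var (GH c)"] by (simp add: eval_simps free_row_simps)

lemma row_smul: "row (sm c x) a \<phi> = c * row x a \<phi>"
proof -
  have "row (sm c 1) a \<phi> = c * \<phi> e" for a \<phi>
    using row_eval[of "Poly_Mapping.single (Word []) c"]
    by (simp add: eval_alg_single[OF kalg] free_row_single)
  then show ?thesis using row_mult[of "sm c 1" x a \<phi>] by simp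
qed

lemma row_hq: "row (h c * q b) a \<phi> = (if a = c then \<phi> b else 0)"
  by (simp add: row_mult row_h row_q)

lemma h_word_expand:
  assumes "\<And>x y. g (x + y) = g x + g y" "\<And>c x. g (sm c x) = c * (g x :: 'k)"
  shows "g (h a * prod_list (map (gen_val A) w)) = word_row w a (\<lambda>b. g (h a * q b))"
  using assms
proof (induction w arbitrary: a g)
  case Nil then show ?case by (simp add: q_e)
next
  case (Cons l w)
  have g0: "g 0 = 0" using Cons.prems(2)[of 0 0] by simp
  have *: "g (h a * (q b * prod_list (map (gen_val A) w))) =
      word_row w (conj_by b a) (\<lambda>d. g (h a * q (b \<bullet> d)))" for b
  proof -
    have "g (h a * (q b * prod_list (map (gen_val A) w))) =
        g (q b * (h (conj_by b a) * prod_list (map (gen_val A) w)))"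
      by (simp flip: mult.assoc add: h_q)
    also have "\<dots> = word_row w (conj_by b a) (\<lambda>d. g (q b * (h (conj_by b a) * q d)))"
      by (rule Cons.IH) (auto simp: Cons.prems algebra_simps)
    also have "(\<lambda>d. g (q b * (h (conj_by b a) * q d))) = (\<lambda>d. g (h a * q (b \<bullet> d)))"
      by (simp only: mult.assoc[symmetric] h_q[of a b, symmetric]) (simp only: mult.assoc q_mult)
    finally show ?thesis .
  qed
  show ?case
  proof (cases l)
    case (GQ b) then show ?thesis using * by simp
  next
    case (GQinv b) then show ?thesis using *[of "star b"] by (simp add: qinv_eq)
  next
    case (GH c)
    then show ?thesis using Cons.IH[OF Cons.prems] by (simp flip: mult.assoc add: h_orth g0)
  qed
qed

text \<open>The rows are the coefficients of \<open>h\<^sub>a x\<close> in the monomials \<open>h\<^sub>a q\<^sub>b\<close>, tested against an arbitrary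
linear functional on \<open>A\<close>.\<close>

lemma h_expand:
  assumes g: "\<And>x y. g (x + y) = g x + g y" "\<And>c x. g (sm c x) = c * (g x :: 'k)"
  shows "g (h a * x) = row x a (\<lambda>b. g (h a * q b))"
proof -
  obtain p where p: "x = eval_alg A p" using eval_surj by metis
  have "g (h a * eval_alg A p) = free_row p a (\<lambda>b. g (h a * q b))"
  proof (rule poly_mapping_additive_eq[of "\<lambda>p. g (h a * eval_alg A p)"])
    show "g (h a * eval_alg A (Poly_Mapping.single w c)) =
        free_row (Poly_Mapping.single w c) a (\<lambda>b. g (h a * q b))" for w c
      by (simp add: eval_alg_single[OF kalg] free_row_single g h_word_expand[of g, OF g])
  qed (auto simp: eval_simps algebra_simps g free_row_add)
  then show ?thesis by (simp add: p row_eval)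
qed

text \<open>Multiplication from the left by \<open>h\<^sub>a\<close> also cuts down \<open>x\<close> on the right: \<open>h\<^sub>a q\<^sub>g = q\<^sub>g h\<^sub>d\<close> for a conjugate \<open>d\<close> of \<open>a\<close>,
and only finitely many \<open>g\<close> occur. This makes \<open>y \<mapsto> f (x y)\<close> a form when \<open>f\<close> is one.\<close>

lemma h_right_window:
  "\<exists>F. finite F \<and> (\<forall>G. finite G \<longrightarrow> F \<subseteq> G \<longrightarrow> h a * x * (\<Sum>c\<in>G. h c) = h a * x)"
proof -
  obtain p where p: "x = eval_alg A p" using eval_surj by metis
  \<comment> \<open>For a word, \<open>h\<^sub>a w\<close> is zero or \<open>h\<^sub>a q\<^sub>g\<close>, so a single index \<open>d\<close> suffices.\<close>
  have word: "\<exists>d. \<forall>G. finite G \<longrightarrow> d \<in> G \<longrightarrow>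
    h a * prod_list (map (gen_val A) w) * (\<Sum>c\<in>G. h c) = h a * prod_list (map (gen_val A) w)" for w a
  proof (induction w arbitrary: a)
    case Nil then show ?case by (auto simp: h_sum_mult)
  next
    case (Cons l w)
    let ?w = "prod_list (map (gen_val A) w)"
    have *: "\<exists>d. \<forall>G. finite G \<longrightarrow> d \<in> G \<longrightarrow>
        h a * (q b * ?w) * (\<Sum>c\<in>G. h c) = h a * (q b * ?w)" for b
    proof -
      have "h a * (q b * ?w) = q b * (h (conj_by b a) * ?w)" by (simp flip: mult.assoc add: h_q)
      then show ?thesis using Cons[of "conj_by b a"] by (simp add: mult.assoc) metis
    qed
    show ?case
    proof (cases l)
      case (GQ b) then show ?thesis using * by simp
    next
      case (GQinv b) then show ?thesis using *[of "star b"] by (simp add: qinv_eq)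
    next
      case (GH c) then show ?thesis using Cons[of a] by (cases "a = c") (simp_all flip: mult.assoc add: h_orth)
    qed
  qed
  have "\<exists>F. finite F \<and> (\<forall>G. finite G \<longrightarrow> F \<subseteq> G \<longrightarrow>
      h a * (\<Sum>w\<in>K. sm (Poly_Mapping.lookup p w) (prod_list (map (gen_val A) (letters w)))) * (\<Sum>c\<in>G. h c) =
      h a * (\<Sum>w\<in>K. sm (Poly_Mapping.lookup p w) (prod_list (map (gen_val A) (letters w)))))" for K
  proof (induction K rule: infinite_finite_induct)
    case (insert w K)
    then obtain F where F: "finite F" "\<forall>G. finite G \<longrightarrow> F \<subseteq> G \<longrightarrow>
      h a * (\<Sum>w\<in>K. sm (Poly_Mapping.lookup p w) (prod_list (map (gen_val A) (letters w)))) * (\<Sum>c\<in>G. h c) =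
      h a * (\<Sum>w\<in>K. sm (Poly_Mapping.lookup p w) (prod_list (map (gen_val A) (letters w))))" by blast
    obtain d where "\<forall>G. finite G \<longrightarrow> d \<in> G \<longrightarrow>
      h a * prod_list (map (gen_val A) (letters w)) * (\<Sum>c\<in>G. h c) = h a * prod_list (map (gen_val A) (letters w))"
      using word by blast
    with F insert(1,2) show ?case by (intro exI[of _ "insert d F"]) (auto simp: algebra_simps)
  qed auto
  from this[of "Poly_Mapping.keys p"] show ?thesis unfolding p eval_alg_def .
qed

lemma sum_h_right_window:
  assumes "finite F"
  shows "\<exists>F'. finite F' \<and> (\<forall>G. finite G \<longrightarrow> F' \<subseteq> G \<longrightarrow> (\<Sum>a\<in>F. h a) * x * (\<Sum>c\<in>G. h c) = (\<Sum>a\<in>F. h a) * x)"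
proof -
  obtain W where W: "\<And>a. finite (W a)"
      "\<And>a G. finite G \<Longrightarrow> W a \<subseteq> G \<Longrightarrow> h a * x * (\<Sum>c\<in>G. h c) = h a * x"
    using h_right_window[of _ x] by metis
  have "(\<Sum>a\<in>F. h a) * x * (\<Sum>c\<in>G. h c) = (\<Sum>a\<in>F. h a) * x" if "finite G" "(\<Union>a\<in>F. W a) \<subseteq> G" for G
  proof -
    have "(\<Sum>a\<in>F. h a * x * (\<Sum>c\<in>G. h c)) = (\<Sum>a\<in>F. h a * x)"
      using that by (intro sum.cong refl W) auto
    then show ?thesis by (simp only: sum_distrib_right)
  qed
  then show ?thesis using assms W(1) by (intro exI[of _ "\<Union>a\<in>F. W a"]) blast
qed

end

section \<open>Multilinear maps and formal sums\<close>

lemma multilinear_zero: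
  fixes f :: "'a::ring_1 list \<Rightarrow> 'w::ab_group_add"
  assumes "multilinear s s' n f" "length xs = n" "i < n" "xs ! i = 0"
  shows "f xs = 0"
proof -
  have "f (xs[i := 0]) = 0" using multilinear_sum[OF assms(1-3), of "{}"] by simp
  then show ?thesis using assms(4) by (metis list_update_id)
qed

lemma multilinear_Cons:
  fixes f :: "'a::ab_group_add list \<Rightarrow> 'w::ab_group_add"
  assumes "multilinear s s' (Suc n) f" shows "multilinear s s' n (\<lambda>ys. f (y # ys))"
  unfolding multilinear_def
proof (intro allI impI)
  fix xs :: "'a list" and i x z c assume "length xs = n" "i < n"
  then show "f (y # xs[i := x + z]) = f (y # xs[i := x]) + f (y # xs[i := z]) \<and>
      f (y # xs[i := s c x]) = s' c (f (y # xs[i := x]))"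
    using multilinearD[OF assms, of "y # xs" "Suc i"] by simp
qed

lemma multilinear_head:
  assumes "multilinear s s' (Suc n) f" "length ys = n"
  shows "f ((x + y) # ys) = f (x # ys) + f (y # ys)" "f (s c x # ys) = s' c (f (x # ys))"
  using multilinearD[OF assms(1), of "x # ys" 0] assms(2) by simp_all

lemma multilinear2I:
  assumes "\<And>x y z. f [x + y, z] = f [x, z] + f [y, z]" "\<And>x y z. f [z, x + y] = f [z, x] + f [z, y]"
    "\<And>c x z. f [s c x, z] = s' c (f [x, z])" "\<And>c x z. f [z, s c x] = s' c (f [z, x])"
  shows "multilinear s s' 2 f"
  unfolding multilinear_def
  using assms by (auto simp: length_Suc_conv numeral_2_eq_2 less_Suc_eq)

lemma has_formal_sumI:
  assumes "\<And>f. \<exists>K. finite K \<and> K \<subseteq> I \<and> (\<forall>i\<in>I - K. u i f = 0) \<and> t f = (\<Sum>i\<in>K. u i f)"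
  shows "has_formal_sum u I t"
  unfolding has_formal_sum_def
proof
  fix f
  from assms obtain K where K: "finite K" "K \<subseteq> I" "\<forall>i\<in>I - K. u i f = 0" "t f = (\<Sum>i\<in>K. u i f)"
    by metis
  have sub: "{i \<in> I. u i f \<noteq> 0} \<subseteq> K" using K by auto
  then have "(\<Sum>i\<in>K. u i f) = (\<Sum>i | i \<in> I \<and> u i f \<noteq> 0. u i f)"
    using K by (intro sum.mono_neutral_right) auto
  then show "finite {i \<in> I. u i f \<noteq> 0} \<and> t f = (\<Sum>i | i \<in> I \<and> u i f \<noteq> 0. u i f)"
    using K finite_subset[OF sub] by simp
qed

lemma has_formal_sum_cong:
  assumes "\<And>i. i \<in> I \<Longrightarrow> u i = u' i"
  shows "has_formal_sum u I t \<longleftrightarrow> has_formal_sum u' I t"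
proof -
  have "{i \<in> I. u i f \<noteq> 0} = {i \<in> I. u' i f \<noteq> 0}" for f using assms by auto
  moreover have "(\<Sum>i | i \<in> I \<and> u i f \<noteq> 0. u i f) = (\<Sum>i | i \<in> I \<and> u' i f \<noteq> 0. u' i f)" for f
    using assms by (intro sum.cong) auto
  ultimately show ?thesis unfolding has_formal_sum_def by simp
qed

lemma has_formal_sum_unique:
  "has_formal_sum u I t \<Longrightarrow> has_formal_sum u I t' \<Longrightarrow> t = t'"
  unfolding has_formal_sum_def by (metis ext)

context strong_quandle_algebra
begin

section \<open>Forms and their windows\<close>

abbreviation hsum :: "'x set \<Rightarrow> 'a" where "hsum F \<equiv> \<Sum>a\<in>F. h a"

abbreviation hmult :: "'x list \<Rightarrow> 'a list \<Rightarrow> 'a list" where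
  "hmult as xs \<equiv> map2 (\<lambda>a x. h a * x) as xs"

text \<open>The monomials \<open>h\<^bsub>a\<^sub>1\<^esub> q\<^bsub>b\<^sub>1\<^esub>, \<dots>, h\<^bsub>a\<^sub>n\<^esub> q\<^bsub>b\<^sub>n\<^esub>\<close>; rows are functionals in the \<open>b\<close> for fixed \<open>a\<close>.\<close>

abbreviation basis :: "'x list \<Rightarrow> 'x list \<Rightarrow> 'a list" where
  "basis as bs \<equiv> hmult as (map q bs)"

abbreviation conj_list :: "'x list \<Rightarrow> 'x list \<Rightarrow> 'x list" where
  "conj_list bs as \<equiv> map2 conj_by bs as"

abbreviation mult_list :: "'x list \<Rightarrow> 'x list \<Rightarrow> 'x list" where
  "mult_list bs ds \<equiv> map2 bul bs ds"

lemma hsum_idem: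
  assumes "finite G" "F \<subseteq> G" shows "hsum F * hsum G = hsum F" "hsum F * (hsum G * x) = hsum F * x"
proof -
  have "h a * hsum G = h a" if "a \<in> F" for a
    using that assms by (auto simp: h_sum_mult)
  then show *: "hsum F * hsum G = hsum F" by (simp add: sum_distrib_right)
  show "hsum F * (hsum G * x) = hsum F * x" by (simp flip: mult.assoc add: *)
qed

lemma hmult_hmult: "length as = length xs \<Longrightarrow> hmult as (hmult as xs) = hmult as xs"
  by (intro nth_equalityI) (auto simp flip: mult.assoc simp: h_orth)

lemma hmult_map: "hmult as xs = map2 (*) (map h as) xs"
  by (simp add: zip_map1 case_prod_beta comp_def)

lemma forms_multilinear: "f \<in> forms A n \<Longrightarrow> multilinear sm (*) n f"
  by (simp add: forms_def)

text \<open>The locality of a form as a congruence: arguments with equal truncations by one finite partial sum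
of the \<open>h\<^sub>a\<close> have equal values. Unlike the defining equation, this is safe to rewrite with.\<close>

lemma forms_window_map:
  assumes "f \<in> forms A n"
  shows "\<exists>F. finite F \<and> (\<forall>xs ys. length xs = n \<longrightarrow> length ys = n \<longrightarrow>
    map (\<lambda>x. hsum F * x) xs = map (\<lambda>x. hsum F * x) ys \<longrightarrow> f xs = f ys)"
proof -
  obtain F where F: "finite F" "\<And>xs. length xs = n \<Longrightarrow> f xs = f (map (\<lambda>x. hsum F * x) xs)"
    using assms unfolding forms_def by blast
  have "f xs = f ys" if "length xs = n" "length ys = n"
    "map (\<lambda>x. hsum F * x) xs = map (\<lambda>x. hsum F * x) ys" for xs ys
    using F(2)[OF that(1)] F(2)[OF that(2)] that(3) by simp
  then show ?thesis using F(1) by blast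
qed

lemma formsI:
  assumes "multilinear sm (*) n f" "finite F"
    and "\<And>xs. length xs = n \<Longrightarrow> f xs = f (map (\<lambda>x. hsum F * x) xs)"
  shows "f \<in> forms A n"
  using assms unfolding forms_def by blast

lemma forms_cong:
  assumes "\<And>xs. length xs = n \<Longrightarrow> f xs = g xs"
  shows "f \<in> forms A n \<longleftrightarrow> g \<in> forms A n"
proof -
  have "multilinear sm (*) n f \<longleftrightarrow> multilinear sm (*) n g"
    unfolding multilinear_def using assms by (simp cong: conj_cong)
  then show ?thesis unfolding forms_def using assms by simp
qed

lemma forms_zero: "(\<lambda>_. 0) \<in> forms A n"
  by (rule formsI[of _ _ "{}"]) (auto simp: multilinear_def)

lemma forms_add:
  assumes f: "f \<in> forms A n" and g: "g \<in> forms A n"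
  shows "(\<lambda>xs. f xs + g xs) \<in> forms A n"
proof -
  obtain F where F: "finite F" "\<And>xs ys. length xs = n \<Longrightarrow> length ys = n \<Longrightarrow>
    map (\<lambda>x. hsum F * x) xs = map (\<lambda>x. hsum F * x) ys \<Longrightarrow> f xs = f ys" using forms_window_map[OF f] by metis
  obtain G where G: "finite G" "\<And>xs ys. length xs = n \<Longrightarrow> length ys = n \<Longrightarrow>
    map (\<lambda>x. hsum G * x) xs = map (\<lambda>x. hsum G * x) ys \<Longrightarrow> g xs = g ys" using forms_window_map[OF g] by metis
  show ?thesis
  proof (rule formsI)
    show "multilinear sm (*) n (\<lambda>xs. f xs + g xs)"
      using f g unfolding forms_def multilinear_def by (simp add: algebra_simps)
    show "finite (F \<union> G)" using F G by simp
    fix xs :: "'a list" assume l: "length xs = n"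
    have "f xs = f (map (\<lambda>x. hsum (F \<union> G) * x) xs)"
      by (rule F(2)) (use l F(1) G(1) in \<open>auto simp: hsum_idem\<close>)
    moreover have "g xs = g (map (\<lambda>x. hsum (F \<union> G) * x) xs)"
      by (rule G(2)) (use l F(1) G(1) in \<open>auto simp: hsum_idem\<close>)
    ultimately show "f xs + g xs = f (map (\<lambda>x. hsum (F \<union> G) * x) xs) + g (map (\<lambda>x. hsum (F \<union> G) * x) xs)"
      by simp
  qed
qed

lemma forms_scale:
  assumes f: "f \<in> forms A n" shows "(\<lambda>xs. c * f xs) \<in> forms A n"
proof -
  obtain F where F: "finite F" "\<And>xs. length xs = n \<Longrightarrow> f xs = f (map (\<lambda>x. hsum F * x) xs)"
    using f unfolding forms_def by blast
  have "multilinear sm (*) n (\<lambda>xs. c * f xs)"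
    using f unfolding forms_def multilinear_def by (simp add: algebra_simps)
  then show ?thesis by (rule formsI[OF _ F(1)]) (subst F(2), simp_all)
qed

lemma multilinear_hsum_expand:
  fixes f :: "'a list \<Rightarrow> 'k"
  assumes "multilinear sm (*) n f" "finite F" "length xs = n"
  shows "f (map (\<lambda>x. hsum F * x) xs) = (\<Sum>as | set as \<subseteq> F \<and> length as = n. f (hmult as xs))"
  using assms
proof (induction xs arbitrary: n f)
  case Nil
  have "{as. set as \<subseteq> F \<and> length as = n} = {[]}" using Nil by auto
  then show ?case by simp
next
  case (Cons x xs)
  obtain m where n: "n = Suc m" using Cons.prems by auto
  note f = Cons.prems(1)[unfolded n]
  have l: "length xs = m" using Cons.prems n by simp
  let ?ys = "map (\<lambda>x. hsum F * x) xs"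
  have "f (map (\<lambda>x. hsum F * x) (x # xs)) = (\<Sum>a\<in>F. f ((h a * x) # ?ys))"
    using multilinear_sum[OF f, of "x # ?ys" 0 F "\<lambda>a. h a * x"] Cons.prems(2) l
    by (simp add: sum_distrib_right)
  also have "\<dots> = (\<Sum>a\<in>F. \<Sum>as | set as \<subseteq> F \<and> length as = m. f ((h a * x) # hmult as xs))"
    using Cons.IH[OF multilinear_Cons[OF f] Cons.prems(2) l] by simp
  also have "\<dots> = (\<Sum>(as, a) \<in> {as. set as \<subseteq> F \<and> length as = m} \<times> F. f (hmult (a # as) (x # xs)))"
    by (subst sum.swap) (simp add: sum.cartesian_product)
  also have "\<dots> = (\<Sum>as | set as \<subseteq> F \<and> length as = n. f (hmult as (x # xs)))"
    unfolding n lists_length_Suc_eq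
    by (subst sum.reindex) (auto simp: inj_on_def case_prod_beta intro!: sum.cong)
  finally show ?case .
qed

text \<open>A finite set of index lists outside which the form \<open>f\<close> sees nothing. The finite set of
letters in the definition of forms is replaced by a set of lists, so that windows of several forms can
be united and sums over them compared.\<close>

definition window :: "nat \<Rightarrow> ('a list \<Rightarrow> 'k) \<Rightarrow> 'x list set \<Rightarrow> bool" where
  "window n f W \<longleftrightarrow> finite W \<and> W \<subseteq> {as. length as = n} \<and>
     (\<forall>as xs. length as = n \<longrightarrow> length xs = n \<longrightarrow> as \<notin> W \<longrightarrow> f (hmult as xs) = 0) \<and>
     (\<forall>xs. length xs = n \<longrightarrow> f xs = (\<Sum>as\<in>W. f (hmult as xs)))"

lemma window_exists:
  assumes f: "f \<in> forms A n" shows "\<exists>W. window n f W"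
proof -
  obtain F where F: "finite F" "\<And>xs. length xs = n \<Longrightarrow> f xs = f (map (\<lambda>x. hsum F * x) xs)"
    using f unfolding forms_def by blast
  note ml = forms_multilinear[OF f]
  have "f (hmult as xs) = 0" if l: "length as = n" "length xs = n" and as: "\<not> set as \<subseteq> F" for as xs
  proof -
    obtain i where i: "i < n" "as ! i \<notin> F" using as l by (metis in_set_conv_nth subsetI)
    have "map (\<lambda>x. hsum F * x) (hmult as xs) ! i = 0"
      using i l F(1) by (simp flip: mult.assoc add: h_sum_mult)
    then show ?thesis using F(2)[of "hmult as xs"] multilinear_zero[OF ml _ i(1)] l by simp
  qed
  moreover have "f xs = (\<Sum>as | set as \<subseteq> F \<and> length as = n. f (hmult as xs))" if "length xs = n" for xs
    using F(2)[OF that] multilinear_hsum_expand[OF ml F(1) that] by (rule trans)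
  ultimately have "window n f {as. set as \<subseteq> F \<and> length as = n}"
    unfolding window_def using finite_lists_length_eq[OF F(1)] by blast
  then show ?thesis by blast
qed

lemma windowD:
  assumes "window n f W"
  shows "finite W" "W \<subseteq> {as. length as = n}" "as \<in> W \<Longrightarrow> length as = n"
    "length as = n \<Longrightarrow> length xs = n \<Longrightarrow> as \<notin> W \<Longrightarrow> f (hmult as xs) = 0"
    "length xs = n \<Longrightarrow> f xs = (\<Sum>as\<in>W. f (hmult as xs))"
  using assms unfolding window_def by blast+

lemma window_superset:
  assumes "window n f W" "finite W'" "W \<subseteq> W'" "W' \<subseteq> {as. length as = n}"
  shows "window n f W'"
  unfolding window_def
proof (intro conjI allI impI)
  fix xs :: "'a list" assume l: "length xs = n"
  have "f xs = (\<Sum>as\<in>W. f (hmult as xs))" using assms(1) l unfolding window_def by blast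
  also have "\<dots> = (\<Sum>as\<in>W'. f (hmult as xs))"
    using assms l unfolding window_def by (intro sum.mono_neutral_left) auto
  finally show "f xs = (\<Sum>as\<in>W'. f (hmult as xs))" .
qed (use assms in \<open>unfold window_def, blast+\<close>)

lemma windows_exist:
  assumes "f \<in> forms A n" "g \<in> forms A n" "finite C" "C \<subseteq> {as. length as = n}"
  shows "\<exists>W. window n f W \<and> window n g W \<and> C \<subseteq> W"
proof -
  obtain W1 W2 where W: "window n f W1" "window n g W2"
    using window_exists[OF assms(1)] window_exists[OF assms(2)] by blast
  have "finite (W1 \<union> W2 \<union> C)" "W1 \<union> W2 \<union> C \<subseteq> {as. length as = n}"
    using assms(3,4) windowD(1,2)[OF W(1)] windowD(1,2)[OF W(2)] by auto
  then have "window n f (W1 \<union> W2 \<union> C)" "window n g (W1 \<union> W2 \<union> C)"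
    by (blast intro: window_superset[OF W(1)] window_superset[OF W(2)])+
  then show ?thesis by blast
qed

section \<open>Tensors given by rows\<close>

text \<open>Finiteness is imposed on each row separately, not on the family; such families are the elements of the
completed tensor power.\<close>

definition finite_rows :: "nat \<Rightarrow> ('x list \<Rightarrow> ('x list \<Rightarrow> 'k) \<Rightarrow> 'k) \<Rightarrow> bool" where
  "finite_rows n T \<longleftrightarrow> (\<forall>as. length as = n \<longrightarrow> T as \<in> fin_functionals {bs. length bs = n})"

text \<open>The formal sum \<open>\<Sum>\<^sub>a\<^sub>s \<Sum>\<^sub>b\<^sub>s T(as,bs) h\<^bsub>a\<^sub>1\<^esub> q\<^bsub>b\<^sub>1\<^esub> \<otimes> \<dots> \<otimes> h\<^bsub>a\<^sub>n\<^esub> q\<^bsub>b\<^sub>n\<^esub>\<close>. Every tensor of the theorem has this shape, and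
equality of two such tensors follows from equality of the rows. The sum is written over the
nonzero terms so that it literally is the sum in \<open>has_formal_sum\<close>.\<close>

definition row_tensor :: "nat \<Rightarrow> ('x list \<Rightarrow> ('x list \<Rightarrow> 'k) \<Rightarrow> 'k) \<Rightarrow> ('k, 'a) tens" where
  "row_tensor n T f = (if f \<in> forms A n
     then \<Sum>as | as \<in> {as. length as = n} \<and> T as (\<lambda>bs. f (basis as bs)) \<noteq> 0. T as (\<lambda>bs. f (basis as bs)) else 0)"

lemma finite_rows_vanish:
  assumes "finite_rows n T" "length as = n" "\<And>bs. length bs = n \<Longrightarrow> \<phi> bs = 0"
  shows "T as \<phi> = 0"
  using fin_functional_cong[of "T as" "{bs. length bs = n}" \<phi> "\<lambda>_. 0"] assms
  by (simp add: finite_rows_def fin_functional_zero[of "T as" "{bs. length bs = n}"])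

lemma row_tensor_window:
  assumes T: "finite_rows n T" and f: "f \<in> forms A n" and W: "window n f W"
  shows "row_tensor n T f = (\<Sum>as\<in>W. T as (\<lambda>bs. f (basis as bs)))"
proof -
  have "T as (\<lambda>bs. f (basis as bs)) = 0" if "length as = n" "as \<notin> W" for as
    using that W by (intro finite_rows_vanish[OF T]) (auto simp: window_def)
  then show ?thesis
    using f W unfolding row_tensor_def by (simp, intro sum.mono_neutral_left) (auto simp: window_def)
qed

text \<open>Needed because the forms produced by \<open>push\<close> are only known on lists of the right length.\<close>

lemma row_tensor_form_cong:
  assumes T: "finite_rows n T" and eq: "\<And>xs. length xs = n \<Longrightarrow> f xs = g xs"
  shows "row_tensor n T f = row_tensor n T g"
proof (cases "f \<in> forms A n")
  case True
  then have g: "g \<in> forms A n" using forms_cong[of n f g, OF eq] by blast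
  obtain W where W: "window n f W" "window n g W"
    using windows_exist[OF True g, of "{}"] by auto
  have "T as (\<lambda>bs. f (basis as bs)) = T as (\<lambda>bs. g (basis as bs))" if "as \<in> W" for as
    using that W(1) T by (intro fin_functional_cong[of "T as"]) (auto simp: window_def finite_rows_def eq)
  then show ?thesis using row_tensor_window[OF T True W(1)] row_tensor_window[OF T g W(2)] by simp
next
  case False
  then have "g \<notin> forms A n" using forms_cong[of n f g, OF eq] by blast
  then show ?thesis using False by (simp add: row_tensor_def)
qed

lemma row_tensor_zero_form: "finite_rows n T \<Longrightarrow> (\<And>xs. length xs = n \<Longrightarrow> f xs = 0) \<Longrightarrow> row_tensor n T f = 0"
  by (subst row_tensor_form_cong[of n T f "\<lambda>_. 0"]) (simp_all add: row_tensor_def finite_rows_vanish[of n T])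

lemma row_tensor_form_add:
  assumes T: "finite_rows n T" and f: "f \<in> forms A n" "g \<in> forms A n"
  shows "row_tensor n T (\<lambda>xs. f xs + g xs) = row_tensor n T f + row_tensor n T g"
proof -
  note fg = forms_add[OF f]
  obtain W0 where W0: "window n f W0" "window n g W0" using windows_exist[OF f, of "{}"] by auto
  obtain W where W: "window n (\<lambda>xs. f xs + g xs) W" "W0 \<subseteq> W"
    using windows_exist[OF fg fg, of W0] windowD(1,2)[OF W0(1)] by blast
  have W': "window n f W" "window n g W"
    using window_superset[OF W0(1) _ W(2)] window_superset[OF W0(2) _ W(2)] windowD(1,2)[OF W(1)] by blast+
  have "T as (\<lambda>bs. f (basis as bs) + g (basis as bs)) = T as (\<lambda>bs. f (basis as bs)) + T as (\<lambda>bs. g (basis as bs))"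
    if "as \<in> W" for as
    using T that W(1) by (intro fin_functional_add) (auto simp: finite_rows_def window_def)
  then show ?thesis
    using row_tensor_window[OF T fg W(1)] row_tensor_window[OF T f(1) W'(1)] row_tensor_window[OF T f(2) W'(2)] by (simp add: sum.distrib)
qed

lemma row_tensor_form_scale:
  assumes T: "finite_rows n T" and f: "f \<in> forms A n"
  shows "row_tensor n T (\<lambda>xs. c * f xs) = c * row_tensor n T f"
proof -
  note cf = forms_scale[OF f]
  obtain W where W: "window n (\<lambda>xs. c * f xs) W" "window n f W" using windows_exist[OF cf f, of "{}"] by auto
  have "T as (\<lambda>bs. c * f (basis as bs)) = c * T as (\<lambda>bs. f (basis as bs))"
    if "as \<in> W" for as
    using T that W(1) by (intro fin_functional_scale) (auto simp: finite_rows_def window_def)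
  then show ?thesis
    using row_tensor_window[OF T cf W(1)] row_tensor_window[OF T f W(2)] by (simp add: sum_distrib_left)
qed

lemma row_tensor_cong:
  assumes "\<And>as \<phi>. length as = n \<Longrightarrow> T as \<phi> = T' as \<phi>"
  shows "row_tensor n T = row_tensor n T'"
proof
  fix f
  show "row_tensor n T f = row_tensor n T' f"
    unfolding row_tensor_def using assms by (auto intro!: sum.cong)
qed

lemma finite_rows_cong:
  assumes "\<And>as \<phi>. length as = n \<Longrightarrow> T as \<phi> = T' as \<phi>" "finite_rows n T'"
  shows "finite_rows n T"
proof -
  have "T as = T' as" if "length as = n" for as using assms(1)[OF that] by (rule ext)
  then show ?thesis using assms(2) unfolding finite_rows_def by simp
qed

lemma row_tensor_add:
  assumes T: "finite_rows n T" "finite_rows n T'"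
  shows "row_tensor n (\<lambda>as \<phi>. T as \<phi> + T' as \<phi>) f = row_tensor n T f + row_tensor n T' f"
proof (cases "f \<in> forms A n")
  case True
  have T'': "finite_rows n (\<lambda>as \<phi>. T as \<phi> + T' as \<phi>)" using T by (auto simp: finite_rows_def intro: fin_functionals.add)
  obtain W where "window n f W" using window_exists[OF True] by auto
  then show ?thesis using row_tensor_window[OF T(1) True] row_tensor_window[OF T(2) True] row_tensor_window[OF T'' True] by (simp add: sum.distrib)
qed (simp add: row_tensor_def)

lemma row_tensor_scale:
  assumes T: "finite_rows n T"
  shows "row_tensor n (\<lambda>as \<phi>. c * T as \<phi>) f = c * row_tensor n T f"
proof (cases "f \<in> forms A n")
  case True
  have T'': "finite_rows n (\<lambda>as \<phi>. c * T as \<phi>)" using T by (auto simp: finite_rows_def intro: fin_functionals.scale)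
  obtain W where "window n f W" using window_exists[OF True] by auto
  then show ?thesis using row_tensor_window[OF T True] row_tensor_window[OF T'' True] by (simp add: sum_distrib_left)
qed (simp add: row_tensor_def)

text \<open>The rows of \<open>x\<^sub>1 \<otimes> \<dots> \<otimes> x\<^sub>n\<close>: the product of the rows of the factors.\<close>

fun pure_row :: "'a list \<Rightarrow> 'x list \<Rightarrow> ('x list \<Rightarrow> 'k) \<Rightarrow> 'k" where
  "pure_row (x # xs) (a # as) \<phi> = row x a (\<lambda>b. pure_row xs as (\<lambda>bs. \<phi> (b # bs)))"
| "pure_row [] [] \<phi> = \<phi> []"
| "pure_row _ _ \<phi> = 0"

lemma finite_rows_pure_row: "length xs = n \<Longrightarrow> finite_rows n (pure_row xs)"
proof -
  have "pure_row xs as \<in> fin_functionals {bs. length bs = length xs}" if "length as = length xs" for as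
    using that
  proof (induction xs arbitrary: as)
    case Nil
    then show ?case by (simp add: fin_functionals.eval fun_eq_iff)
  next
    case (Cons x xs)
    obtain a as' where as: "as = a # as'" "length as' = length xs" using Cons.prems by (cases as) auto
    have "(\<lambda>\<phi>. row x a (\<lambda>b. pure_row xs as' (\<lambda>bs. \<phi> (b # bs)))) \<in> fin_functionals {bs. length bs = length (x # xs)}"
      by (rule fin_functional_bind[OF row_fin], rule fin_functional_map[OF Cons.IH[OF as(2)]]) simp
    then show ?case by (simp add: as)
  qed
  then show "length xs = n \<Longrightarrow> finite_rows n (pure_row xs)" by (auto simp: finite_rows_def)
qed

lemma hmult_pure_row:
  assumes "multilinear sm (*) n f" "length as = n" "length xs = n"
  shows "f (hmult as xs) = pure_row xs as (\<lambda>bs. f (basis as bs))"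
  using assms
proof (induction xs arbitrary: as n f)
  case Nil then show ?case by simp
next
  case (Cons x xs)
  obtain a as' where as: "as = a # as'" "length as' = length xs" using Cons.prems by (cases as) auto
  have n: "n = Suc (length xs)" using Cons.prems by simp
  note f = Cons.prems(1)[unfolded n]
  have "f (hmult as (x # xs)) = row x a (\<lambda>b. f ((h a * q b) # hmult as' xs))"
    using h_expand[of "\<lambda>y. f (y # hmult as' xs)" a x] multilinear_head[OF f, of "hmult as' xs"] as by simp
  also have "\<dots> = row x a (\<lambda>b. pure_row xs as' (\<lambda>bs. f ((h a * q b) # basis as' bs)))"
    using Cons.IH[OF multilinear_Cons[OF f]] as by simp
  finally show ?case by (simp add: as)
qed

lemma pure_row_tensor: "length xs = n \<Longrightarrow> pure A xs = row_tensor n (pure_row xs)"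
proof
  fix f assume l: "length xs = n"
  show "pure A xs f = row_tensor n (pure_row xs) f"
  proof (cases "f \<in> forms A n")
    case True
    obtain W where W: "window n f W" using window_exists[OF True] by auto
    have "f xs = (\<Sum>as\<in>W. f (hmult as xs))" using W l unfolding window_def by blast
    also have "\<dots> = (\<Sum>as\<in>W. pure_row xs as (\<lambda>bs. f (basis as bs)))"
      using W l by (intro sum.cong refl hmult_pure_row[OF forms_multilinear[OF True]]) (auto simp: window_def)
    finally show ?thesis using True l row_tensor_window[OF finite_rows_pure_row[OF l] True W] by (simp add: pure_def)
  qed (simp add: pure_def row_tensor_def l)
qed

text \<open>Formal sums may be computed row by row. It is enough that each single index list meets finitely many
summands, since a form has a finite window.\<close>

lemma has_formal_sum_row_tensor:
  assumes T: "\<And>i. i \<in> I \<Longrightarrow> finite_rows m (T i)" and V: "finite_rows m V"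
    and K: "\<And>cs. length cs = m \<Longrightarrow> \<exists>K. finite K \<and> K \<subseteq> I \<and>
      (\<forall>i\<in>I - K. \<forall>\<phi>. T i cs \<phi> = 0) \<and> (\<forall>\<phi>. V cs \<phi> = (\<Sum>i\<in>K. T i cs \<phi>))"
  shows "has_formal_sum (\<lambda>i. row_tensor m (T i)) I (row_tensor m V)"
proof (rule has_formal_sumI)
  fix f
  show "\<exists>K. finite K \<and> K \<subseteq> I \<and> (\<forall>i\<in>I - K. row_tensor m (T i) f = 0) \<and> row_tensor m V f = (\<Sum>i\<in>K. row_tensor m (T i) f)"
  proof (cases "f \<in> forms A m")
    case True
    obtain W where W: "window m f W" using window_exists[OF True] by auto
    then have W': "finite W" "\<And>cs. cs \<in> W \<Longrightarrow> length cs = m" by (blast dest: windowD)+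
    from K obtain k where k: "\<And>cs. length cs = m \<Longrightarrow> finite (k cs)" "\<And>cs. length cs = m \<Longrightarrow> k cs \<subseteq> I"
      "\<And>cs i \<phi>. length cs = m \<Longrightarrow> i \<in> I - k cs \<Longrightarrow> T i cs \<phi> = 0"
      "\<And>cs \<phi>. length cs = m \<Longrightarrow> V cs \<phi> = (\<Sum>i\<in>k cs. T i cs \<phi>)" by metis
    let ?K = "\<Union>cs\<in>W. k cs"
    have fin: "finite ?K" and sub: "?K \<subseteq> I" using k(1,2) W' by auto
    have ti: "row_tensor m (T i) f = (\<Sum>cs\<in>W. T i cs (\<lambda>ds. f (basis cs ds)))" if "i \<in> I" for i
      by (rule row_tensor_window[OF T[OF that] True W])
    have "row_tensor m V f = (\<Sum>cs\<in>W. V cs (\<lambda>ds. f (basis cs ds)))" by (rule row_tensor_window[OF V True W])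
    also have "\<dots> = (\<Sum>cs\<in>W. \<Sum>i\<in>?K. T i cs (\<lambda>ds. f (basis cs ds)))"
    proof (rule sum.cong[OF refl])
      fix cs assume cs: "cs \<in> W"
      then show "V cs (\<lambda>ds. f (basis cs ds)) = (\<Sum>i\<in>?K. T i cs (\<lambda>ds. f (basis cs ds)))"
        unfolding k(4)[OF W'(2)[OF cs]]
        using fin sub k(3)[OF W'(2)[OF cs]] by (intro sum.mono_neutral_left) auto
    qed
    also have "\<dots> = (\<Sum>i\<in>?K. row_tensor m (T i) f)"
      by (subst sum.swap) (use sub ti in \<open>auto intro!: sum.cong\<close>)
    finally have "row_tensor m V f = (\<Sum>i\<in>?K. row_tensor m (T i) f)" .
    moreover have "row_tensor m (T i) f = 0" if "i \<in> I - ?K" for i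
      using that k(3) W' by (auto simp: ti intro!: sum.neutral)
    ultimately show ?thesis using fin sub by blast
  qed (auto simp: row_tensor_def)
qed

lemma fin_functional_row_tensor:
  assumes L: "L \<in> fin_functionals P" and U: "\<And>b. b \<in> P \<Longrightarrow> finite_rows m (U b)"
  shows "L (\<lambda>b. row_tensor m (U b) f) = row_tensor m (\<lambda>cs \<phi>. L (\<lambda>b. U b cs \<phi>)) f"
    "finite_rows m (\<lambda>cs \<phi>. L (\<lambda>b. U b cs \<phi>))"
proof -
  show a: "finite_rows m (\<lambda>cs \<phi>. L (\<lambda>b. U b cs \<phi>))"
    unfolding finite_rows_def
  proof (intro allI impI)
    fix cs :: "'x list" assume "length cs = m"
    then show "(\<lambda>\<phi>. L (\<lambda>b. U b cs \<phi>)) \<in> fin_functionals {bs. length bs = m}"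
      using U by (intro fin_functional_bind[OF L, of "\<lambda>b. U b cs"]) (simp add: finite_rows_def)
  qed
  show "L (\<lambda>b. row_tensor m (U b) f) = row_tensor m (\<lambda>cs \<phi>. L (\<lambda>b. U b cs \<phi>)) f"
  proof (cases "f \<in> forms A m")
    case True
    obtain W where W: "window m f W" using window_exists[OF True] by auto
    have "L (\<lambda>b. row_tensor m (U b) f) = L (\<lambda>b. \<Sum>cs\<in>W. U b cs (\<lambda>ds. f (basis cs ds)))"
      by (rule fin_functional_cong[OF L]) (rule row_tensor_window[OF U True W])
    also have "\<dots> = row_tensor m (\<lambda>cs \<phi>. L (\<lambda>b. U b cs \<phi>)) f"
      unfolding row_tensor_window[OF a True W] by (rule fin_functional_sum[OF L])
    finally show ?thesis .
  qed (simp add: row_tensor_def fin_functional_zero[OF L])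
qed

text \<open>The form in which \<open>has_formal_sum_row_tensor\<close> is applied to a linear map \<open>B\<close> whose values on monomials
are known row tensors \<open>U\<close>.\<close>

lemma has_formal_sum_rows:
  fixes U :: "'x list \<Rightarrow> 'x list \<Rightarrow> 'x list \<Rightarrow> ('x list \<Rightarrow> 'k) \<Rightarrow> 'k"
    and T :: "'x list \<Rightarrow> ('x list \<Rightarrow> 'k) \<Rightarrow> 'k"
  assumes T: "finite_rows n T"
    and B: "\<And>as bs. length as = n \<Longrightarrow> length bs = n \<Longrightarrow> B (basis as bs) = row_tensor m (U as bs)"
    and U: "\<And>as bs. length as = n \<Longrightarrow> length bs = n \<Longrightarrow> finite_rows m (U as bs)"
    and V: "finite_rows m V"
    and K: "\<And>cs. length cs = m \<Longrightarrow> \<exists>K. finite K \<and> K \<subseteq> {as. length as = n} \<and>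
      (\<forall>as\<in>{as. length as = n} - K. \<forall>\<phi>. T as (\<lambda>bs. U as bs cs \<phi>) = 0) \<and>
      (\<forall>\<phi>. V cs \<phi> = (\<Sum>as\<in>K. T as (\<lambda>bs. U as bs cs \<phi>)))"
  shows "has_formal_sum (\<lambda>as f. T as (\<lambda>bs. B (basis as bs) f)) {as. length as = n} (row_tensor m V)"
proof -
  have "has_formal_sum (\<lambda>as. row_tensor m (\<lambda>cs \<phi>. T as (\<lambda>bs. U as bs cs \<phi>))) {as. length as = n} (row_tensor m V)"
  proof (rule has_formal_sum_row_tensor[OF _ V])
    show "finite_rows m (\<lambda>cs \<phi>. T as (\<lambda>bs. U as bs cs \<phi>))" if "as \<in> {as. length as = n}" for as
      using T U that by (intro fin_functional_row_tensor(2)[of "T as" "{bs. length bs = n}"]) (auto simp: finite_rows_def)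
  qed (use K in auto)
  also have "?this \<longleftrightarrow> ?thesis"
  proof (rule has_formal_sum_cong, rule ext)
    fix as :: "'x list" and f assume as: "as \<in> {as. length as = n}"
    then have Ta: "T as \<in> fin_functionals {bs. length bs = n}" using T by (simp add: finite_rows_def)
    have "row_tensor m (\<lambda>cs \<phi>. T as (\<lambda>bs. U as bs cs \<phi>)) f = T as (\<lambda>bs. row_tensor m (U as bs) f)"
      by (rule fin_functional_row_tensor(1)[OF Ta, symmetric]) (use as U in auto)
    also have "\<dots> = T as (\<lambda>bs. B (basis as bs) f)"
      by (rule fin_functional_cong[OF Ta]) (use B as in auto)
    finally show "row_tensor m (\<lambda>cs \<phi>. T as (\<lambda>bs. U as bs cs \<phi>)) f = T as (\<lambda>bs. B (basis as bs) f)" .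
  qed
  finally show ?thesis .
qed

lemma push_row_tensor:
  assumes fs: "has_formal_sum (\<lambda>as f. T as (\<lambda>bs. B (basis as bs) f)) {as. length as = n} y"
    and B: "\<And>f. (\<lambda>xs. B xs f) \<in> forms A n"
  shows "push (row_tensor n T) B = y"
proof
  fix f show "push (row_tensor n T) B f = y f"
    using fs B[of f] unfolding push_def row_tensor_def has_formal_sum_def by simp
qed

text \<open>Multiplying by \<open>h\<^sub>a\<^sub>s\<close> selects the row at \<open>as\<close>, so lifting \<open>B\<close> along a row tensor means summing the images of
its monomials. Truncation also makes a form out of every multilinear \<open>B\<close>, with the letters of \<open>as\<close> as
window; this is how \<open>lifts_to\<close> reaches maps to which \<open>push\<close> does not apply.\<close>

lemma lifts_row_tensor:
  assumes T: "finite_rows n T" and B: "\<And>f. multilinear sm (*) n (\<lambda>xs. B xs f)"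
    and fs: "has_formal_sum (\<lambda>as f. T as (\<lambda>bs. B (basis as bs) f)) {as. length as = n} y"
  shows "lifts_to A n B (row_tensor n T) y"
proof -
  have "push (row_tensor n T) (\<lambda>xs. B (hmult as xs)) f = T as (\<lambda>bs. B (basis as bs) f)" if as: "length as = n" for as f
  proof -
    let ?g = "\<lambda>xs. B (hmult as xs) f"
    have ml: "multilinear sm (*) n ?g"
      unfolding hmult_map using multilinear_list_update(1)[OF kalg B, of "map h as"] as by simp
    have g: "?g \<in> forms A n"
    proof (rule formsI[OF ml, of "set as"])
      fix xs :: "'a list" assume l: "length xs = n"
      have "hmult as xs = hmult as (map (\<lambda>x. hsum (set as) * x) xs)"
        using l as by (intro nth_equalityI) (auto simp flip: mult.assoc simp: h_sum_mult)
      then show "B (hmult as xs) f = B (hmult as (map (\<lambda>x. hsum (set as) * x) xs)) f" by simp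
    qed simp
    \<comment> \<open>Among the rows in the window only the one at \<open>as\<close> survives the multiplication by \<open>h\<^sub>a\<^sub>s\<close>.\<close>
    obtain W where W: "window n ?g W" "as \<in> W" using windows_exist[OF g g, of "{as}"] as by auto
    have Ta: "T as \<in> fin_functionals {bs. length bs = n}" if "length as = n" for as
      using T that by (simp add: finite_rows_def)
    have "push (row_tensor n T) (\<lambda>xs. B (hmult as xs)) f = (\<Sum>as'\<in>W. T as' (\<lambda>bs. B (hmult as (basis as' bs)) f))"
      using row_tensor_window[OF T g W(1)] by (simp add: push_def)
    also have "\<dots> = (\<Sum>as'\<in>W. if as = as' then T as (\<lambda>bs. B (basis as bs) f) else 0)"
    proof (rule sum.cong[OF refl])
      fix as' assume "as' \<in> W"
      then have l: "length as' = n" by (rule windowD(3)[OF W(1)])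
      show "T as' (\<lambda>bs. B (hmult as (basis as' bs)) f) = (if as = as' then T as (\<lambda>bs. B (basis as bs) f) else 0)"
      proof (cases "as = as'")
        case True
        have "T as (\<lambda>bs. B (hmult as (basis as bs)) f) = T as (\<lambda>bs. B (basis as bs) f)"
          by (rule fin_functional_cong[OF Ta[OF as]]) (use as in \<open>simp add: hmult_hmult\<close>)
        then show ?thesis using True by simp
      next
        case False
        then obtain i where i: "i < n" "as ! i \<noteq> as' ! i" using as l by (metis nth_equalityI)
        have "T as' (\<lambda>bs. B (hmult as (basis as' bs)) f) = 0"
        proof (rule finite_rows_vanish[OF T l])
          fix bs :: "'x list" assume "length bs = n"
          then show "B (hmult as (basis as' bs)) f = 0"
            using i as l by (intro multilinear_zero[OF B, of _ i]) (auto simp flip: mult.assoc simp: h_orth)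
        qed
        then show ?thesis using False by simp
      qed
    qed
    also have "\<dots> = T as (\<lambda>bs. B (basis as bs) f)" using W(2) windowD(1)[OF W(1)] by simp
    finally show ?thesis .
  qed
  then show ?thesis
    unfolding lifts_to_def using fs by (subst has_formal_sum_cong) (auto simp: fun_eq_iff)
qed

section \<open>Products of tensors\<close>

text \<open>The common part of \<open>tmult\<close> and \<open>tprod\<close>: both evaluate a form on \<open>\<beta> xs ys\<close> for a bilinear \<open>\<beta>\<close>, and
the inner evaluation is again a form in \<open>xs\<close>.\<close>

lemma row_tensor_bilinear:
  assumes T: "finite_rows n T" and S: "finite_rows m S"
    and len: "\<And>xs ys. length xs = n \<Longrightarrow> length ys = m \<Longrightarrow> length (\<beta> xs ys) = l"
    and right: "\<And>xs. length xs = n \<Longrightarrow> (\<lambda>ys. f (\<beta> xs ys)) \<in> forms A m"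
    and left: "\<And>ys. length ys = m \<Longrightarrow> multilinear sm (*) n (\<lambda>xs. f (\<beta> xs ys))"
    and F: "finite F" "\<And>xs ys. length xs = n \<Longrightarrow> length ys = m \<Longrightarrow>
      f (\<beta> xs ys) = f (\<beta> (map (\<lambda>x. hsum F * x) xs) ys)"
    and f: "f \<in> forms A l"
  shows "(\<lambda>xs. row_tensor m S (\<lambda>ys. f (\<beta> xs ys))) \<in> forms A n"
    and "push (row_tensor n T) (\<lambda>xs. push (row_tensor m S) (\<lambda>ys. pure A (\<beta> xs ys))) f = row_tensor n T (\<lambda>xs. row_tensor m S (\<lambda>ys. f (\<beta> xs ys)))"
proof -
  show "(\<lambda>xs. row_tensor m S (\<lambda>ys. f (\<beta> xs ys))) \<in> forms A n"
  proof (rule formsI[OF _ F(1)])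
    show "multilinear sm (*) n (\<lambda>xs. row_tensor m S (\<lambda>ys. f (\<beta> xs ys)))"
      unfolding multilinear_def
    proof (intro allI impI conjI)
      fix xs :: "'a list" and i x y c assume a: "length xs = n" "i < n"
      have "row_tensor m S (\<lambda>ys. f (\<beta> (xs[i := x + y]) ys)) = row_tensor m S (\<lambda>ys. f (\<beta> (xs[i := x]) ys) + f (\<beta> (xs[i := y]) ys))"
        by (rule row_tensor_form_cong[OF S]) (rule multilinearD(1)[OF left a])
      then show "row_tensor m S (\<lambda>ys. f (\<beta> (xs[i := x + y]) ys)) =
          row_tensor m S (\<lambda>ys. f (\<beta> (xs[i := x]) ys)) + row_tensor m S (\<lambda>ys. f (\<beta> (xs[i := y]) ys))"
        using a row_tensor_form_add[OF S right right, of "xs[i := x]" "xs[i := y]"] by simp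
      have "row_tensor m S (\<lambda>ys. f (\<beta> (xs[i := sm c x]) ys)) = row_tensor m S (\<lambda>ys. c * f (\<beta> (xs[i := x]) ys))"
        by (rule row_tensor_form_cong[OF S]) (rule multilinearD(2)[OF left a])
      then show "row_tensor m S (\<lambda>ys. f (\<beta> (xs[i := sm c x]) ys)) = c * row_tensor m S (\<lambda>ys. f (\<beta> (xs[i := x]) ys))"
        using a row_tensor_form_scale[OF S right, of "xs[i := x]"] by simp
    qed
    fix xs :: "'a list" assume l: "length xs = n"
    show "row_tensor m S (\<lambda>ys. f (\<beta> xs ys)) = row_tensor m S (\<lambda>ys. f (\<beta> (map (\<lambda>x. hsum F * x) xs) ys))"
      by (rule row_tensor_form_cong[OF S]) (rule F(2)[OF l])
  qed
  show "push (row_tensor n T) (\<lambda>xs. push (row_tensor m S) (\<lambda>ys. pure A (\<beta> xs ys))) f = row_tensor n T (\<lambda>xs. row_tensor m S (\<lambda>ys. f (\<beta> xs ys)))"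
    unfolding push_def
    by (rule row_tensor_form_cong[OF T], rule row_tensor_form_cong[OF S]) (use f len in \<open>simp add: pure_def\<close>)
qed

lemma row_tensor_bilinear_nonform:
  assumes T: "finite_rows n T" and S: "finite_rows m S"
    and len: "\<And>xs ys. length xs = n \<Longrightarrow> length ys = m \<Longrightarrow> length (\<beta> xs ys) = l"
    and f: "f \<notin> forms A l"
  shows "push (row_tensor n T) (\<lambda>xs. push (row_tensor m S) (\<lambda>ys. pure A (\<beta> xs ys))) f = 0"
  unfolding push_def
  by (rule row_tensor_zero_form[OF T], rule row_tensor_zero_form[OF S]) (use f len in \<open>simp add: pure_def\<close>)

lemma basis_mult:
  assumes "length as = n" "length bs = n" "length cs = n" "length ds = n" "multilinear sm (*) n f"
  shows "f (map2 (*) (basis as bs) (basis cs ds)) = (if cs = conj_list bs as then f (basis as (mult_list bs ds)) else 0)"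
proof (cases "cs = conj_list bs as")
  case True
  have "map2 (*) (basis as bs) (basis cs ds) = basis as (mult_list bs ds)"
    using assms(1-4) True by (intro nth_equalityI) (auto simp: hq_mult)
  then show ?thesis using True by simp
next
  case False
  then obtain i where i: "i < n" "cs ! i \<noteq> conj_by (bs ! i) (as ! i)"
    using assms(1-4) nth_equalityI[of cs "conj_list bs as"] by auto
  then show ?thesis using assms False by (subst multilinear_zero[OF assms(5) _ i(1)]) (auto simp: hq_mult)
qed

lemma tmult_right_form:
  assumes f: "f \<in> forms A n" and l: "length xs = n"
  shows "(\<lambda>ys. f (map2 (*) xs ys)) \<in> forms A n"
proof -
  obtain F where F: "finite F" "\<And>xs ys. length xs = n \<Longrightarrow> length ys = n \<Longrightarrow>
    map (\<lambda>x. hsum F * x) xs = map (\<lambda>x. hsum F * x) ys \<Longrightarrow> f xs = f ys" using forms_window_map[OF f] by metis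
  obtain w where w: "\<And>x. finite (w x)"
    "\<And>x G. finite G \<Longrightarrow> w x \<subseteq> G \<Longrightarrow> hsum F * x * hsum G = hsum F * x"
    using sum_h_right_window[OF F(1)] by metis
  \<comment> \<open>Truncating by \<open>?G\<close> on the right of an entry of \<open>xs\<close> is invisible behind the window \<open>F\<close> of \<open>f\<close>.\<close>
  let ?G = "\<Union>x\<in>set xs. w x"
  have G: "hsum F * (x * (hsum ?G * y)) = hsum F * (x * y)" if "x \<in> set xs" for x y
  proof -
    have "hsum F * x * hsum ?G = hsum F * x" using that w(1) by (intro w(2)) auto
    then show ?thesis by (metis mult.assoc)
  qed
  show ?thesis
  proof (rule formsI[OF multilinear_list_update(1)[OF kalg forms_multilinear[OF f] l]])
    show "finite ?G" using w(1) by simp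
    fix ys :: "'a list" assume ly: "length ys = n"
    show "f (map2 (*) xs ys) = f (map2 (*) xs (map (\<lambda>x. hsum ?G * x) ys))"
      by (rule F(2)) (use l ly G in \<open>auto intro!: nth_equalityI\<close>)
  qed
qed

text \<open>Convolution of rows. For a fixed monomial on the left only the row of \<open>S\<close> at the conjugated index list
survives by \<open>hq_mult\<close>, so the sum over the index lists of \<open>S\<close> collapses and products of tensors become
compositions of functionals.\<close>

lemma tmult_row_tensor:
  assumes T: "finite_rows n T" and S: "finite_rows n S"
  defines "V \<equiv> \<lambda>as \<phi>. T as (\<lambda>bs. S (conj_list bs as) (\<lambda>ds. \<phi> (mult_list bs ds)))"
  shows "tmult A (row_tensor n T) (row_tensor n S) = row_tensor n V" "finite_rows n V"
proof -
  show V: "finite_rows n V"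
    unfolding finite_rows_def V_def
  proof (intro allI impI)
    fix as :: "'x list" assume l: "length as = n"
    show "(\<lambda>\<phi>. T as (\<lambda>bs. S (conj_list bs as) (\<lambda>ds. \<phi> (mult_list bs ds)))) \<in> fin_functionals {bs. length bs = n}"
    proof (rule fin_functional_bind[where L = "T as" and P = "{bs. length bs = n}" and M = "\<lambda>bs \<phi>. S (conj_list bs as) (\<lambda>ds. \<phi> (mult_list bs ds))"])
      show "T as \<in> fin_functionals {bs. length bs = n}" using T l by (simp add: finite_rows_def)
      show "(\<lambda>\<phi>. S (conj_list bs as) (\<lambda>ds. \<phi> (mult_list bs ds))) \<in> fin_functionals {bs. length bs = n}"
        if "bs \<in> {bs. length bs = n}" for bs
        using S l that by (intro fin_functional_map[where L = "S (conj_list bs as)" and P = "{bs. length bs = n}" and g = "\<lambda>ds. mult_list bs ds"]) (auto simp: finite_rows_def)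
    qed
  qed
  show "tmult A (row_tensor n T) (row_tensor n S) = row_tensor n V"
  proof
    fix f :: "'a list \<Rightarrow> 'k"
    show "tmult A (row_tensor n T) (row_tensor n S) f = row_tensor n V f"
    proof (cases "f \<in> forms A n")
      case False
      then show ?thesis
        unfolding tmult_def by (subst row_tensor_bilinear_nonform[OF T S, of _ n]) (auto simp: row_tensor_def)
    next
      case True
      note ml = forms_multilinear[OF True]
      obtain F where F: "finite F" "\<And>xs ys. length xs = n \<Longrightarrow> length ys = n \<Longrightarrow>
        map (\<lambda>x. hsum F * x) xs = map (\<lambda>x. hsum F * x) ys \<Longrightarrow> f xs = f ys"
        using forms_window_map[OF True] by metis
      have left: "f (map2 (*) xs ys) = f (map2 (*) (map (\<lambda>x. hsum F * x) xs) ys)"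
        if "length xs = n" "length ys = n" for xs ys
        by (rule F(2)) (use that F(1) in \<open>auto intro!: nth_equalityI simp: mult.assoc hsum_idem\<close>)
      have len: "length (map2 (*) xs ys) = n" if "length xs = n" "length ys = n" for xs ys :: "'a list"
        using that by simp
      let ?g = "\<lambda>xs. row_tensor n S (\<lambda>ys. f (map2 (*) xs ys))"
      have bil: "?g \<in> forms A n"
        "push (row_tensor n T) (\<lambda>xs. push (row_tensor n S) (\<lambda>ys. pure A (map2 (*) xs ys))) f = row_tensor n T ?g"
        by (rule row_tensor_bilinear[where F = F and l = n and f = f and \<beta> = "\<lambda>xs ys. map2 (*) xs ys"];
            (fact T S True F(1) | rule tmult_right_form[OF True] multilinear_list_update(2)[OF kalg ml] left len; assumption))+
      obtain W where W: "window n f W" "window n ?g W"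
        using windows_exist[OF True bil(1), of "{}"] by auto
      have inner: "?g (basis as bs) = S (conj_list bs as) (\<lambda>ds. f (basis as (mult_list bs ds)))"
        if l: "length as = n" "length bs = n" for as bs
      proof -
        have g': "(\<lambda>ys. f (map2 (*) (basis as bs) ys)) \<in> forms A n"
          by (rule tmult_right_form[OF True]) (use l in simp)
        obtain W' where W': "window n (\<lambda>ys. f (map2 (*) (basis as bs) ys)) W'" "conj_list bs as \<in> W'"
          using windows_exist[OF g' g', of "{conj_list bs as}"] l by auto
        have "?g (basis as bs) = (\<Sum>cs\<in>W'. S cs (\<lambda>ds. f (map2 (*) (basis as bs) (basis cs ds))))"
          by (rule row_tensor_window[OF S g' W'(1)])
        also have "\<dots> = (\<Sum>cs\<in>W'. if conj_list bs as = cs then S (conj_list bs as) (\<lambda>ds. f (basis as (mult_list bs ds))) else 0)"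
        proof (rule sum.cong[OF refl])
          fix cs assume "cs \<in> W'"
          then have lc: "length cs = n" by (rule windowD(3)[OF W'(1)])
          have "S cs (\<lambda>ds. f (map2 (*) (basis as bs) (basis cs ds))) =
              S cs (\<lambda>ds. if cs = conj_list bs as then f (basis as (mult_list bs ds)) else 0)"
            using S lc l by (intro fin_functional_cong[of "S cs" "{ds. length ds = n}"])
              (auto simp: finite_rows_def basis_mult[OF l lc _ ml])
          also have "\<dots> = (if conj_list bs as = cs then S (conj_list bs as) (\<lambda>ds. f (basis as (mult_list bs ds))) else 0)"
            using finite_rows_vanish[OF S lc] by auto
          finally show "S cs (\<lambda>ds. f (map2 (*) (basis as bs) (basis cs ds))) = \<dots>" .
        qed
        also have "\<dots> = S (conj_list bs as) (\<lambda>ds. f (basis as (mult_list bs ds)))"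
          using W'(2) windowD(1)[OF W'(1)] by simp
        finally show ?thesis .
      qed
      have "tmult A (row_tensor n T) (row_tensor n S) f = (\<Sum>as\<in>W. T as (\<lambda>bs. ?g (basis as bs)))"
        unfolding tmult_def bil(2) by (rule row_tensor_window[OF T bil(1) W(2)])
      also have "\<dots> = (\<Sum>as\<in>W. V as (\<lambda>bs. f (basis as bs)))"
      proof (rule sum.cong[OF refl])
        fix as assume "as \<in> W"
        then have l: "length as = n" by (rule windowD(3)[OF W(1)])
        show "T as (\<lambda>bs. ?g (basis as bs)) = V as (\<lambda>bs. f (basis as bs))"
          unfolding V_def
          using T l inner[OF l] by (intro fin_functional_cong[of "T as" "{ds. length ds = n}"]) (auto simp: finite_rows_def)
      qed
      also have "\<dots> = row_tensor n V f" using row_tensor_window[OF V True W(1)] by simp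
      finally show ?thesis .
    qed
  qed
qed

lemma append_forms:
  assumes f: "f \<in> forms A (n + m)"
  shows "length xs = n \<Longrightarrow> (\<lambda>ys. f (xs @ ys)) \<in> forms A m"
    "length ys = m \<Longrightarrow> (\<lambda>xs. f (xs @ ys)) \<in> forms A n"
    "\<exists>F. finite F \<and> (\<forall>xs ys. length xs = n \<longrightarrow> length ys = m \<longrightarrow> f (xs @ ys) = f (map (\<lambda>x. hsum F * x) xs @ ys))"
proof -
  obtain F where F: "finite F" "\<And>xs ys. length xs = n + m \<Longrightarrow> length ys = n + m \<Longrightarrow>
    map (\<lambda>x. hsum F * x) xs = map (\<lambda>x. hsum F * x) ys \<Longrightarrow> f xs = f ys"
    using forms_window_map[OF f] by metis
  note ml = forms_multilinear[OF f]
  note idem = hsum_idem(2)[OF F(1) subset_refl]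
  have left: "f (xs @ ys) = f (map (\<lambda>x. hsum F * x) xs @ ys)" if "length xs = n" "length ys = m" for xs ys
    by (rule F(2)) (use that in \<open>auto simp: idem\<close>)
  then show "\<exists>F. finite F \<and> (\<forall>xs ys. length xs = n \<longrightarrow> length ys = m \<longrightarrow> f (xs @ ys) = f (map (\<lambda>x. hsum F * x) xs @ ys))"
    using F(1) by blast
  show "(\<lambda>xs. f (xs @ ys)) \<in> forms A n" if l: "length ys = m"
  proof (rule formsI[of n "\<lambda>xs. f (xs @ ys)", OF _ F(1) left[OF _ l]])
    show "multilinear sm (*) n (\<lambda>xs. f (xs @ ys))"
      unfolding multilinear_def
    proof (intro allI impI)
      fix xs :: "'a list" and i x y c assume "length xs = n" "i < n"
      then show "f (xs[i := x + y] @ ys) = f (xs[i := x] @ ys) + f (xs[i := y] @ ys) \<and>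
          f (xs[i := sm c x] @ ys) = c * f (xs[i := x] @ ys)"
        using multilinearD[OF ml, of "xs @ ys" i] l by (simp add: list_update_append)
    qed
  qed
  show "(\<lambda>ys. f (xs @ ys)) \<in> forms A m" if l: "length xs = n"
  proof (rule formsI[of m "\<lambda>ys. f (xs @ ys)", OF _ F(1)])
    show "multilinear sm (*) m (\<lambda>ys. f (xs @ ys))"
      unfolding multilinear_def
    proof (intro allI impI)
      fix ys :: "'a list" and i x y c assume "length ys = m" "i < m"
      then show "f (xs @ ys[i := x + y]) = f (xs @ ys[i := x]) + f (xs @ ys[i := y]) \<and>
          f (xs @ ys[i := sm c x]) = c * f (xs @ ys[i := x])"
        using multilinearD[OF ml, of "xs @ ys" "n + i"] l by (simp add: list_update_append)
    qed
    fix ys :: "'a list" assume "length ys = m"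
    then show "f (xs @ ys) = f (xs @ map (\<lambda>x. hsum F * x) ys)"
      using l by (intro F(2)) (auto simp: idem)
  qed
qed

lemma tprod_row_tensor:
  assumes T: "finite_rows n T" and S: "finite_rows m S"
  defines "V \<equiv> \<lambda>as \<phi>. T (take n as) (\<lambda>bs. S (drop n as) (\<lambda>ds. \<phi> (bs @ ds)))"
  shows "tprod A (row_tensor n T) (row_tensor m S) = row_tensor (n + m) V" "finite_rows (n + m) V"
proof -
  have Ta: "T as \<in> fin_functionals {bs. length bs = n}" if "length as = n" for as
    using T that by (simp add: finite_rows_def)
  show V: "finite_rows (n + m) V"
    unfolding finite_rows_def V_def
  proof (intro allI impI)
    fix as :: "'x list" assume l: "length as = n + m"
    show "(\<lambda>\<phi>. T (take n as) (\<lambda>bs. S (drop n as) (\<lambda>ds. \<phi> (bs @ ds)))) \<in> fin_functionals {bs. length bs = n + m}"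
    proof (rule fin_functional_bind[where L = "T (take n as)" and P = "{bs. length bs = n}" and M = "\<lambda>bs \<phi>. S (drop n as) (\<lambda>ds. \<phi> (bs @ ds))"])
      show "T (take n as) \<in> fin_functionals {bs. length bs = n}" using T l by (simp add: finite_rows_def)
      show "(\<lambda>\<phi>. S (drop n as) (\<lambda>ds. \<phi> (bs @ ds))) \<in> fin_functionals {bs. length bs = n + m}"
        if "bs \<in> {bs. length bs = n}" for bs
        using S l that by (intro fin_functional_map[where L = "S (drop n as)" and P = "{bs. length bs = m}" and g = "\<lambda>ds. bs @ ds"]) (auto simp: finite_rows_def)
    qed
  qed
  show "tprod A (row_tensor n T) (row_tensor m S) = row_tensor (n + m) V"
  proof
    fix f :: "'a list \<Rightarrow> 'k"
    show "tprod A (row_tensor n T) (row_tensor m S) f = row_tensor (n + m) V f"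
    proof (cases "f \<in> forms A (n + m)")
      case False
      then show ?thesis
        unfolding tprod_def by (subst row_tensor_bilinear_nonform[OF T S, of _ "n + m"]) (auto simp: row_tensor_def)
    next
      case True
      note af = append_forms[OF True]
      obtain F where F: "finite F" "\<And>xs ys. length xs = n \<Longrightarrow> length ys = m \<Longrightarrow>
        f (xs @ ys) = f (map (\<lambda>x. hsum F * x) xs @ ys)" using af(3) by metis
      have len: "length (xs @ ys) = n + m" if "length xs = n" "length ys = m" for xs ys :: "'a list"
        using that by simp
      let ?g = "\<lambda>xs. row_tensor m S (\<lambda>ys. f (xs @ ys))"
      have bil: "?g \<in> forms A n"
        "push (row_tensor n T) (\<lambda>xs. push (row_tensor m S) (\<lambda>ys. pure A (xs @ ys))) f = row_tensor n T ?g"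
        by (rule row_tensor_bilinear[where F = F and l = "n + m" and f = f and \<beta> = "\<lambda>xs ys. xs @ ys"];
            (fact T S True F(1) | rule af(1) forms_multilinear[OF af(2)] F(2) len; assumption))+
      obtain W where W: "window n ?g W" using window_exists[OF bil(1)] by auto
      obtain W2 where W2: "window (n + m) f W2" using window_exists[OF True] by auto
      \<comment> \<open>Windows for the two factors cut out of one for \<open>f\<close>; the first must also serve the partial evaluation \<open>?g\<close>.\<close>
      let ?W1 = "W \<union> take n ` W2"
      let ?W' = "drop n ` W2"
      have l1: "length as = n" if "as \<in> ?W1" for as using that windowD(3)[OF W] windowD(3)[OF W2] by fastforce
      have l2: "length as = m" if "as \<in> ?W'" for as using that windowD(3)[OF W2] by fastforce
      have W1: "window n ?g ?W1"
        by (rule window_superset[OF W]) (use l1 windowD(1)[OF W] windowD(1)[OF W2] in auto)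
      have fin: "finite ?W1" "finite ?W'" using windowD(1)[OF W] windowD(1)[OF W2] by auto
      have sub2: "?W' \<subseteq> {as. length as = m}" using l2 by blast
      have zero: "f (basis as bs @ basis cs ds) = 0"
        if "length as = n" "length bs = n" "length cs = m" "length ds = m" "as @ cs \<notin> W2" for as bs cs ds
      proof -
        have "f (basis (as @ cs) (bs @ ds)) = 0"
          using windowD(4)[OF W2, of "as @ cs" "map q (bs @ ds)"] that by simp
        then show ?thesis using that by simp
      qed
      have inner: "?g (basis as bs) = (\<Sum>cs\<in>?W'. S cs (\<lambda>ds. f (basis as bs @ basis cs ds)))"
        if l: "length as = n" "length bs = n" for as bs
      proof -
        have g': "(\<lambda>ys. f (basis as bs @ ys)) \<in> forms A m"
          by (rule af(1)) (use l in simp)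
        obtain W3 where W3: "window m (\<lambda>ys. f (basis as bs @ ys)) W3" "?W' \<subseteq> W3"
          using windows_exist[OF g' g' fin(2) sub2] by blast
        have "?g (basis as bs) = (\<Sum>cs\<in>W3. S cs (\<lambda>ds. f (basis as bs @ basis cs ds)))"
          by (rule row_tensor_window[OF S g' W3(1)])
        also have "\<dots> = (\<Sum>cs\<in>?W'. S cs (\<lambda>ds. f (basis as bs @ basis cs ds)))"
        proof (rule sum.mono_neutral_right)
          show "\<forall>cs\<in>W3 - ?W'. S cs (\<lambda>ds. f (basis as bs @ basis cs ds)) = 0"
          proof
            fix cs assume cs: "cs \<in> W3 - ?W'"
            then have lc: "length cs = m" using windowD(3)[OF W3(1)] by blast
            have "as @ cs \<notin> W2" using cs l by (force simp: image_iff)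
            then show "S cs (\<lambda>ds. f (basis as bs @ basis cs ds)) = 0"
              using l lc by (intro finite_rows_vanish[OF S lc] zero) auto
          qed
        qed (use W3(2) windowD(1)[OF W3(1)] in auto)
        finally show ?thesis .
      qed
      have "tprod A (row_tensor n T) (row_tensor m S) f = (\<Sum>as\<in>?W1. T as (\<lambda>bs. ?g (basis as bs)))"
        unfolding tprod_def bil(2) by (rule row_tensor_window[OF T bil(1) W1])
      also have "\<dots> = (\<Sum>as\<in>?W1. \<Sum>cs\<in>?W'. T as (\<lambda>bs. S cs (\<lambda>ds. f (basis as bs @ basis cs ds))))"
      proof (rule sum.cong[OF refl])
        fix as assume "as \<in> ?W1"
        then have l: "length as = n" by (rule l1)
        have "T as (\<lambda>bs. ?g (basis as bs)) = T as (\<lambda>bs. \<Sum>cs\<in>?W'. S cs (\<lambda>ds. f (basis as bs @ basis cs ds)))"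
          by (rule fin_functional_cong[OF Ta[OF l]]) (use inner[OF l] in auto)
        then show "T as (\<lambda>bs. ?g (basis as bs)) = (\<Sum>cs\<in>?W'. T as (\<lambda>bs. S cs (\<lambda>ds. f (basis as bs @ basis cs ds))))"
          by (simp add: fin_functional_sum[OF Ta[OF l]])
      qed
      also have "\<dots> = (\<Sum>(as, cs)\<in>?W1 \<times> ?W'. V (as @ cs) (\<lambda>bs. f (basis (as @ cs) bs)))"
        unfolding sum.cartesian_product
      proof (rule sum.cong[OF refl])
        fix p assume "p \<in> ?W1 \<times> ?W'"
        then obtain as cs where p: "p = (as, cs)" "as \<in> ?W1" "cs \<in> ?W'" by (rule SigmaE)
        have l: "length as = n" "length cs = m" by (rule l1[OF p(2)], rule l2[OF p(3)])
        have "T as (\<lambda>bs. S cs (\<lambda>ds. f (basis as bs @ basis cs ds))) = V (as @ cs) (\<lambda>bs. f (basis (as @ cs) bs))"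
          unfolding V_def by (simp add: l) (rule fin_functional_cong[OF Ta[OF l(1)]], simp add: l)
        then show "(case p of (as, cs) \<Rightarrow> T as (\<lambda>bs. S cs (\<lambda>ds. f (basis as bs @ basis cs ds)))) =
            (case p of (as, cs) \<Rightarrow> V (as @ cs) (\<lambda>bs. f (basis (as @ cs) bs)))"
          by (simp add: p(1))
      qed
      also have "\<dots> = (\<Sum>as\<in>(\<lambda>(as, cs). as @ cs) ` (?W1 \<times> ?W'). V as (\<lambda>bs. f (basis as bs)))"
      proof -
        have "inj_on (\<lambda>(as, cs). as @ cs) (?W1 \<times> ?W')"
        proof (rule inj_onI)
          fix p p' assume p: "p \<in> ?W1 \<times> ?W'" "p' \<in> ?W1 \<times> ?W'"
            and eq: "(\<lambda>(as, cs). as @ cs) p = (\<lambda>(as, cs). as @ cs) p'"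
          have "length (fst p) = length (fst p')" using p[THEN mem_Times_iff[THEN iffD1]] l1 by metis
          then show "p = p'" using eq by (simp add: case_prod_beta prod_eq_iff)
        qed
        then show ?thesis by (subst sum.reindex) (simp_all add: case_prod_beta)
      qed
      also have "\<dots> = row_tensor (n + m) V f"
      proof (rule row_tensor_window[OF V True, symmetric], rule window_superset[OF W2])
        show "finite ((\<lambda>(as, cs). as @ cs) ` (?W1 \<times> ?W'))" using fin by simp
        show "W2 \<subseteq> (\<lambda>(as, cs). as @ cs) ` (?W1 \<times> ?W')"
        proof
          fix as assume "as \<in> W2"
          then have "as = (\<lambda>(as, cs). as @ cs) (take n as, drop n as)" "(take n as, drop n as) \<in> ?W1 \<times> ?W'"
            by simp_all
          then show "as \<in> (\<lambda>(as, cs). as @ cs) ` (?W1 \<times> ?W')" by (rule image_eqI)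
        qed
        show "(\<lambda>(as, cs). as @ cs) ` (?W1 \<times> ?W') \<subseteq> {as. length as = n + m}"
        proof
          fix as assume "as \<in> (\<lambda>(as, cs). as @ cs) ` (?W1 \<times> ?W')"
          then obtain p where "p \<in> ?W1 \<times> ?W'" "as = (\<lambda>(as, cs). as @ cs) p" by blast
          then show "as \<in> {as. length as = n + m}"
            using l1[of "fst p"] l2[of "snd p"] by (simp add: case_prod_beta mem_Times_iff)
        qed
      qed
      finally show ?thesis .
    qed
  qed
qed

section \<open>Row tensors in the completed tensor power\<close>

text \<open>Rows that do not depend on the index list come from \<open>\<Sum> c\<^sub>b q\<^sub>b\<close>, a finite sum of pure tensors. There must be at
least one tensor factor to absorb the scalar.\<close>

lemma row_tensor_const_alg_tensors:
  assumes "L \<in> fin_functionals {bs. length bs = n}" "n > 0"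
  shows "row_tensor n (\<lambda>_. L) \<in> alg_tensors A n"
  using assms(1)
proof (induction rule: fin_functionals.induct)
  case zero
  then show ?case unfolding alg_tensors_def by (auto intro!: exI[of _ "[]"] simp: row_tensor_def fun_eq_iff)
next
  case (eval b)
  have p: "pure_row (map q bs) as \<phi> = \<phi> bs" if "length as = length bs" for as bs \<phi>
    using that by (induction bs arbitrary: as \<phi>) (auto simp: row_q length_Suc_conv)
  have "row_tensor n (\<lambda>_ \<phi>. \<phi> b) = pure A (map q b)"
    using eval by (subst pure_row_tensor[of _ n]) (auto intro!: row_tensor_cong simp: p)
  then show ?case unfolding alg_tensors_def by (auto intro!: exI[of _ "[map q b]"] simp: eval[simplified])
next
  case (add L M)
  then obtain xss yss where x: "\<forall>xs\<in>set xss. length xs = n" "row_tensor n (\<lambda>_. L) = (\<lambda>f. \<Sum>xs\<leftarrow>xss. pure A xs f)"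
    and y: "\<forall>xs\<in>set yss. length xs = n" "row_tensor n (\<lambda>_. M) = (\<lambda>f. \<Sum>xs\<leftarrow>yss. pure A xs f)"
    unfolding alg_tensors_def by auto
  have "row_tensor n (\<lambda>_ \<phi>. L \<phi> + M \<phi>) = (\<lambda>f. \<Sum>xs\<leftarrow>xss @ yss. pure A xs f)"
  proof
    fix f show "row_tensor n (\<lambda>_ \<phi>. L \<phi> + M \<phi>) f = (\<Sum>xs\<leftarrow>xss @ yss. pure A xs f)"
      using row_tensor_add[of n "\<lambda>_. L" "\<lambda>_. M" f] add x(2) y(2) by (simp add: finite_rows_def)
  qed
  moreover have "\<forall>xs\<in>set (xss @ yss). length xs = n" using x y by auto
  ultimately show ?case unfolding alg_tensors_def by blast
next
  case (scale L c)
  then obtain xss where x: "\<forall>xs\<in>set xss. length xs = n" "row_tensor n (\<lambda>_. L) = (\<lambda>f. \<Sum>xs\<leftarrow>xss. pure A xs f)"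
    unfolding alg_tensors_def by auto
  have s: "pure A (xs[0 := sm c (xs ! 0)]) f = c * pure A xs f" if "length xs = n" for xs f
    using multilinearD(2)[OF forms_multilinear that assms(2), of f c "xs ! 0"] that by (simp add: pure_def)
  have "row_tensor n (\<lambda>_ \<phi>. c * L \<phi>) = (\<lambda>f. \<Sum>xs\<leftarrow>map (\<lambda>xs. xs[0 := sm c (xs ! 0)]) xss. pure A xs f)"
  proof
    fix f
    have "row_tensor n (\<lambda>_ \<phi>. c * L \<phi>) f = c * (\<Sum>xs\<leftarrow>xss. pure A xs f)"
      using row_tensor_scale[of n "\<lambda>_. L" c f] scale x(2) by (simp add: finite_rows_def)
    also have "\<dots> = (\<Sum>xs\<leftarrow>xss. pure A (xs[0 := sm c (xs ! 0)]) f)"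
      using x(1) by (induction xss) (auto simp: s algebra_simps)
    finally show "row_tensor n (\<lambda>_ \<phi>. c * L \<phi>) f = (\<Sum>xs\<leftarrow>map (\<lambda>xs. xs[0 := sm c (xs ! 0)]) xss. pure A xs f)"
      by (simp add: comp_def)
  qed
  moreover have "\<forall>xs\<in>set (map (\<lambda>xs. xs[0 := sm c (xs ! 0)]) xss). length xs = n" using x by auto
  ultimately show ?case unfolding alg_tensors_def by blast
qed

text \<open>The row at \<open>as\<close> is \<open>h\<^sub>a\<^sub>s\<close> times the algebraic tensor of \<open>row_tensor_const_alg_tensors\<close>.\<close>

lemma row_tensor_tensors:
  assumes T: "finite_rows n T" and n: "n > 0"
  shows "row_tensor n T \<in> tensors A n"
proof -
  let ?u = "\<lambda>as. row_tensor n (\<lambda>as' \<phi>. if as' = as then T as \<phi> else 0)"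
  have finite_rows: "finite_rows n (\<lambda>as' \<phi>. if as' = as then T as \<phi> else 0)" for as
    unfolding finite_rows_def
  proof (intro allI impI)
    fix as' :: "'x list" assume "length as' = n"
    then show "(\<lambda>\<phi>. if as' = as then T as \<phi> else 0) \<in> fin_functionals {bs. length bs = n}"
      using T by (cases "as' = as") (auto simp: finite_rows_def intro: fin_functionals.zero)
  qed
  have "has_formal_sum ?u {as. length as = n} (row_tensor n T)"
    by (rule has_formal_sum_row_tensor[OF finite_rows T], rule_tac x = "{cs}" in exI) auto
  moreover have "?u as \<in> tmult A (pure A (map h as)) ` alg_tensors A n" if l: "length as = n" for as
  proof -
    have La: "T as \<in> fin_functionals {bs. length bs = n}" using T l by (simp add: finite_rows_def)
    have p: "pure_row (map h as) as' \<phi> = (if as' = as then \<phi> (map (\<lambda>_. e) as) else 0)"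
      if "length as' = length as" for as as' \<phi>
      using that
      by (induction as arbitrary: as' \<phi>) (auto simp: row_h length_Suc_conv split: if_splits)
    have c: "conj_list (map (\<lambda>_. e) as) as = as" for as by (induction as) auto
    have b: "mult_list (map (\<lambda>_. e) as) ds = ds" if "length ds = length as" for as ds
      using that by (induction as arbitrary: ds) (auto simp: length_Suc_conv)
    have L: "finite_rows n (\<lambda>_. T as)" using La by (simp add: finite_rows_def)
    have ph: "finite_rows n (pure_row (map h as))" by (rule finite_rows_pure_row) (use l in simp)
    have "tmult A (pure A (map h as)) (row_tensor n (\<lambda>_. T as)) = row_tensor n (\<lambda>as' \<phi>.
        pure_row (map h as) as' (\<lambda>bs. T as (\<lambda>ds. \<phi> (mult_list bs ds))))"
      using tmult_row_tensor(1)[OF ph L] l by (simp add: pure_row_tensor)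
    also have "\<dots> = ?u as"
    proof (rule row_tensor_cong)
      fix as' :: "'x list" and \<phi> assume "length as' = n"
      moreover have "T as (\<lambda>ds. \<phi> (mult_list (map (\<lambda>_. e) as) ds)) = T as \<phi>"
        by (rule fin_functional_cong[OF La]) (simp add: b l)
      ultimately show "pure_row (map h as) as' (\<lambda>bs. T as (\<lambda>ds. \<phi> (mult_list bs ds))) = (if as' = as then T as \<phi> else 0)"
        by (simp add: p l)
    qed
    finally show ?thesis using row_tensor_const_alg_tensors[OF La n] by (metis image_eqI)
  qed
  ultimately show ?thesis unfolding tensors_def by auto
qed

section \<open>Coproduct and counit\<close>

lemma len1: "length as = Suc 0 \<longleftrightarrow> (\<exists>a. as = [a])"
  by (auto simp: length_Suc_conv)
lemma len2: "length as = 2 \<longleftrightarrow> (\<exists>a b. as = [a, b])"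
  by (auto simp: length_Suc_conv numeral_eq_Suc)
lemma len3: "length as = 3 \<longleftrightarrow> (\<exists>a b c. as = [a, b, c])"
  by (auto simp: length_Suc_conv numeral_eq_Suc)

lemma star_eq_iff [simp]: "star a = star b \<longleftrightarrow> a = b"
  by (metis inverse_inverse)

lemma row_if: "row x a (\<lambda>b. if P then \<phi> b else 0) = (if P then row x a \<phi> else 0)"
  by (simp add: fin_functional_zero[OF row_fin])

lemma row_tensor_addI:
  assumes "finite_rows n T" "finite_rows n T'" "\<And>as \<phi>. length as = n \<Longrightarrow> U as \<phi> = T as \<phi> + T' as \<phi>"
  shows "row_tensor n U f = row_tensor n T f + row_tensor n T' f"
  using row_tensor_add[OF assms(1,2)] row_tensor_cong[of n U "\<lambda>as \<phi>. T as \<phi> + T' as \<phi>", OF assms(3)] by simp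

lemma row_tensor_scaleI:
  assumes "finite_rows n T" "\<And>as \<phi>. length as = n \<Longrightarrow> U as \<phi> = c * T as \<phi>"
  shows "row_tensor n U f = c * row_tensor n T f"
  using row_tensor_scale[OF assms(1)] row_tensor_cong[of n U "\<lambda>as \<phi>. c * T as \<phi>", OF assms(2)] by simp

text \<open>\<open>\<Delta> (h\<^sub>c q\<^sub>b) = \<Sum>\<^bsub>a a' = c\<^esub> h\<^sub>a q\<^sub>b \<otimes> h\<^sub>a\<^sub>' q\<^sub>b\<close> in terms of rows: the row of \<open>\<Delta> x\<close> at \<open>(a, a')\<close> is the row of
\<open>x\<close> at \<open>a a'\<close>, placed on the diagonal. Multiplicativity then says that conjugation is a homomorphism.\<close>

definition coproduct_row :: "'a \<Rightarrow> 'x list \<Rightarrow> ('x list \<Rightarrow> 'k) \<Rightarrow> 'k" where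
  "coproduct_row x as \<phi> = row x (as ! 0 \<bullet> as ! 1) (\<lambda>b. \<phi> [b, b])"

definition coproduct :: "'a \<Rightarrow> ('k, 'a) tens" where
  "coproduct x = row_tensor 2 (coproduct_row x)"

definition counit :: "'a \<Rightarrow> 'k" where
  "counit x = row x e (\<lambda>_. 1)"

lemma finite_rows_coproduct_row: "finite_rows 2 (coproduct_row x)"
  unfolding finite_rows_def
proof (intro allI impI)
  fix as :: "'x list"
  have "(\<lambda>\<phi>. row x (as ! 0 \<bullet> as ! 1) (\<lambda>b. \<phi> [b, b])) \<in> fin_functionals {bs. length bs = 2}"
    by (rule fin_functional_map[OF row_fin]) simp
  then show "coproduct_row x as \<in> fin_functionals {bs. length bs = 2}" by (simp add: coproduct_row_def[abs_def])
qed

lemma coproduct_add: "coproduct (x + y) f = coproduct x f + coproduct y f"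
  unfolding coproduct_def by (rule row_tensor_addI[OF finite_rows_coproduct_row finite_rows_coproduct_row]) (simp add: coproduct_row_def row_add)

lemma coproduct_smul: "coproduct (sm c x) f = c * coproduct x f"
  unfolding coproduct_def by (rule row_tensor_scaleI[OF finite_rows_coproduct_row]) (simp add: coproduct_row_def row_smul)

lemma coproduct_mult: "coproduct (x * y) = tmult A (coproduct x) (coproduct y)"
  unfolding coproduct_def tmult_row_tensor(1)[OF finite_rows_coproduct_row finite_rows_coproduct_row]
  by (rule row_tensor_cong) (auto simp: len2 coproduct_row_def row_mult assoc)

lemma coproduct_one: "coproduct 1 = pure A [1, 1]"
  unfolding coproduct_def
  by (subst pure_row_tensor[of _ 2], simp) (rule row_tensor_cong, auto simp: len2 coproduct_row_def row_one)

lemma coproduct_q: "coproduct (q a) = pure A [q a, q a]"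
  unfolding coproduct_def
  by (subst pure_row_tensor[of _ 2], simp) (rule row_tensor_cong, auto simp: len2 coproduct_row_def row_q)

lemma coproduct_h:
  "has_formal_sum (\<lambda>(b, c). pure A [h b, h c]) {(b, c). b \<bullet> c = a} (coproduct (h a))"
proof -
  have "has_formal_sum (\<lambda>i. row_tensor 2 (pure_row [h (fst i), h (snd i)])) {(b, c). b \<bullet> c = a} (row_tensor 2 (coproduct_row (h a)))"
  proof (rule has_formal_sum_row_tensor[OF finite_rows_pure_row finite_rows_coproduct_row])
    fix cs :: "'x list" assume "length cs = 2"
    then obtain b c where cs: "cs = [b, c]" by (auto simp: len2)
    have p: "pure_row [h (fst i), h (snd i)] cs \<phi> = (if i = (b, c) then \<phi> [e, e] else 0)" for i \<phi>
      by (cases i) (simp add: cs row_h)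
    have d: "coproduct_row (h a) cs \<phi> = (if b \<bullet> c = a then \<phi> [e, e] else 0)" for \<phi>
      by (simp add: cs row_h coproduct_row_def)
    show "\<exists>K. finite K \<and> K \<subseteq> {(b, c). b \<bullet> c = a} \<and>
        (\<forall>i\<in>{(b, c). b \<bullet> c = a} - K. \<forall>\<phi>. pure_row [h (fst i), h (snd i)] cs \<phi> = 0) \<and>
        (\<forall>\<phi>. coproduct_row (h a) cs \<phi> = (\<Sum>i\<in>K. pure_row [h (fst i), h (snd i)] cs \<phi>))"
      unfolding p d by (rule exI[of _ "if b \<bullet> c = a then {(b, c)} else {}"]) simp
  qed simp
  then show ?thesis
    unfolding coproduct_def
    by (rule has_formal_sum_cong[THEN iffD1, rotated]) (auto simp: pure_row_tensor[of _ 2])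
qed

lemma counit_simps:
  "counit (x + y) = counit x + counit y" "counit (sm c x) = c * counit x"
  "counit (x * y) = counit x * counit y" "counit 1 = 1" "counit (q a) = 1"
  "counit (h a) = (if a = e then 1 else 0)"
proof -
  have "row x e (\<lambda>b. row y e (\<lambda>_. 1)) = row y e (\<lambda>_. 1) * row x e (\<lambda>_. 1)"
    by (rule fin_functional_const[OF row_fin])
  then show "counit (x * y) = counit x * counit y"
    by (simp add: counit_def row_mult)
qed (auto simp: counit_def row_add row_smul row_one row_q row_h)

section \<open>Antipode\<close>

text \<open>Unlike the coproduct, the antipode takes values in \<open>A\<close> itself, so it is obtained from the free algebra
and not from rows.\<close>

fun anti_gen :: "'x rack_gen \<Rightarrow> 'a" where
  "anti_gen (GQ a) = qinv A a"
| "anti_gen (GQinv a) = q a"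
| "anti_gen (GH a) = h (star a)"

definition free_anti :: "('x rack_gen, 'k) free_alg \<Rightarrow> 'a" where
  "free_anti = linear_extension sm (\<lambda>w. prod_list (rev (map anti_gen (letters w))))"

definition antipode :: "'a \<Rightarrow> 'a" where
  "antipode x = free_anti (SOME p. eval_alg A p = x)"

lemma free_anti_add: "free_anti (p + r) = free_anti p + free_anti r"
  and free_anti_single: "free_anti (Poly_Mapping.single w c) = sm c (prod_list (rev (map anti_gen (letters w))))"
  unfolding free_anti_def
  by (simp_all add: linear_extension_add[OF vector_space_axioms] linear_extension_single[OF vector_space_axioms])

lemma free_anti_mult: "free_anti (p * r) = free_anti r * free_anti p"
proof -
  have *: "free_anti (Poly_Mapping.single w c * r) = free_anti r * free_anti (Poly_Mapping.single w c)" for w c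
    by (rule poly_mapping_additive_eq[of "\<lambda>r. free_anti (Poly_Mapping.single w c * r)"
          "\<lambda>r. free_anti r * free_anti (Poly_Mapping.single w c)"])
      (auto simp: free_anti_add free_anti_single algebra_simps mult_single plus_word_def)
  show ?thesis
    by (rule poly_mapping_additive_eq[of "\<lambda>p. free_anti (p * r)" "\<lambda>p. free_anti r * free_anti p"])
      (auto simp only: * free_anti_add distrib_left distrib_right)
qed

lemma free_anti_simps:
  "free_anti 1 = 1" "free_anti (gen_var g) = anti_gen g"
  "free_anti (p - r) = free_anti p - free_anti r" "free_anti 0 = 0"
  "finite I \<Longrightarrow> free_anti (\<Sum>i\<in>I. g' i) = (\<Sum>i\<in>I. free_anti (g' i))"
  using additive_uminus[of free_anti, OF free_anti_add]
  by (simp_all add: free_alg_one gen_var_def free_anti_single)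

lemma sum_h_one:
  assumes "finite (UNIV :: 'x set)" shows "hsum UNIV = 1"
proof -
  have "(\<Sum>a\<in>UNIV. gen_var (GH a)) - 1 \<in> relators"
    using assms by (simp add: norm_relators_def)
  from eval_alg_eqI[OF this] assms show ?thesis by (simp add: eval_simps)
qed

text \<open>Inversion reverses products and exchanges \<open>h\<^sub>a\<close> with \<open>h\<^bsub>a\<^sup>-\<^sup>1\<^esub>\<close>, which maps each relation to a
consequence of the relations.\<close>

lemma free_anti_relator: assumes "r \<in> relators" shows "free_anti r = 0"
proof -
  have "bij star" by (rule bij_betw_byWitness[of _ star]) auto
  then have star_sum: "hsum UNIV = (\<Sum>a\<in>UNIV. h (star a))"
    by (simp add: sum.reindex_bij_betw)
  show ?thesis
    using assms unfolding rack_relators_def norm_relators_def strong_hom_relators_def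
    by (auto simp: free_anti_simps free_anti_mult power2_eq_square tr_eq qinv_eq q_mult q_e h_orth h_q
        assoc inverse_distrib_swap star_sum[symmetric] sum_h_one split: if_splits)
qed

lemma antipode_eval: "antipode (eval_alg A p) = free_anti p"
  unfolding antipode_def
proof (rule presented_factor[where L = free_anti, OF presented free_anti_add])
  fix p assume "p \<in> two_sided_ideal relators"
  then show "free_anti p = 0"
    by (rule two_sided_ideal_vanish[where L = free_anti, OF free_anti_add, rotated -1])
      (simp_all add: free_anti_mult free_anti_relator)
qed

lemma antipode_add: "antipode (x + y) = antipode x + antipode y"
  and antipode_mult: "antipode (x * y) = antipode y * antipode x"
proof -
  obtain p r where "x = eval_alg A p" "y = eval_alg A r" using eval_surj by metis
  then show "antipode (x + y) = antipode x + antipode y" "antipode (x * y) = antipode y * antipode x"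
    by (simp_all add: antipode_eval free_anti_add free_anti_mult flip: eval_simps(1,2))
qed

lemma antipode_gens:
  "antipode 1 = 1" "antipode (q a) = qinv A a" "antipode (qinv A a) = q a" "antipode (h a) = h (star a)"
  using antipode_eval[of 1] antipode_eval[of "gen_var (GQ a)"] antipode_eval[of "gen_var (GQinv a)"]
    antipode_eval[of "gen_var (GH a)"] by (simp_all add: eval_simps free_anti_simps)

lemma antipode_smul: "antipode (sm c x) = sm c (antipode x)"
proof -
  have "antipode (sm c 1) = sm c 1"
    using antipode_eval[of "Poly_Mapping.single (Word []) c"]
    by (simp add: eval_alg_single[OF kalg] free_anti_single)
  then show ?thesis using antipode_mult[of "sm c 1" x] by simp
qed

section \<open>Coassociativity\<close>

abbreviation coproduct_left_row :: "'a \<Rightarrow> 'a \<Rightarrow> 'x list \<Rightarrow> ('x list \<Rightarrow> 'k) \<Rightarrow> 'k" where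
  "coproduct_left_row x y as \<phi> \<equiv> row x (as ! 0 \<bullet> as ! 1) (\<lambda>b. row y (as ! 2) (\<lambda>d. \<phi> [b, b, d]))"

abbreviation coproduct_right_row :: "'a \<Rightarrow> 'a \<Rightarrow> 'x list \<Rightarrow> ('x list \<Rightarrow> 'k) \<Rightarrow> 'k" where
  "coproduct_right_row x y as \<phi> \<equiv> row x (as ! 0) (\<lambda>b. row y (as ! 1 \<bullet> as ! 2) (\<lambda>d. \<phi> [b, d, d]))"

lemma pure_singleton_row_tensor: "pure A [x] = row_tensor 1 (pure_row [x])"
  by (rule pure_row_tensor) simp

lemma coproduct_tprod_pure: "tprod A (coproduct x) (pure A [y]) = row_tensor 3 (coproduct_left_row x y)" "finite_rows 3 (coproduct_left_row x y)"
proof -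
  let ?V = "\<lambda>as \<phi>. coproduct_row x (take 2 as) (\<lambda>bs. pure_row [y] (drop 2 as) (\<lambda>ds. \<phi> (bs @ ds)))"
  have p: "finite_rows 1 (pure_row [y])" by (rule finite_rows_pure_row) simp
  have eq: "coproduct_left_row x y as \<phi> = ?V as \<phi>" if "length as = 3" for as \<phi>
    using that by (auto simp: len3 coproduct_row_def)
  have "finite_rows 3 ?V" using tprod_row_tensor(2)[OF finite_rows_coproduct_row p] by simp
  with eq show "finite_rows 3 (coproduct_left_row x y)" by (rule finite_rows_cong)
  have "tprod A (coproduct x) (pure A [y]) = row_tensor 3 ?V"
    using tprod_row_tensor(1)[OF finite_rows_coproduct_row p] by (simp add: coproduct_def pure_row_tensor[of _ 1])
  also have "\<dots> = row_tensor 3 (coproduct_left_row x y)" by (rule row_tensor_cong) (rule eq[symmetric])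
  finally show "tprod A (coproduct x) (pure A [y]) = row_tensor 3 (coproduct_left_row x y)" .
qed

lemma pure_tprod_coproduct: "tprod A (pure A [x]) (coproduct y) = row_tensor 3 (coproduct_right_row x y)" "finite_rows 3 (coproduct_right_row x y)"
proof -
  let ?V = "\<lambda>as \<phi>. pure_row [x] (take 1 as) (\<lambda>bs. coproduct_row y (drop 1 as) (\<lambda>ds. \<phi> (bs @ ds)))"
  have p: "finite_rows 1 (pure_row [x])" by (rule finite_rows_pure_row) simp
  have eq: "coproduct_right_row x y as \<phi> = ?V as \<phi>" if "length as = 3" for as \<phi>
    using that by (auto simp: len3 coproduct_row_def)
  have three: "1 + 2 = (3 :: nat)" by simp
  have "finite_rows 3 ?V" by (rule tprod_row_tensor(2)[OF p finite_rows_coproduct_row, unfolded three])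
  with eq show "finite_rows 3 (coproduct_right_row x y)" by (rule finite_rows_cong)
  have "tprod A (pure A [x]) (coproduct y) = row_tensor 3 ?V"
    using tprod_row_tensor(1)[OF p finite_rows_coproduct_row[of y], unfolded three] by (simp only: coproduct_def pure_singleton_row_tensor)
  also have "\<dots> = row_tensor 3 (coproduct_right_row x y)" by (rule row_tensor_cong) (rule eq[symmetric])
  finally show "tprod A (pure A [x]) (coproduct y) = row_tensor 3 (coproduct_right_row x y)" .
qed

lemma multilinear_coproduct_tprod_pure:
  "multilinear sm (*) 2 (\<lambda>xs. tprod A (coproduct (xs ! 0)) (pure A [xs ! 1]) f)"
  unfolding coproduct_tprod_pure(1)
  by (rule multilinear2I;
      (rule row_tensor_addI[OF coproduct_tprod_pure(2) coproduct_tprod_pure(2)] | rule row_tensor_scaleI[OF coproduct_tprod_pure(2)]);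
      simp add: row_add row_smul fin_functional_add[OF row_fin] fin_functional_scale[OF row_fin])

lemma multilinear_pure_tprod_coproduct:
  "multilinear sm (*) 2 (\<lambda>xs. tprod A (pure A [xs ! 0]) (coproduct (xs ! 1)) f)"
  unfolding pure_tprod_coproduct(1)
  by (rule multilinear2I;
      (rule row_tensor_addI[OF pure_tprod_coproduct(2) pure_tprod_coproduct(2)] | rule row_tensor_scaleI[OF pure_tprod_coproduct(2)]);
      simp add: row_add row_smul fin_functional_add[OF row_fin] fin_functional_scale[OF row_fin])

definition coproduct_row3 :: "'a \<Rightarrow> 'x list \<Rightarrow> ('x list \<Rightarrow> 'k) \<Rightarrow> 'k" where
  "coproduct_row3 x as \<phi> = row x (as ! 0 \<bullet> as ! 1 \<bullet> as ! 2) (\<lambda>b. \<phi> [b, b, b])"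

lemma finite_rows_coproduct_row3: "finite_rows 3 (coproduct_row3 x)"
  unfolding finite_rows_def
proof (intro allI impI)
  fix as :: "'x list"
  have "(\<lambda>\<phi>. row x (as ! 0 \<bullet> as ! 1 \<bullet> as ! 2) (\<lambda>b. \<phi> [b, b, b])) \<in> fin_functionals {bs. length bs = 3}"
    by (rule fin_functional_map[OF row_fin]) simp
  then show "coproduct_row3 x as \<in> fin_functionals {bs. length bs = 3}" by (simp add: coproduct_row3_def[abs_def])
qed

text \<open>Applying \<open>\<Delta> \<otimes> id\<close> pulls rows back along \<open>(a, b, c) \<mapsto> (a b, c)\<close> and doubles the first group element. This
one computation gives a half of coassociativity and one of the two identities for \<open>R\<close>.\<close>

lemma lifts_coproduct_left:
  assumes T: "finite_rows 2 T" and V: "finite_rows 3 V"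
    and eq: "\<And>a b c \<phi>. V [a, b, c] \<phi> = T [a \<bullet> b, c] (\<lambda>bs. \<phi> [bs ! 0, bs ! 0, bs ! 1])"
  shows "lifts_to A 2 (\<lambda>xs. tprod A (coproduct (xs ! 0)) (pure A [xs ! 1])) (row_tensor 2 T) (row_tensor 3 V)"
proof (rule lifts_row_tensor[OF T multilinear_coproduct_tprod_pure])
  have T_if: "T [a, b] (\<lambda>bs. if P then \<phi> bs else 0) = (if P then T [a, b] \<phi> else 0)" for a b P \<phi>
    using finite_rows_vanish[OF T, of "[a, b]"] by simp
  let ?U = "\<lambda>as bs. coproduct_left_row (h (as ! 0) * q (bs ! 0)) (h (as ! 1) * q (bs ! 1))"
  show "has_formal_sum (\<lambda>as f. T as (\<lambda>bs. tprod A (coproduct (basis as bs ! 0)) (pure A [basis as bs ! 1]) f))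
      {as. length as = 2} (row_tensor 3 V)"
  proof (rule has_formal_sum_rows[OF T _ _ V, where U = ?U
        and B = "\<lambda>xs. tprod A (coproduct (xs ! 0)) (pure A [xs ! 1])"])
    fix as bs :: "'x list" assume l: "length as = 2" "length bs = 2"
    then show "tprod A (coproduct (basis as bs ! 0)) (pure A [basis as bs ! 1]) = row_tensor 3 (?U as bs)"
      by (auto simp: len2 coproduct_tprod_pure(1))
    show "finite_rows 3 (?U as bs)" by (rule coproduct_tprod_pure(2))
  next
    fix cs :: "'x list" assume "length cs = 3"
    then obtain a b c where cs: "cs = [a, b, c]" by (auto simp: len3)
    have T_U: "T as (\<lambda>bs. ?U as bs cs \<phi>) = (if as = [a \<bullet> b, c] then V cs \<phi> else 0)" if "length as = 2" for as \<phi>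
      using that by (auto simp: len2 cs row_hq eq T_if cong: if_cong split: if_splits)
    show "\<exists>K. finite K \<and> K \<subseteq> {as. length as = 2} \<and>
        (\<forall>as\<in>{as. length as = 2} - K. \<forall>\<phi>. T as (\<lambda>bs. ?U as bs cs \<phi>) = 0) \<and>
        (\<forall>\<phi>. V cs \<phi> = (\<Sum>as\<in>K. T as (\<lambda>bs. ?U as bs cs \<phi>)))"
    proof (intro exI[of _ "{[a \<bullet> b, c]}"] conjI ballI allI)
      show "T as (\<lambda>bs. ?U as bs cs \<phi>) = 0" if "as \<in> {as. length as = 2} - {[a \<bullet> b, c]}" for as \<phi>
        using T_U[of as \<phi>] that by simp
      show "V cs \<phi> = (\<Sum>as\<in>{[a \<bullet> b, c]}. T as (\<lambda>bs. ?U as bs cs \<phi>))" for \<phi>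
        using T_U[of "[a \<bullet> b, c]" \<phi>] by simp
    qed simp_all
  qed
qed

lemma lifts_coproduct_right:
  assumes T: "finite_rows 2 T" and V: "finite_rows 3 V"
    and eq: "\<And>a b c \<phi>. V [a, b, c] \<phi> = T [a, b \<bullet> c] (\<lambda>bs. \<phi> [bs ! 0, bs ! 1, bs ! 1])"
  shows "lifts_to A 2 (\<lambda>xs. tprod A (pure A [xs ! 0]) (coproduct (xs ! 1))) (row_tensor 2 T) (row_tensor 3 V)"
proof (rule lifts_row_tensor[OF T multilinear_pure_tprod_coproduct])
  have T_if: "T [a, b] (\<lambda>bs. if P then \<phi> bs else 0) = (if P then T [a, b] \<phi> else 0)" for a b P \<phi>
    using finite_rows_vanish[OF T, of "[a, b]"] by simp
  let ?U = "\<lambda>as bs. coproduct_right_row (h (as ! 0) * q (bs ! 0)) (h (as ! 1) * q (bs ! 1))"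
  show "has_formal_sum (\<lambda>as f. T as (\<lambda>bs. tprod A (pure A [basis as bs ! 0]) (coproduct (basis as bs ! 1)) f))
      {as. length as = 2} (row_tensor 3 V)"
  proof (rule has_formal_sum_rows[OF T _ _ V, where U = ?U
        and B = "\<lambda>xs. tprod A (pure A [xs ! 0]) (coproduct (xs ! 1))"])
    fix as bs :: "'x list" assume l: "length as = 2" "length bs = 2"
    then show "tprod A (pure A [basis as bs ! 0]) (coproduct (basis as bs ! 1)) = row_tensor 3 (?U as bs)"
      by (auto simp: len2 pure_tprod_coproduct(1))
    show "finite_rows 3 (?U as bs)" by (rule pure_tprod_coproduct(2))
  next
    fix cs :: "'x list" assume "length cs = 3"
    then obtain a b c where cs: "cs = [a, b, c]" by (auto simp: len3)
    have T_U: "T as (\<lambda>bs. ?U as bs cs \<phi>) = (if as = [a, b \<bullet> c] then V cs \<phi> else 0)" if "length as = 2" for as \<phi>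
      using that by (auto simp: len2 cs row_hq eq T_if cong: if_cong split: if_splits)
    show "\<exists>K. finite K \<and> K \<subseteq> {as. length as = 2} \<and>
        (\<forall>as\<in>{as. length as = 2} - K. \<forall>\<phi>. T as (\<lambda>bs. ?U as bs cs \<phi>) = 0) \<and>
        (\<forall>\<phi>. V cs \<phi> = (\<Sum>as\<in>K. T as (\<lambda>bs. ?U as bs cs \<phi>)))"
    proof (intro exI[of _ "{[a, b \<bullet> c]}"] conjI ballI allI)
      show "T as (\<lambda>bs. ?U as bs cs \<phi>) = 0" if "as \<in> {as. length as = 2} - {[a, b \<bullet> c]}" for as \<phi>
        using T_U[of as \<phi>] that by simp
      show "V cs \<phi> = (\<Sum>as\<in>{[a, b \<bullet> c]}. T as (\<lambda>bs. ?U as bs cs \<phi>))" for \<phi>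
        using T_U[of "[a, b \<bullet> c]" \<phi>] by simp
    qed simp_all
  qed
qed

lemma coassociative:
  "\<exists>z \<in> tensors A 3.
        lifts_to A 2 (\<lambda>xs. tprod A (coproduct (xs ! 0)) (pure A [xs ! 1])) (coproduct x) z \<and>
        lifts_to A 2 (\<lambda>xs. tprod A (pure A [xs ! 0]) (coproduct (xs ! 1))) (coproduct x) z"
proof (intro bexI conjI)
  show "lifts_to A 2 (\<lambda>xs. tprod A (coproduct (xs ! 0)) (pure A [xs ! 1])) (coproduct x) (row_tensor 3 (coproduct_row3 x))"
    unfolding coproduct_def[of x]
    by (rule lifts_coproduct_left[OF finite_rows_coproduct_row finite_rows_coproduct_row3]) (simp add: coproduct_row_def coproduct_row3_def)
  show "lifts_to A 2 (\<lambda>xs. tprod A (pure A [xs ! 0]) (coproduct (xs ! 1))) (coproduct x) (row_tensor 3 (coproduct_row3 x))"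
    unfolding coproduct_def[of x]
    by (rule lifts_coproduct_right[OF finite_rows_coproduct_row finite_rows_coproduct_row3]) (simp add: coproduct_row_def coproduct_row3_def assoc)
  show "row_tensor 3 (coproduct_row3 x) \<in> tensors A 3" by (rule row_tensor_tensors[OF finite_rows_coproduct_row3]) simp
qed

section \<open>Counit and antipode axioms\<close>

lemma pure_singleton: "pure A [x + y] f = pure A [x] f + pure A [y] f" "pure A [sm c x] f = c * pure A [x] f"
proof -
  have "finite_rows 1 (pure_row [x])" for x by (rule finite_rows_pure_row) simp
  note a = row_tensor_addI[OF this this] row_tensor_scaleI[OF this]
  show "pure A [x + y] f = pure A [x] f + pure A [y] f"
    unfolding pure_singleton_row_tensor by (rule a(1)) (auto simp: len1 row_add)
  show "pure A [sm c x] f = c * pure A [x] f"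
    unfolding pure_singleton_row_tensor by (rule a(2)) (auto simp: len1 row_smul)
qed

text \<open>Lifts along a bilinear map \<open>A \<times> A \<rightarrow> A\<close>, for the counit and antipode axioms. The set \<open>K\<close> must be
found for each index \<open>c\<close> because multiplication does not respect all formal sums.\<close>

lemma lifts_multiplication:
  assumes T: "finite_rows 2 T"
    and g: "\<And>x x' z. g (x + x') z = g x z + g x' z" "\<And>x x' z. g z (x + x') = g z x + g z x'"
      "\<And>c x z. g (sm c x) z = sm c (g x z)" "\<And>c x z. g z (sm c x) = sm c (g z x)"
    and K: "\<And>c. \<exists>K. finite K \<and> K \<subseteq> {as. length as = 2} \<and>
      (\<forall>a b \<phi>. [a, b] \<notin> K \<longrightarrow>
        T [a, b] (\<lambda>bs. row (g (h a * q (bs ! 0)) (h b * q (bs ! 1))) c (\<lambda>d. \<phi> [d])) = 0) \<and>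
      (\<forall>\<phi>. row y c (\<lambda>d. \<phi> [d]) =
        (\<Sum>as\<in>K. T as (\<lambda>bs. row (g (h (as ! 0) * q (bs ! 0)) (h (as ! 1) * q (bs ! 1))) c (\<lambda>d. \<phi> [d]))))"
  shows "lifts_to A 2 (\<lambda>xs. pure A [g (xs ! 0) (xs ! 1)]) (row_tensor 2 T) (pure A [y])"
proof (rule lifts_row_tensor[OF T])
  show "multilinear sm (*) 2 (\<lambda>xs. pure A [g (xs ! 0) (xs ! 1)] f)" for f
    by (rule multilinear2I) (simp_all add: g pure_singleton)
  have p: "finite_rows 1 (pure_row [x])" "pure A [x] = row_tensor 1 (pure_row [x])" for x
    by (simp_all add: finite_rows_pure_row pure_row_tensor)
  let ?U = "\<lambda>as bs. pure_row [g (h (as ! 0) * q (bs ! 0)) (h (as ! 1) * q (bs ! 1))]"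
  show "has_formal_sum (\<lambda>as f. T as (\<lambda>bs. pure A [g (basis as bs ! 0) (basis as bs ! 1)] f))
      {as. length as = 2} (pure A [y])"
    unfolding p(2)[of y]
  proof (rule has_formal_sum_rows[OF T _ _ p(1), where U = ?U and B = "\<lambda>xs. pure A [g (xs ! 0) (xs ! 1)]"])
    fix as bs :: "'x list" assume l: "length as = 2" "length bs = 2"
    then show "pure A [g (basis as bs ! 0) (basis as bs ! 1)] = row_tensor 1 (?U as bs)"
      by (auto simp: len2 p(2))
    show "finite_rows 1 (?U as bs)" by (rule p)
  next
    fix cs :: "'x list" assume "length cs = 1"
    then obtain c where cs: "cs = [c]" by (auto simp: len1)
    obtain K where "finite K" "K \<subseteq> {as. length as = 2}"
      "\<And>a b \<phi>. [a, b] \<notin> K \<Longrightarrow>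
        T [a, b] (\<lambda>bs. row (g (h a * q (bs ! 0)) (h b * q (bs ! 1))) c (\<lambda>d. \<phi> [d])) = 0"
      "\<And>\<phi>. row y c (\<lambda>d. \<phi> [d]) =
        (\<Sum>as\<in>K. T as (\<lambda>bs. row (g (h (as ! 0) * q (bs ! 0)) (h (as ! 1) * q (bs ! 1))) c (\<lambda>d. \<phi> [d])))"
      using K[of c] by blast
    then show "\<exists>K. finite K \<and> K \<subseteq> {as. length as = 2} \<and>
        (\<forall>as\<in>{as. length as = 2} - K. \<forall>\<phi>. T as (\<lambda>bs. ?U as bs cs \<phi>) = 0) \<and>
        (\<forall>\<phi>. pure_row [y] cs \<phi> = (\<Sum>as\<in>K. T as (\<lambda>bs. ?U as bs cs \<phi>)))"
      by (intro exI[of _ K]) (auto simp: len2 cs)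
  qed
qed

lemma counit_left:
  "lifts_to A 2 (\<lambda>xs. pure A [sm (counit (xs ! 0)) (xs ! 1)]) (coproduct x) (pure A [x])"
  unfolding coproduct_def
proof (rule lifts_multiplication[OF finite_rows_coproduct_row, where g = "\<lambda>x y. sm (counit x) y"])
  fix c
  show "\<exists>K. finite K \<and> K \<subseteq> {as. length as = 2} \<and>
      (\<forall>a b \<phi>. [a, b] \<notin> K \<longrightarrow>
        coproduct_row x [a, b] (\<lambda>bs. row (sm (counit (h a * q (bs ! 0))) (h b * q (bs ! 1))) c (\<lambda>d. \<phi> [d])) = 0) \<and>
      (\<forall>\<phi>. row x c (\<lambda>d. \<phi> [d]) =
        (\<Sum>as\<in>K. coproduct_row x as (\<lambda>bs. row (sm (counit (h (as ! 0) * q (bs ! 0))) (h (as ! 1) * q (bs ! 1))) c (\<lambda>d. \<phi> [d]))))"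
    by (intro exI[of _ "{[e, c]}"])
      (auto simp: coproduct_row_def counit_simps row_smul row_hq fin_functional_zero[OF row_fin])
qed (simp_all add: counit_simps scale_left_distrib scale_right_distrib mult.commute)

lemma counit_right:
  "lifts_to A 2 (\<lambda>xs. pure A [sm (counit (xs ! 1)) (xs ! 0)]) (coproduct x) (pure A [x])"
  unfolding coproduct_def
proof (rule lifts_multiplication[OF finite_rows_coproduct_row, where g = "\<lambda>x y. sm (counit y) x"])
  fix c
  show "\<exists>K. finite K \<and> K \<subseteq> {as. length as = 2} \<and>
      (\<forall>a b \<phi>. [a, b] \<notin> K \<longrightarrow>
        coproduct_row x [a, b] (\<lambda>bs. row (sm (counit (h b * q (bs ! 1))) (h a * q (bs ! 0))) c (\<lambda>d. \<phi> [d])) = 0) \<and>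
      (\<forall>\<phi>. row x c (\<lambda>d. \<phi> [d]) =
        (\<Sum>as\<in>K. coproduct_row x as (\<lambda>bs. row (sm (counit (h (as ! 1) * q (bs ! 1))) (h (as ! 0) * q (bs ! 0))) c (\<lambda>d. \<phi> [d]))))"
    by (intro exI[of _ "{[c, e]}"])
      (auto simp: coproduct_row_def counit_simps row_smul row_hq fin_functional_zero[OF row_fin])
qed (simp_all add: counit_simps scale_left_distrib scale_right_distrib mult.commute)

lemma antipode_hq: "antipode (h a * q b) = q (star b) * h (star a)"
  by (simp add: antipode_mult antipode_gens qinv_eq)

text \<open>\<open>h\<^sub>a q\<^sub>b S(h\<^sub>a\<^sub>' q\<^sub>b) = h\<^sub>a h\<^bsub>a'\<^sup>-\<^sup>1\<^esub>\<close>, so only \<open>a' = a\<^sup>-\<^sup>1\<close> contributes, and there the coproduct row is the one at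
\<open>e\<close> that defines the counit.\<close>

lemma antipode_right:
  "lifts_to A 2 (\<lambda>xs. pure A [xs ! 0 * antipode (xs ! 1)]) (coproduct x) (pure A [sm (counit x) 1])"
  unfolding coproduct_def
proof (rule lifts_multiplication[OF finite_rows_coproduct_row, where g = "\<lambda>x y. x * antipode y"])
  fix c
  have const: "row x e (\<lambda>b. k) = counit x * k" for k
    using fin_functional_const[OF row_fin, of x e k] by (simp add: counit_def)
  have "coproduct_row x [a, b] (\<lambda>bs. row (h a * q (bs ! 0) * antipode (h b * q (bs ! 1))) c (\<lambda>d. \<phi> [d])) =
      (if a = c \<and> b = star c then counit x * \<phi> [e] else 0)" for a b \<phi>
  proof -
    have "c = star b \<longleftrightarrow> b = star c" by (metis inverse_inverse)
    then show ?thesis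
      by (cases "c = a") (simp_all add: coproduct_row_def antipode_hq row_mult row_h row_q assoc const row_if fin_functional_zero[OF row_fin] cong: if_cong)
  qed
  then show "\<exists>K. finite K \<and> K \<subseteq> {as. length as = 2} \<and>
      (\<forall>a b \<phi>. [a, b] \<notin> K \<longrightarrow>
        coproduct_row x [a, b] (\<lambda>bs. row (h a * q (bs ! 0) * antipode (h b * q (bs ! 1))) c (\<lambda>d. \<phi> [d])) = 0) \<and>
      (\<forall>\<phi>. row (sm (counit x) 1) c (\<lambda>d. \<phi> [d]) =
        (\<Sum>as\<in>K. coproduct_row x as (\<lambda>bs. row (h (as ! 0) * q (bs ! 0) * antipode (h (as ! 1) * q (bs ! 1))) c (\<lambda>d. \<phi> [d]))))"
    by (intro exI[of _ "{[c, star c]}"]) (auto simp: row_smul row_one)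
qed (simp_all add: antipode_add antipode_smul algebra_simps)

text \<open>\<open>S(h\<^sub>a q\<^sub>b) h\<^sub>a\<^sub>' q\<^sub>b\<close> is \<open>h\<^bsub>b\<^sup>-\<^sup>1 a' b\<^esub>\<close> if \<open>a a' = e\<close> and \<open>0\<close> otherwise. The index pair that contributes to \<open>h\<^sub>c\<close> thus
depends on \<open>b\<close>; finitely many pairs remain because the row of \<open>x\<close> at \<open>e\<close> has finite support.\<close>

lemma antipode_left:
  "lifts_to A 2 (\<lambda>xs. pure A [antipode (xs ! 0) * xs ! 1]) (coproduct x) (pure A [sm (counit x) 1])"
  unfolding coproduct_def
proof (rule lifts_multiplication[OF finite_rows_coproduct_row, where g = "\<lambda>x y. antipode x * y"])
  fix c
  \<comment> \<open>The pair \<open>[a, a']\<close> that reaches \<open>h\<^sub>c\<close> through \<open>b\<close>.\<close>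
  define k where "k b = [star (conj_by (star b) c), conj_by (star b) c]" for b
  have row_eq: "coproduct_row x [a, b] (\<lambda>bs. row (antipode (h a * q (bs ! 0)) * (h b * q (bs ! 1))) c (\<lambda>d. \<phi> [d])) =
      row x (a \<bullet> b) (\<lambda>d. if [a, b] = k d then \<phi> [e] else 0)" for a b \<phi>
  proof -
    have "a = star (conj_by (star d) c) \<longleftrightarrow> conj_by (star d) c = star a" for d by (metis inverse_inverse)
    then show ?thesis
      by (auto simp: coproduct_row_def antipode_hq row_mult row_h row_q assoc k_def intro!: arg_cong[of _ _ "row x (a \<bullet> b)"])
  qed
  obtain P where P: "finite P" "\<And>\<phi> \<psi>. (\<And>b. b \<in> P \<Longrightarrow> \<phi> b = \<psi> b) \<Longrightarrow> row x e \<phi> = row x e \<psi>"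
    using fin_functional_support[OF row_fin, of x e] by metis
  have kmul: "k d ! 0 \<bullet> k d ! 1 = e" for d by (simp add: k_def)
  have zero: "row x (a \<bullet> b) (\<lambda>d. if [a, b] = k d then \<phi> [e] else 0) = 0" if "[a, b] \<notin> k ` P" for a b \<phi>
  proof (cases "a \<bullet> b = e")
    case True
    have "row x e (\<lambda>d. if [a, b] = k d then \<phi> [e] else 0) = row x e (\<lambda>_. 0)"
      by (rule P(2)) (use that in auto)
    then show ?thesis using True by (simp add: fin_functional_zero[OF row_fin])
  next
    case False
    then have "[a, b] \<noteq> k d" for d using kmul[of d] by (metis nth_Cons_0 nth_Cons_Suc One_nat_def)
    then show ?thesis by (simp add: fin_functional_zero[OF row_fin])
  qed
  have sum: "(\<Sum>as\<in>k ` P. row x (as ! 0 \<bullet> as ! 1) (\<lambda>d. if as = k d then \<phi> [e] else 0)) = counit x * \<phi> [e]" for \<phi>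
  proof -
    have "(\<Sum>as\<in>k ` P. row x (as ! 0 \<bullet> as ! 1) (\<lambda>d. if as = k d then \<phi> [e] else 0)) =
        (\<Sum>as\<in>k ` P. row x e (\<lambda>d. if as = k d then \<phi> [e] else 0))"
      by (rule sum.cong) (auto simp: kmul[simplified])
    also have "\<dots> = row x e (\<lambda>d. \<Sum>as\<in>k ` P. if as = k d then \<phi> [e] else 0)"
      by (rule fin_functional_sum[OF row_fin, symmetric])
    also have "\<dots> = row x e (\<lambda>_. \<phi> [e])" by (rule P(2)) (use P(1) in simp)
    also have "\<dots> = counit x * \<phi> [e]"
      using fin_functional_const[OF row_fin, of x e "\<phi> [e]"] by (simp add: counit_def)
    finally show ?thesis .
  qed
  have row_eq': "coproduct_row x as (\<lambda>bs. row (antipode (h (as ! 0) * q (bs ! 0)) * (h (as ! 1) * q (bs ! 1))) c (\<lambda>d. \<phi> [d])) =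
      row x (as ! 0 \<bullet> as ! 1) (\<lambda>d. if as = k d then \<phi> [e] else 0)" if kP: "as \<in> k ` P" for as \<phi>
  proof -
    obtain a b where as: "as = [a, b]" using kP by (auto simp: k_def)
    show ?thesis using row_eq[of a b \<phi>] unfolding as by simp
  qed
  show "\<exists>K. finite K \<and> K \<subseteq> {as. length as = 2} \<and>
      (\<forall>a b \<phi>. [a, b] \<notin> K \<longrightarrow>
        coproduct_row x [a, b] (\<lambda>bs. row (antipode (h a * q (bs ! 0)) * (h b * q (bs ! 1))) c (\<lambda>d. \<phi> [d])) = 0) \<and>
      (\<forall>\<phi>. row (sm (counit x) 1) c (\<lambda>d. \<phi> [d]) =
        (\<Sum>as\<in>K. coproduct_row x as (\<lambda>bs. row (antipode (h (as ! 0) * q (bs ! 0)) * (h (as ! 1) * q (bs ! 1))) c (\<lambda>d. \<phi> [d]))))"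
  proof (intro exI[of _ "k ` P"] conjI allI impI)
    show "k ` P \<subseteq> {as. length as = 2}" by (auto simp: k_def)
    show "row (sm (counit x) 1) c (\<lambda>d. \<phi> [d]) =
        (\<Sum>as\<in>k ` P. coproduct_row x as (\<lambda>bs. row (antipode (h (as ! 0) * q (bs ! 0)) * (h (as ! 1) * q (bs ! 1))) c (\<lambda>d. \<phi> [d])))"
      for \<phi> using row_eq' sum by (simp add: row_smul row_one)
  qed (use P(1) zero row_eq in \<open>simp_all\<close>)
qed (simp_all add: antipode_add antipode_smul algebra_simps)

lemma hopf: "hopf_algebra A coproduct counit antipode"
  unfolding hopf_algebra_def
proof (intro conjI allI)
  show "coproduct x \<in> tensors A 2" for x
    unfolding coproduct_def by (rule row_tensor_tensors[OF finite_rows_coproduct_row]) simp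
qed (simp_all only: kalg coproduct_add coproduct_smul coproduct_mult coproduct_one counit_simps coassociative
    counit_left counit_right antipode_add antipode_smul antipode_left antipode_right fun_eq_iff simp_thms)

section \<open>The universal R-matrix\<close>

text \<open>\<open>\<R> = \<Sum>\<^bsub>a, c\<^esub> h\<^sub>a \<otimes> h\<^sub>c q\<^sub>a\<close>, after inserting \<open>\<Sum>\<^sub>c h\<^sub>c = 1\<close> in the second factor: each row is a single evaluation.
For the inverse, \<open>q\<^sub>a\<close> is replaced by \<open>q\<^sub>a\<^sup>-\<^sup>1\<close>.\<close>

definition R_row :: "'x list \<Rightarrow> ('x list \<Rightarrow> 'k) \<Rightarrow> 'k" where
  "R_row as \<phi> = \<phi> [e, as ! 0]"

definition R_inverse_row :: "'x list \<Rightarrow> ('x list \<Rightarrow> 'k) \<Rightarrow> 'k" where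
  "R_inverse_row as \<phi> = \<phi> [e, star (as ! 0)]"

lemma finite_rows_eval:
  assumes "\<And>as. length as = n \<Longrightarrow> length (g as) = n" shows "finite_rows n (\<lambda>as \<phi>. \<phi> (g as))"
  using assms by (auto simp: finite_rows_def intro: fin_functionals.eval)

lemma finite_rows_R: "finite_rows 2 R_row" "finite_rows 2 R_inverse_row"
  using finite_rows_eval[of 2 "\<lambda>as. [e, as ! 0]"] finite_rows_eval[of 2 "\<lambda>as. [e, star (as ! 0)]"]
  by (simp_all add: R_row_def[abs_def] R_inverse_row_def[abs_def])

lemma R_formal_sum: "has_formal_sum (\<lambda>a. pure A [h a, q a]) UNIV (row_tensor 2 R_row)"
proof -
  have "has_formal_sum (\<lambda>a. row_tensor 2 (pure_row [h a, q a])) UNIV (row_tensor 2 R_row)"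
  proof (rule has_formal_sum_row_tensor[OF finite_rows_pure_row finite_rows_R(1)])
    fix cs :: "'x list" assume "length cs = 2"
    then obtain b c where cs: "cs = [b, c]" by (auto simp: len2)
    show "\<exists>K. finite K \<and> K \<subseteq> UNIV \<and> (\<forall>i\<in>UNIV - K. \<forall>\<phi>. pure_row [h i, q i] cs \<phi> = 0) \<and>
        (\<forall>\<phi>. R_row cs \<phi> = (\<Sum>i\<in>K. pure_row [h i, q i] cs \<phi>))"
      by (rule exI[of _ "{b}"]) (auto simp: cs row_h row_q R_row_def)
  qed simp
  then show ?thesis by (simp add: pure_row_tensor[of _ 2])
qed

lemma R_invertible:
  "tmult A (row_tensor 2 R_row) (row_tensor 2 R_inverse_row) = pure A [1, 1]" "tmult A (row_tensor 2 R_inverse_row) (row_tensor 2 R_row) = pure A [1, 1]"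
proof -
  have p: "pure A [1, 1] = row_tensor 2 (pure_row [1, 1])" by (rule pure_row_tensor) simp
  show "tmult A (row_tensor 2 R_row) (row_tensor 2 R_inverse_row) = pure A [1, 1]" "tmult A (row_tensor 2 R_inverse_row) (row_tensor 2 R_row) = pure A [1, 1]"
    unfolding p tmult_row_tensor(1)[OF finite_rows_R] tmult_row_tensor(1)[OF finite_rows_R(2,1)]
    by (rule row_tensor_cong, auto simp: len2 R_row_def R_inverse_row_def row_one)+
qed

lemma multilinear2D:
  assumes "multilinear sm (*) 2 f"
  shows "f [x + y, b] = f [x, b] + f [y, b]" "f [b, x + y] = f [b, x] + f [b, y]"
    "f [sm c x, b] = c * (f [x, b] :: 'k)" "f [b, sm c x] = c * f [b, x]"
  using multilinearD[OF assms, of "[x, b]" 0] multilinearD[OF assms, of "[b, x]" 1] by simp_all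

lemma multilinear3D:
  assumes "multilinear sm (*) 3 f"
  shows "f [x + y, b, c] = f [x, b, c] + f [y, b, c]" "f [b, x + y, c] = f [b, x, c] + f [b, y, c]"
    "f [b, c, x + y] = f [b, c, x] + f [b, c, y]"
    "f [sm d x, b, c] = d * (f [x, b, c] :: 'k)" "f [b, sm d x, c] = d * f [b, x, c]" "f [b, c, sm d x] = d * f [b, c, x]"
  using multilinearD[OF assms, of "[x, b, c]" 0] multilinearD[OF assms, of "[b, x, c]" 1]
    multilinearD[OF assms, of "[b, c, x]" 2] by (simp_all add: numeral_2_eq_2)

text \<open>The placements of tensor legs and the flip only permute arguments or insert \<open>1\<close>, so they send forms to
forms and are computed by \<open>push\<close> without any truncation.\<close>

lemma pure_comp_forms:
  assumes len: "\<And>xs. length xs = n \<Longrightarrow> length (\<beta> xs) = m"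
    and ml: "multilinear sm (*) m f \<Longrightarrow> multilinear sm (*) n (\<lambda>xs. f (\<beta> xs))"
    and win: "\<And>F xs. finite F \<Longrightarrow> length xs = n \<Longrightarrow>
      map (\<lambda>x. hsum F * x) (\<beta> xs) = map (\<lambda>x. hsum F * x) (\<beta> (map (\<lambda>x. hsum F * x) xs))"
  shows "(\<lambda>xs. pure A (\<beta> xs) f) \<in> forms A n"
proof (cases "f \<in> forms A m")
  case True
  obtain F where F: "finite F" "\<And>xs ys. length xs = m \<Longrightarrow> length ys = m \<Longrightarrow>
    map (\<lambda>x. hsum F * x) xs = map (\<lambda>x. hsum F * x) ys \<Longrightarrow> f xs = f ys" using forms_window_map[OF True] by metis
  have "(\<lambda>xs. f (\<beta> xs)) \<in> forms A n"
    by (rule formsI[OF ml[OF forms_multilinear[OF True]] F(1)], rule F(2)) (auto simp: len intro: win[OF F(1)])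
  then show ?thesis by (subst forms_cong[of n _ "\<lambda>xs. f (\<beta> xs)"]) (simp_all add: pure_def len True)
next
  case False
  then show ?thesis by (subst forms_cong[of n _ "\<lambda>_. 0"]) (simp_all add: pure_def len forms_zero)
qed

lemma leg_forms:
  "(\<lambda>xs. pure A [xs ! 0, xs ! 1, 1] f) \<in> forms A 2" "(\<lambda>xs. pure A [xs ! 0, 1, xs ! 1] f) \<in> forms A 2"
  "(\<lambda>xs. pure A [1, xs ! 0, xs ! 1] f) \<in> forms A 2" "(\<lambda>xs. pure A [xs ! 1, xs ! 0] f) \<in> forms A 2"
  by (rule pure_comp_forms[where m = 3], simp, rule multilinear2I, simp_all add: multilinear3D len2,
      force simp: hsum_idem)+
     (rule pure_comp_forms[where m = 2], simp, rule multilinear2I, simp_all add: multilinear2D len2,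
      force simp: hsum_idem)

lemma push_pure:
  assumes T: "finite_rows 2 T" and V: "finite_rows m V"
    and len: "\<And>xs. length xs = 2 \<Longrightarrow> length (\<beta> xs) = m"
    and \<beta>: "\<And>f. (\<lambda>xs. pure A (\<beta> xs) f) \<in> forms A 2"
    and k: "\<And>cs. length cs = m \<Longrightarrow> length (k cs) = 2"
    and eq: "\<And>as cs \<phi>. length as = 2 \<Longrightarrow> length cs = m \<Longrightarrow>
      T as (\<lambda>bs. pure_row (\<beta> (basis as bs)) cs \<phi>) = (if as = k cs then V cs \<phi> else 0)"
  shows "push (row_tensor 2 T) (\<lambda>xs. pure A (\<beta> xs)) = row_tensor m V"
proof (rule push_row_tensor[OF _ \<beta>])
  show "has_formal_sum (\<lambda>as f. T as (\<lambda>bs. pure A (\<beta> (basis as bs)) f)) {as. length as = 2} (row_tensor m V)"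
  proof (rule has_formal_sum_rows[OF T _ _ V, where B = "\<lambda>xs. pure A (\<beta> xs)" and U = "\<lambda>as bs. pure_row (\<beta> (basis as bs))"])
    fix as bs :: "'x list" assume l: "length as = 2" "length bs = 2"
    show "pure A (\<beta> (basis as bs)) = row_tensor m (pure_row (\<beta> (basis as bs)))"
      by (rule pure_row_tensor[OF len]) (simp add: l)
    show "finite_rows m (pure_row (\<beta> (basis as bs)))"
      by (rule finite_rows_pure_row[OF len]) (simp add: l)
  next
    fix cs :: "'x list" assume cs: "length cs = m"
    show "\<exists>K. finite K \<and> K \<subseteq> {as. length as = 2} \<and>
        (\<forall>as\<in>{as. length as = 2} - K. \<forall>\<phi>. T as (\<lambda>bs. pure_row (\<beta> (basis as bs)) cs \<phi>) = 0) \<and>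
        (\<forall>\<phi>. V cs \<phi> = (\<Sum>as\<in>K. T as (\<lambda>bs. pure_row (\<beta> (basis as bs)) cs \<phi>)))"
      using k[OF cs] by (intro exI[of _ "{k cs}"]) (auto simp: eq cs)
  qed
qed

lemma R_legs:
  "leg12 A (row_tensor 2 R_row) = row_tensor 3 (\<lambda>cs \<phi>. \<phi> [e, cs ! 0, e])"
  "leg13 A (row_tensor 2 R_row) = row_tensor 3 (\<lambda>cs \<phi>. \<phi> [e, e, cs ! 0])"
  "leg23 A (row_tensor 2 R_row) = row_tensor 3 (\<lambda>cs \<phi>. \<phi> [e, e, cs ! 1])"
  unfolding leg12_def leg13_def leg23_def
  by (rule push_pure[OF finite_rows_R(1) finite_rows_eval _ leg_forms(1), where k = "\<lambda>cs. [cs ! 0, cs ! 1]"]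
      push_pure[OF finite_rows_R(1) finite_rows_eval _ leg_forms(2), where k = "\<lambda>cs. [cs ! 0, cs ! 2]"]
      push_pure[OF finite_rows_R(1) finite_rows_eval _ leg_forms(3), where k = "\<lambda>cs. [cs ! 1, cs ! 2]"];
      auto simp: len2 len3 R_row_def row_hq row_h row_one q_e split: if_splits)+

lemma flip_coproduct: "flip A (coproduct x) = row_tensor 2 (\<lambda>cs \<phi>. row x (cs ! 1 \<bullet> cs ! 0) (\<lambda>b. \<phi> [b, b]))"
  and finite_rows_flip: "finite_rows 2 (\<lambda>cs \<phi>. row x (cs ! 1 \<bullet> cs ! 0) (\<lambda>b. \<phi> [b, b]))"
proof -
  show a: "finite_rows 2 (\<lambda>cs \<phi>. row x (cs ! 1 \<bullet> cs ! 0) (\<lambda>b. \<phi> [b, b]))"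
    unfolding finite_rows_def by (intro allI impI fin_functional_map[OF row_fin]) simp
  show "flip A (coproduct x) = row_tensor 2 (\<lambda>cs \<phi>. row x (cs ! 1 \<bullet> cs ! 0) (\<lambda>b. \<phi> [b, b]))"
    unfolding flip_def coproduct_def
    by (rule push_pure[OF finite_rows_coproduct_row a _ leg_forms(4), where k = "\<lambda>cs. [cs ! 1, cs ! 0]"])
      (auto simp: len2 coproduct_row_def row_hq row_if cong: if_cong split: if_splits)
qed

lemma R_hexagon_right:
  "lifts_to A 2 (\<lambda>xs. tprod A (pure A [xs ! 0]) (coproduct (xs ! 1))) (row_tensor 2 R_row)
     (tmult A (leg13 A (row_tensor 2 R_row)) (leg12 A (row_tensor 2 R_row)))"
proof -
  have a: "finite_rows 3 (\<lambda>cs \<phi>. \<phi> [e, e, cs ! 0])" "finite_rows 3 (\<lambda>cs \<phi>. \<phi> [e, cs ! 0, e])"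
    by (simp_all add: finite_rows_eval)
  show ?thesis
    unfolding R_legs tmult_row_tensor(1)[OF a]
    by (rule lifts_coproduct_right[OF finite_rows_R(1) tmult_row_tensor(2)[OF a]]) (simp add: R_row_def)
qed

lemma R_hexagon_left:
  "lifts_to A 2 (\<lambda>xs. tprod A (coproduct (xs ! 0)) (pure A [xs ! 1])) (row_tensor 2 R_row)
     (tmult A (leg13 A (row_tensor 2 R_row)) (leg23 A (row_tensor 2 R_row)))"
proof -
  have a: "finite_rows 3 (\<lambda>cs \<phi>. \<phi> [e, e, cs ! 0])" "finite_rows 3 (\<lambda>cs \<phi>. \<phi> [e, e, cs ! 1])"
    by (simp_all add: finite_rows_eval)
  show ?thesis
    unfolding R_legs tmult_row_tensor(1)[OF a]
    by (rule lifts_coproduct_left[OF finite_rows_R(1) tmult_row_tensor(2)[OF a]]) (simp add: R_row_def)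
qed

text \<open>Both sides have the single row \<open>\<phi> \<mapsto> row x (a' a) (\<lambda>b. \<phi> [b, a b])\<close> at \<open>(a, a')\<close>: on the left \<open>b (b\<^sup>-\<^sup>1 a b) = a b\<close>,
on the right \<open>a (a\<^sup>-\<^sup>1 a' a) = a' a\<close>.\<close>

lemma R_intertwines: "tmult A (flip A (coproduct x)) (row_tensor 2 R_row) = tmult A (row_tensor 2 R_row) (coproduct x)"
  unfolding flip_coproduct tmult_row_tensor(1)[OF finite_rows_flip finite_rows_R(1)]
  unfolding coproduct_def tmult_row_tensor(1)[OF finite_rows_R(1) finite_rows_coproduct_row]
  by (rule row_tensor_cong) (auto simp: len2 R_row_def coproduct_row_def assoc)

lemma quasi_triangular: "quasi_triangular_hopf_algebra A coproduct counit antipode (row_tensor 2 R_row)"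
proof -
  have "row_tensor 2 R_inverse_row \<in> tensors A 2" "row_tensor 2 R_row \<in> tensors A 2"
    by (simp_all add: row_tensor_tensors finite_rows_R)
  then show ?thesis
    unfolding quasi_triangular_hopf_algebra_def
    using hopf R_invertible R_hexagon_left R_hexagon_right R_intertwines by blast
qed

end

section \<open>The quasi-triangular Hopf algebra\<close>

theorem theorem5p12:
  fixes A :: "('x::countable, 'k::field, 'a::ring_1) rack_alg"
    and tr bul :: "'x \<Rightarrow> 'x \<Rightarrow> 'x" and e :: 'x and star :: "'x \<Rightarrow> 'x"
    and R :: "('k, 'a) tens"
  assumes "group bul e star"
    and "quandle_algebra A tr bul (strong_hom_relators bul)"
    and "has_formal_sum (\<lambda>a. pure A [hgen A a, qgen A a]) UNIV R"
    and "yang_baxter A R"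
  shows "\<exists>\<Delta> \<epsilon> S.
    (\<forall>a. \<Delta> (qgen A a) = pure A [qgen A a, qgen A a] \<and>
         \<Delta> (qinv A a) = pure A [qinv A a, qinv A a] \<and>
         has_formal_sum (\<lambda>(b, c). pure A [hgen A b, hgen A c]) {(b, c). bul b c = a} (\<Delta> (hgen A a))) \<and>
    (\<forall>a. \<epsilon> (qgen A a) = 1 \<and> \<epsilon> (qinv A a) = 1 \<and> \<epsilon> (hgen A a) = (if a = e then 1 else 0)) \<and>
    (\<forall>a. S (qgen A a) = qinv A a \<and> S (qinv A a) = qgen A a \<and> S (hgen A a) = hgen A (star a)) \<and>
    (\<forall>x y. S (x * y) = S y * S x) \<and> S 1 = 1 \<and>
    quasi_triangular_hopf_algebra A \<Delta> \<epsilon> S R"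
proof -
  interpret strong_quandle_algebra bul e star A tr
    using assms(1,2) by (simp add: strong_quandle_algebra_def strong_quandle_algebra_axioms_def)
  have R: "R = row_tensor 2 R_row" by (rule has_formal_sum_unique[OF assms(3) R_formal_sum])
  show ?thesis
    unfolding R
    by (intro exI[of _ coproduct] exI[of _ counit] exI[of _ antipode] conjI allI quasi_triangular
        coproduct_q coproduct_h antipode_mult antipode_gens counit_simps)
      (simp_all add: qinv_eq coproduct_q counit_simps)
qed

end
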